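(* Let $G$ be a singular graph with finitely many vertices and no breaking vertices, and let $\overline{G}$ be its amplification. Then $C^*(G) \cong C^*(\overline{G})$.
   Context: A graph $G=(G^0,G^1,s_G,r_G)$ is a directed graph (loops and multiple edges allowed) with vertex set $G^0$, edge set $G^1$, and source and range maps $s_G,r_G:G^1\to G^0$. $C^*(G)$ is the universal $C^*$-algebra generated by mutually orthogonal projections $\{p_v : v\in G^0\}$ and partial isometries $\{s_e : e\in G^1\}$ subject to: $s_e^*s_f=0$ for $e\ne f$; $s_e^*s_e=p_{r_G(e)}$; $s_es_e^*\le p_{s_G(e)}$; and $p_v=\sum_{e\in s_G^{-1}(v)}s_es_e^*$ for every $v$ with $0<|s_G^{-1}(v)|<\infty$. The amplification $\overline{G}$ has vertex set $G^0$ and edges $e(v,w)^n$, $n\in\mathbb{N}$, from $v$ to $w$ for each pair $(v,w)$ such that $G$ has an edge from $v$ to $w$. A graph is singular if every vertex either emits infinitely many edges or is a sink (emits no edges). A set $H\subseteq G^0$ is hereditary if whenever $u\in H$ and there is a path from $u$ to $v$, then $v\in H$ (in a singular graph every vertex set is automatically saturated). A vertex $v$ is a breaking vertex if there is a hereditary set $H\subseteq G^0$ with $v\in G^0\setminus H$ such that $v$ emits infinitely many edges and $0<|s_G^{-1}(v)\cap r_G^{-1}(G^0\setminus H)|<\infty$.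
   Formalization: The graph G is additionally assumed to have countably many edges; without this the claim fails, e.g. for one vertex with uncountably many loops, where C*(G) is non-separable while the C*-algebra of the amplification is separable. *)

theory Defs
  imports "HOL-Analysis.Analysis" "HOL-Library.Poly_Mapping" "Graph_Theory.Digraph"
begin

section \<open>Complex *-algebras and C*-algebras\<close>

text \<open>
  Algebras are not assumed to have a unit, since the C*-algebra of a graph is unital only if
  the vertex set is finite. They are carrier-based because the C*-algebra of a graph depends on
  the graph, a term, and a type cannot.
\<close>

record 'a star_algebra =
  sa_carrier :: "'a set"
  sa_zero :: 'a ("\<zero>\<index>")
  sa_add :: "'a \<Rightarrow> 'a \<Rightarrow> 'a" (infixl "\<oplus>\<index>" 65)
  sa_scale :: "complex \<Rightarrow> 'a \<Rightarrow> 'a" (infixr "\<odot>\<index>" 75)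
  sa_mult :: "'a \<Rightarrow> 'a \<Rightarrow> 'a" (infixl "\<otimes>\<index>" 70)
  sa_star :: "'a \<Rightarrow> 'a" ("_\<^sup>\<star>\<index>" [1000] 999)

record 'a normed_star_algebra = "'a star_algebra" +
  sa_norm :: "'a \<Rightarrow> real"

definition sa_diff :: "('a, 'b) star_algebra_scheme \<Rightarrow> 'a \<Rightarrow> 'a \<Rightarrow> 'a" (infixl "\<ominus>\<index>" 65) where
  "x \<ominus>\<^bsub>A\<^esub> y = x \<oplus>\<^bsub>A\<^esub> (-1) \<odot>\<^bsub>A\<^esub> y"

locale star_algebra =
  fixes A :: "('a, 'b) star_algebra_scheme" (structure)
  assumes zero_closed [simp]: "\<zero> \<in> sa_carrier A"
    and add_closed [simp]: "\<lbrakk>x \<in> sa_carrier A; y \<in> sa_carrier A\<rbrakk> \<Longrightarrow> x \<oplus> y \<in> sa_carrier A"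
    and scale_closed [simp]: "x \<in> sa_carrier A \<Longrightarrow> c \<odot> x \<in> sa_carrier A"
    and mult_closed [simp]: "\<lbrakk>x \<in> sa_carrier A; y \<in> sa_carrier A\<rbrakk> \<Longrightarrow> x \<otimes> y \<in> sa_carrier A"
    and star_closed [simp]: "x \<in> sa_carrier A \<Longrightarrow> x\<^sup>\<star> \<in> sa_carrier A"
    and add_assoc: "\<lbrakk>x \<in> sa_carrier A; y \<in> sa_carrier A; z \<in> sa_carrier A\<rbrakk>
      \<Longrightarrow> (x \<oplus> y) \<oplus> z = x \<oplus> (y \<oplus> z)"
    and add_commute: "\<lbrakk>x \<in> sa_carrier A; y \<in> sa_carrier A\<rbrakk> \<Longrightarrow> x \<oplus> y = y \<oplus> x"
    and add_zero: "x \<in> sa_carrier A \<Longrightarrow> x \<oplus> \<zero> = x"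
    and add_inverse: "x \<in> sa_carrier A \<Longrightarrow> x \<oplus> (-1) \<odot> x = \<zero>"
    and scale_add: "\<lbrakk>x \<in> sa_carrier A; y \<in> sa_carrier A\<rbrakk> \<Longrightarrow> c \<odot> (x \<oplus> y) = c \<odot> x \<oplus> c \<odot> y"
    and add_scale: "x \<in> sa_carrier A \<Longrightarrow> (c + d) \<odot> x = c \<odot> x \<oplus> d \<odot> x"
    and scale_scale: "x \<in> sa_carrier A \<Longrightarrow> c \<odot> d \<odot> x = (c * d) \<odot> x"
    and scale_one: "x \<in> sa_carrier A \<Longrightarrow> 1 \<odot> x = x"
    and mult_assoc: "\<lbrakk>x \<in> sa_carrier A; y \<in> sa_carrier A; z \<in> sa_carrier A\<rbrakk>
      \<Longrightarrow> (x \<otimes> y) \<otimes> z = x \<otimes> (y \<otimes> z)"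
    and distrib_right: "\<lbrakk>x \<in> sa_carrier A; y \<in> sa_carrier A; z \<in> sa_carrier A\<rbrakk>
      \<Longrightarrow> (x \<oplus> y) \<otimes> z = x \<otimes> z \<oplus> y \<otimes> z"
    and distrib_left: "\<lbrakk>x \<in> sa_carrier A; y \<in> sa_carrier A; z \<in> sa_carrier A\<rbrakk>
      \<Longrightarrow> x \<otimes> (y \<oplus> z) = x \<otimes> y \<oplus> x \<otimes> z"
    and scale_mult_left: "\<lbrakk>x \<in> sa_carrier A; y \<in> sa_carrier A\<rbrakk> \<Longrightarrow> (c \<odot> x) \<otimes> y = c \<odot> (x \<otimes> y)"
    and scale_mult_right: "\<lbrakk>x \<in> sa_carrier A; y \<in> sa_carrier A\<rbrakk> \<Longrightarrow> x \<otimes> (c \<odot> y) = c \<odot> (x \<otimes> y)"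
    and star_star: "x \<in> sa_carrier A \<Longrightarrow> (x\<^sup>\<star>)\<^sup>\<star> = x"
    and star_add: "\<lbrakk>x \<in> sa_carrier A; y \<in> sa_carrier A\<rbrakk> \<Longrightarrow> (x \<oplus> y)\<^sup>\<star> = x\<^sup>\<star> \<oplus> y\<^sup>\<star>"
    and star_scale: "x \<in> sa_carrier A \<Longrightarrow> (c \<odot> x)\<^sup>\<star> = cnj c \<odot> x\<^sup>\<star>"
    and star_mult: "\<lbrakk>x \<in> sa_carrier A; y \<in> sa_carrier A\<rbrakk> \<Longrightarrow> (x \<otimes> y)\<^sup>\<star> = y\<^sup>\<star> \<otimes> x\<^sup>\<star>"

definition cstar_seminorm :: "('a, 'b) star_algebra_scheme \<Rightarrow> ('a \<Rightarrow> real) \<Rightarrow> bool" where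
  "cstar_seminorm A q \<longleftrightarrow>
     (\<forall>x\<in>sa_carrier A. 0 \<le> q x) \<and>
     (\<forall>x\<in>sa_carrier A. \<forall>y\<in>sa_carrier A. q (x \<oplus>\<^bsub>A\<^esub> y) \<le> q x + q y) \<and>
     (\<forall>c. \<forall>x\<in>sa_carrier A. q (c \<odot>\<^bsub>A\<^esub> x) = cmod c * q x) \<and>
     (\<forall>x\<in>sa_carrier A. \<forall>y\<in>sa_carrier A. q (x \<otimes>\<^bsub>A\<^esub> y) \<le> q x * q y) \<and>
     (\<forall>x\<in>sa_carrier A. q (x\<^sup>\<star>\<^bsub>A\<^esub> \<otimes>\<^bsub>A\<^esub> x) = (q x)\<^sup>2)"

definition cauchy_seqs :: "('a, 'b) star_algebra_scheme \<Rightarrow> ('a \<Rightarrow> real) \<Rightarrow> (nat \<Rightarrow> 'a) set" where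
  "cauchy_seqs A q = {X. (\<forall>n. X n \<in> sa_carrier A) \<and>
     (\<forall>e>0. \<exists>N. \<forall>m\<ge>N. \<forall>n\<ge>N. q (X m \<ominus>\<^bsub>A\<^esub> X n) < e)}"

locale cstar_algebra = star_algebra A for A :: "('a, 'b) normed_star_algebra_scheme" (structure) +
  assumes cstar_norm: "cstar_seminorm A (sa_norm A)"
    and norm_definite: "\<lbrakk>x \<in> sa_carrier A; sa_norm A x = 0\<rbrakk> \<Longrightarrow> x = \<zero>"
    and complete: "X \<in> cauchy_seqs A (sa_norm A)
      \<Longrightarrow> \<exists>x\<in>sa_carrier A. (\<lambda>n. sa_norm A (X n \<ominus> x)) \<longlonglongrightarrow> 0"

definition star_hom ::
  "('a, 'c) star_algebra_scheme \<Rightarrow> ('b, 'd) star_algebra_scheme \<Rightarrow> ('a \<Rightarrow> 'b) \<Rightarrow> bool" where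
  "star_hom A B \<phi> \<longleftrightarrow>
     (\<forall>x\<in>sa_carrier A. \<phi> x \<in> sa_carrier B) \<and>
     (\<forall>x\<in>sa_carrier A. \<forall>y\<in>sa_carrier A. \<phi> (x \<oplus>\<^bsub>A\<^esub> y) = \<phi> x \<oplus>\<^bsub>B\<^esub> \<phi> y) \<and>
     (\<forall>c. \<forall>x\<in>sa_carrier A. \<phi> (c \<odot>\<^bsub>A\<^esub> x) = c \<odot>\<^bsub>B\<^esub> \<phi> x) \<and>
     (\<forall>x\<in>sa_carrier A. \<forall>y\<in>sa_carrier A. \<phi> (x \<otimes>\<^bsub>A\<^esub> y) = \<phi> x \<otimes>\<^bsub>B\<^esub> \<phi> y) \<and>
     (\<forall>x\<in>sa_carrier A. \<phi> (x\<^sup>\<star>\<^bsub>A\<^esub>) = (\<phi> x)\<^sup>\<star>\<^bsub>B\<^esub>)"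

text \<open>
  No norm condition is imposed: a *-isomorphism of C*-algebras is automatically isometric.
\<close>

definition star_isomorphic ::
  "('a, 'c) star_algebra_scheme \<Rightarrow> ('b, 'd) star_algebra_scheme \<Rightarrow> bool" (infix "\<cong>\<^sub>\<star>" 50) where
  "A \<cong>\<^sub>\<star> B \<longleftrightarrow> (\<exists>\<phi>. star_hom A B \<phi> \<and> bij_betw \<phi> (sa_carrier A) (sa_carrier B))"


section \<open>Hausdorff completion with respect to a C*-seminorm\<close>

definition null_rel ::
  "('a, 'b) star_algebra_scheme \<Rightarrow> ('a \<Rightarrow> real) \<Rightarrow> ((nat \<Rightarrow> 'a) \<times> (nat \<Rightarrow> 'a)) set" where
  "null_rel A q = {(X, Y). X \<in> cauchy_seqs A q \<and> Y \<in> cauchy_seqs A q \<and>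
     (\<lambda>n. q (X n \<ominus>\<^bsub>A\<^esub> Y n)) \<longlonglongrightarrow> 0}"

definition cstar_completion ::
  "('a, 'b) star_algebra_scheme \<Rightarrow> ('a \<Rightarrow> real) \<Rightarrow> (nat \<Rightarrow> 'a) set normed_star_algebra" where
  "cstar_completion A q = \<lparr>
     sa_carrier = cauchy_seqs A q // null_rel A q,
     sa_zero = null_rel A q `` {\<lambda>n. \<zero>\<^bsub>A\<^esub>},
     sa_add = (\<lambda>S T. \<Union>X\<in>S. \<Union>Y\<in>T. null_rel A q `` {\<lambda>n. X n \<oplus>\<^bsub>A\<^esub> Y n}),
     sa_scale = (\<lambda>c S. \<Union>X\<in>S. null_rel A q `` {\<lambda>n. c \<odot>\<^bsub>A\<^esub> X n}),
     sa_mult = (\<lambda>S T. \<Union>X\<in>S. \<Union>Y\<in>T. null_rel A q `` {\<lambda>n. X n \<otimes>\<^bsub>A\<^esub> Y n}),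
     sa_star = (\<lambda>S. \<Union>X\<in>S. null_rel A q `` {\<lambda>n. (X n)\<^sup>\<star>\<^bsub>A\<^esub>}),
     sa_norm = (\<lambda>S. THE r. \<forall>X\<in>S. (\<lambda>n. q (X n)) \<longlonglongrightarrow> r) \<rparr>"

definition cstar_completion_embed ::
  "('a, 'b) star_algebra_scheme \<Rightarrow> ('a \<Rightarrow> real) \<Rightarrow> 'a \<Rightarrow> (nat \<Rightarrow> 'a) set" where
  "cstar_completion_embed A q x = null_rel A q `` {\<lambda>n. x}"


section \<open>The universal C*-algebra on generators and relations\<close>

text \<open>
  Words under concatenation form a monoid, so \<open>'a list \<Rightarrow>\<^sub>0 complex\<close> with the convolution product
  of \<^theory>\<open>HOL-Library.Poly_Mapping\<close> is the algebra of noncommutative polynomials. A letter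
  \<open>(g, False)\<close> stands for the generator \<open>g\<close>, and \<open>(g, True)\<close> for its formal adjoint.
\<close>

instantiation list :: (type) monoid_add
begin
definition zero_list :: "'a list" where "zero_list = []"
definition plus_list :: "'a list \<Rightarrow> 'a list \<Rightarrow> 'a list" where "plus_list = (@)"
instance by standard (simp_all add: zero_list_def plus_list_def)
end

type_synonym 'g star_poly = "('g \<times> bool) list \<Rightarrow>\<^sub>0 complex"

definition word_star :: "('g \<times> bool) list \<Rightarrow> ('g \<times> bool) list" where
  "word_star w = rev (map (apsnd Not) w)"

lemma word_star_word_star [simp]: "word_star (word_star w) = w"
  by (induction w) (auto simp: word_star_def rev_map[symmetric])

lift_definition poly_star :: "'g star_poly \<Rightarrow> 'g star_poly" is "\<lambda>f w. cnj (f (word_star w))"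
proof -
  fix f :: "('g \<times> bool) list \<Rightarrow> complex"
  assume "finite {w. f w \<noteq> 0}"
  moreover have "{w. cnj (f (word_star w)) \<noteq> 0} \<subseteq> word_star ` {w. f w \<noteq> 0}"
    by (auto intro!: image_eqI[of _ word_star])
  ultimately show "finite {w. cnj (f (word_star w)) \<noteq> 0}"
    by (meson finite_imageI finite_subset)
qed

definition gen :: "'g \<Rightarrow> 'g star_poly" where
  "gen g = Poly_Mapping.single [(g, False)] 1"

text \<open>
  The free (non-unital) *-algebra on the set \<open>X\<close>: the empty word is excluded.
\<close>

definition free_star_algebra :: "'g set \<Rightarrow> 'g star_poly star_algebra" where
  "free_star_algebra X = \<lparr>
     sa_carrier = {x. \<forall>w\<in>Poly_Mapping.keys x. w \<noteq> [] \<and> fst ` set w \<subseteq> X},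
     sa_zero = 0,
     sa_add = (+),
     sa_scale = (\<lambda>c. Poly_Mapping.map ((*) c)),
     sa_mult = (*),
     sa_star = poly_star \<rparr>"

text \<open>
  The supremum is that of a set of reals, so it is meaningful only if the relations bound the
  norms of the generators. For the relations of a graph this is \<open>ck_relations_bounded\<close> below.
\<close>

definition universal_seminorm :: "'g set \<Rightarrow> 'g star_poly set \<Rightarrow> 'g star_poly \<Rightarrow> real" where
  "universal_seminorm X R x =
     (SUP q\<in>{q. cstar_seminorm (free_star_algebra X) q \<and> (\<forall>r\<in>R. q r = 0)}. q x)"

definition universal_cstar_algebra ::
  "'g set \<Rightarrow> 'g star_poly set \<Rightarrow> (nat \<Rightarrow> 'g star_poly) set normed_star_algebra" where
  "universal_cstar_algebra X R = cstar_completion (free_star_algebra X) (universal_seminorm X R)"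


section \<open>Graph C*-algebras\<close>

datatype ('v, 'e) ck_gen = Proj 'v | PIso 'e

definition ck_gens :: "('v, 'e) pre_digraph \<Rightarrow> ('v, 'e) ck_gen set" where
  "ck_gens G = Proj ` verts G \<union> PIso ` arcs G"

abbreviation p_gen :: "'v \<Rightarrow> ('v, 'e) ck_gen star_poly" where
  "p_gen v \<equiv> gen (Proj v)"

abbreviation s_gen :: "'e \<Rightarrow> ('v, 'e) ck_gen star_poly" where
  "s_gen e \<equiv> gen (PIso e)"

text \<open>
  Source and range of an edge are its \<^const>\<open>tail\<close> and \<^const>\<open>head\<close>. An element \<open>r\<close> of the set
  encodes the relation \<open>r = 0\<close>. The first three sets say that the \<open>p\<^sub>v\<close> are mutually orthogonal
  projections, the fourth that the \<open>s\<^sub>e\<close> are partial isometries; \<open>s\<^sub>e s\<^sub>e\<^sup>* \<le> p\<close> is spelled out as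
  \<open>p s\<^sub>e s\<^sub>e\<^sup>* = s\<^sub>e s\<^sub>e\<^sup>*\<close>, the order on projections.
\<close>

definition ck_relations :: "('v, 'e) pre_digraph \<Rightarrow> ('v, 'e) ck_gen star_poly set" where
  "ck_relations G =
     {p_gen v * p_gen v - p_gen v | v. v \<in> verts G} \<union>
     {poly_star (p_gen v) - p_gen v | v. v \<in> verts G} \<union>
     {p_gen v * p_gen w | v w. v \<in> verts G \<and> w \<in> verts G \<and> v \<noteq> w} \<union>
     {s_gen e * poly_star (s_gen e) * s_gen e - s_gen e | e. e \<in> arcs G} \<union>
     {poly_star (s_gen e) * s_gen f | e f. e \<in> arcs G \<and> f \<in> arcs G \<and> e \<noteq> f} \<union>
     {poly_star (s_gen e) * s_gen e - p_gen (head G e) | e. e \<in> arcs G} \<union>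
     {p_gen (tail G e) * (s_gen e * poly_star (s_gen e)) - s_gen e * poly_star (s_gen e) | e. e \<in> arcs G} \<union>
     {p_gen v - (\<Sum>e\<in>out_arcs G v. s_gen e * poly_star (s_gen e)) | v.
        v \<in> verts G \<and> out_arcs G v \<noteq> {} \<and> finite (out_arcs G v)}"

definition graph_cstar_algebra ::
  "('v, 'e) pre_digraph \<Rightarrow> (nat \<Rightarrow> ('v, 'e) ck_gen star_poly) set normed_star_algebra" where
  "graph_cstar_algebra G = universal_cstar_algebra (ck_gens G) (ck_relations G)"


section \<open>Graphs\<close>

definition amplification :: "('v, 'e) pre_digraph \<Rightarrow> ('v, 'v \<times> 'v \<times> nat) pre_digraph" where
  "amplification G = \<lparr>
     verts = verts G,
     arcs = {(v, w, n). \<exists>e\<in>arcs G. tail G e = v \<and> head G e = w},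
     tail = (\<lambda>(v, w, n). v),
     head = (\<lambda>(v, w, n). w) \<rparr>"

definition singular_graph :: "('v, 'e) pre_digraph \<Rightarrow> bool" where
  "singular_graph G \<longleftrightarrow> (\<forall>v\<in>verts G. infinite (out_arcs G v) \<or> out_arcs G v = {})"

definition hereditary :: "('v, 'e) pre_digraph \<Rightarrow> 'v set \<Rightarrow> bool" where
  "hereditary G H \<longleftrightarrow> H \<subseteq> verts G \<and> (\<forall>u\<in>H. \<forall>v. u \<rightarrow>\<^sup>*\<^bsub>G\<^esub> v \<longrightarrow> v \<in> H)"

definition breaking_vertex :: "('v, 'e) pre_digraph \<Rightarrow> 'v \<Rightarrow> bool" where
  "breaking_vertex G v \<longleftrightarrow> (\<exists>H. hereditary G H \<and> v \<in> verts G - H \<and>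
     infinite (out_arcs G v) \<and>
     {e \<in> out_arcs G v. head G e \<in> verts G - H} \<noteq> {} \<and>
     finite {e \<in> out_arcs G v. head G e \<in> verts G - H})"


section \<open>The free *-algebra is a *-algebra\<close>

lemma poly_mapping_single_induct [case_names zero single add]:
  assumes "P 0" "\<And>w c. P (Poly_Mapping.single w c)" "\<And>x y. P x \<Longrightarrow> P y \<Longrightarrow> P (x + y)"
  shows "P x"
proof (induction x rule: update_induct)
  case const then show ?case by (rule assms)
next
  case (update f a b)
  have "Poly_Mapping.update a b f = f + Poly_Mapping.single a b"
    using update(1) by (intro poly_mapping_eqI)
      (auto simp: lookup_update lookup_add lookup_single when_def not_in_keys_iff_lookup_eq_zero)
  then show ?case using assms update by simp
qed

lemma poly_star_single: "poly_star (Poly_Mapping.single w c) = Poly_Mapping.single (word_star w) (cnj c)"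
  by (rule poly_mapping_eqI) (auto simp: poly_star.rep_eq lookup_single when_def)

lemma poly_star_add: "poly_star (x + y) = poly_star x + poly_star y"
  by (rule poly_mapping_eqI) (simp add: poly_star.rep_eq lookup_add)

lemma poly_star_zero [simp]: "poly_star 0 = 0"
  by (rule poly_mapping_eqI) (simp add: poly_star.rep_eq)

lemma word_star_append: "word_star (u + w) = word_star w + word_star u"
  by (simp add: word_star_def plus_list_def)

lemma poly_star_mult: "poly_star (x * y) = poly_star y * poly_star x"
proof (induction x rule: poly_mapping_single_induct)
  case (single w c)
  show ?case
    by (induction y rule: poly_mapping_single_induct)
      (simp_all add: poly_star_single mult_single word_star_append poly_star_add algebra_simps)
qed (simp_all add: poly_star_add algebra_simps)

lemma fst_set_word_star: "fst ` set (word_star w) = fst ` set w"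
  by (auto simp: word_star_def image_iff apsnd_def map_prod_def split: prod.splits) force+

lemma word_star_eq_Nil [simp]: "word_star w = [] \<longleftrightarrow> w = []"
  by (simp add: word_star_def)

lemma keys_poly_star: "Poly_Mapping.keys (poly_star x) = word_star ` Poly_Mapping.keys x"
  by (auto simp: in_keys_iff poly_star.rep_eq intro!: image_eqI[of _ word_star])

lemma map_scale: "Poly_Mapping.map ((*) c) x = Poly_Mapping.single 0 c * (x :: 'g star_poly)"
  by (rule mult_map_scale_conv_mult)

lemma lookup_scale: "Poly_Mapping.lookup (Poly_Mapping.map ((*) c) x) w = c * Poly_Mapping.lookup (x :: 'g star_poly) w"
  by (simp add: Poly_Mapping.map.rep_eq when_def)

lemma scale_mult_right': "x * Poly_Mapping.single 0 c = Poly_Mapping.single 0 c * (x :: 'g star_poly)"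
  by (induction x rule: poly_mapping_single_induct) (simp_all add: mult_single algebra_simps)


definition free_carrier :: "'g set \<Rightarrow> 'g star_poly set" where
  "free_carrier X = {x. \<forall>w\<in>Poly_Mapping.keys x. w \<noteq> [] \<and> fst ` set w \<subseteq> X}"

lemma free_simps [simp]:
  "sa_carrier (free_star_algebra X) = free_carrier X"
  "sa_zero (free_star_algebra X) = 0"
  "sa_add (free_star_algebra X) = (+)"
  "sa_scale (free_star_algebra X) = (\<lambda>c x. Poly_Mapping.single 0 c * x)"
  "sa_mult (free_star_algebra X) = (*)"
  "sa_star (free_star_algebra X) = poly_star"
  by (simp_all add: free_star_algebra_def free_carrier_def map_scale fun_eq_iff)

lemma free_carrierI: "(\<And>w. w \<in> Poly_Mapping.keys x \<Longrightarrow> w \<noteq> [] \<and> fst ` set w \<subseteq> X) \<Longrightarrow> x \<in> free_carrier X"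
  by (simp add: free_carrier_def)

lemma free_carrierD: "x \<in> free_carrier X \<Longrightarrow> w \<in> Poly_Mapping.keys x \<Longrightarrow> w \<noteq> [] \<and> fst ` set w \<subseteq> X"
  by (simp add: free_carrier_def)

lemma free_carrier_add: "x \<in> free_carrier X \<Longrightarrow> y \<in> free_carrier X \<Longrightarrow> x + y \<in> free_carrier X"
  by (rule free_carrierI) (meson UnE keys_add subsetD free_carrierD)

lemma free_carrier_mult:
  assumes "x \<in> free_carrier X" "y \<in> free_carrier X" shows "x * y \<in> free_carrier X"
proof (rule free_carrierI)
  fix w assume "w \<in> Poly_Mapping.keys (x * y)"
  then obtain a b where w: "w = a + b" and a: "a \<in> Poly_Mapping.keys x" and b: "b \<in> Poly_Mapping.keys y"
    using keys_mult[of x y] by blast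
  show "w \<noteq> [] \<and> fst ` set w \<subseteq> X"
    using free_carrierD[OF assms(1) a] free_carrierD[OF assms(2) b] by (simp add: w plus_list_def image_Un)
qed

lemma free_carrier_scale:
  assumes "x \<in> free_carrier X" shows "Poly_Mapping.single 0 c * x \<in> free_carrier X"
  by (rule free_carrierI, rule free_carrierD[OF assms])
    (auto simp: in_keys_iff map_scale[symmetric] lookup_scale)

lemma free_carrier_star: "x \<in> free_carrier X \<Longrightarrow> poly_star x \<in> free_carrier X"
  by (auto simp: free_carrier_def keys_poly_star fst_set_word_star)

lemma free_carrier_zero: "0 \<in> free_carrier X"
  by (simp add: free_carrier_def)

theorem star_algebra_free: "star_algebra (free_star_algebra X)"
proof -
  have ws: "word_star (0 :: ('b \<times> bool) list) = 0"
    by (simp add: word_star_def zero_list_def)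
  have sm: "Poly_Mapping.single 0 (-1) = (- 1 :: 'b star_poly)"
    by (simp add: single_uminus)
  have st: "poly_star (Poly_Mapping.single 0 c * x) = Poly_Mapping.single 0 (cnj c) * poly_star x"
    for c and x :: "'b star_poly"
    by (simp add: poly_star_mult poly_star_single ws scale_mult_right')
  have ss: "poly_star (poly_star x) = x" for x :: "'b star_poly"
    by (rule poly_mapping_eqI) (simp add: poly_star.rep_eq)
  have ma: "x * (Poly_Mapping.single 0 c * y) = Poly_Mapping.single 0 c * (x * y)"
    for c and x y :: "'b star_poly"
    by (metis mult.assoc scale_mult_right')
  note closed = free_carrier_add free_carrier_mult free_carrier_scale free_carrier_star free_carrier_zero
  show ?thesis
  proof (unfold_locales, unfold free_simps, goal_cases)
    case 6 show ?case by (rule add.assoc)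
  next case 7 show ?case by (rule add.commute)
  next case 8 show ?case by simp
  next case 9 show ?case by (simp add: sm)
  next case 10 show ?case by (rule distrib_left)
  next case 11 show ?case by (simp add: single_add distrib_right)
  next case 12 show ?case by (simp add: mult_single flip: mult.assoc)
  next case 13 show ?case by simp
  next case 14 show ?case by (rule mult.assoc)
  next case 15 show ?case by (rule distrib_right)
  next case 16 show ?case by (rule distrib_left)
  next case 17 show ?case by (rule mult.assoc)
  next case 18 show ?case by (rule ma)
  next case 19 show ?case by (rule ss)
  next case 20 show ?case by (rule poly_star_add)
  next case 21 show ?case by (rule st)
  next case 22 show ?case by (rule poly_star_mult)
  qed (rule closed; assumption)+
qed


section \<open>The completion is a C*-algebra with the expected extension property\<close>

context star_algebra begin

lemma diff_closed [simp]: "\<lbrakk>x \<in> sa_carrier A; y \<in> sa_carrier A\<rbrakk> \<Longrightarrow> x \<ominus> y \<in> sa_carrier A"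
  by (simp add: sa_diff_def)

lemma add_left_commute:
  "\<lbrakk>x \<in> sa_carrier A; y \<in> sa_carrier A; z \<in> sa_carrier A\<rbrakk> \<Longrightarrow> x \<oplus> (y \<oplus> z) = y \<oplus> (x \<oplus> z)"
  by (metis add_assoc add_commute)

lemmas sa_ac = add_assoc add_commute add_left_commute

lemma zero_add: "x \<in> sa_carrier A \<Longrightarrow> \<zero> \<oplus> x = x"
  by (metis add_commute add_zero zero_closed)

lemma scale_zero_left: "x \<in> sa_carrier A \<Longrightarrow> 0 \<odot> x = \<zero>"
  using add_scale[of x 1 "-1"] by (simp add: scale_one add_inverse)

lemma diff_self: "x \<in> sa_carrier A \<Longrightarrow> x \<ominus> x = \<zero>"
  by (simp add: sa_diff_def add_inverse)

lemma diff_add_diff: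
  assumes "x \<in> sa_carrier A" "y \<in> sa_carrier A" "z \<in> sa_carrier A"
  shows "(x \<ominus> y) \<oplus> (y \<ominus> z) = x \<ominus> z"
proof -
  have "(x \<ominus> y) \<oplus> (y \<ominus> z) = x \<oplus> ((y \<oplus> (-1) \<odot> y) \<oplus> (-1) \<odot> z)"
    using assms by (simp add: sa_diff_def sa_ac)
  then show ?thesis using assms by (simp add: add_inverse zero_add sa_diff_def)
qed

lemma diff_add_cancel: "x \<in> sa_carrier A \<Longrightarrow> y \<in> sa_carrier A \<Longrightarrow> (x \<ominus> y) \<oplus> y = x"
  by (metis add_commute add_inverse add_zero add_assoc sa_diff_def scale_closed)

lemma add_diff_add:
  assumes "x \<in> sa_carrier A" "y \<in> sa_carrier A" "x' \<in> sa_carrier A" "y' \<in> sa_carrier A"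
  shows "(x \<oplus> y) \<ominus> (x' \<oplus> y') = (x \<ominus> x') \<oplus> (y \<ominus> y')"
  using assms by (simp add: sa_diff_def scale_add sa_ac)

lemma scale_diff: "x \<in> sa_carrier A \<Longrightarrow> y \<in> sa_carrier A \<Longrightarrow> c \<odot> x \<ominus> c \<odot> y = c \<odot> (x \<ominus> y)"
  by (simp add: sa_diff_def scale_add scale_scale)

lemma mult_diff_mult:
  assumes "x \<in> sa_carrier A" "y \<in> sa_carrier A" "x' \<in> sa_carrier A" "y' \<in> sa_carrier A"
  shows "x \<otimes> y \<ominus> x' \<otimes> y' = (x \<ominus> x') \<otimes> y \<oplus> x' \<otimes> (y \<ominus> y')"
proof -
  have 1: "(x \<ominus> x') \<otimes> y = x \<otimes> y \<ominus> x' \<otimes> y" and 2: "x' \<otimes> (y \<ominus> y') = x' \<otimes> y \<ominus> x' \<otimes> y'"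
    using assms by (simp_all add: sa_diff_def distrib_right distrib_left scale_mult_left scale_mult_right)
  show ?thesis unfolding 1 2 using assms by (simp add: diff_add_diff)
qed

lemma star_diff: "x \<in> sa_carrier A \<Longrightarrow> y \<in> sa_carrier A \<Longrightarrow> x\<^sup>\<star> \<ominus> y\<^sup>\<star> = (x \<ominus> y)\<^sup>\<star>"
  by (simp add: sa_diff_def star_add star_scale)

lemma diff_minus: "x \<in> sa_carrier A \<Longrightarrow> y \<in> sa_carrier A \<Longrightarrow> (-1) \<odot> (x \<ominus> y) = y \<ominus> x"
  by (simp add: sa_diff_def scale_add scale_scale scale_one add_commute)

lemma diff_zero: "x \<in> sa_carrier A \<Longrightarrow> x \<ominus> \<zero> = x"
  using diff_add_cancel[of x \<zero>] add_zero[of "x \<ominus> \<zero>"] by simp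

end

locale seminormed_star_algebra = star_algebra A for A :: "('a, 'b) star_algebra_scheme" (structure) +
  fixes q :: "'a \<Rightarrow> real"
  assumes seminorm: "cstar_seminorm A q"
begin

lemma
  shows q_nonneg: "x \<in> sa_carrier A \<Longrightarrow> 0 \<le> q x"
    and q_add: "\<lbrakk>x \<in> sa_carrier A; y \<in> sa_carrier A\<rbrakk> \<Longrightarrow> q (x \<oplus> y) \<le> q x + q y"
    and q_scale: "x \<in> sa_carrier A \<Longrightarrow> q (c \<odot> x) = cmod c * q x"
    and q_mult: "\<lbrakk>x \<in> sa_carrier A; y \<in> sa_carrier A\<rbrakk> \<Longrightarrow> q (x \<otimes> y) \<le> q x * q y"
    and q_star_mult: "x \<in> sa_carrier A \<Longrightarrow> q (x\<^sup>\<star> \<otimes> x) = (q x)\<^sup>2"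
  using seminorm by (auto simp: cstar_seminorm_def)

lemma q_zero: "q \<zero> = 0"
  using q_scale[of \<zero> 0] scale_zero_left[of \<zero>] by simp

lemma q_diff_commute: "x \<in> sa_carrier A \<Longrightarrow> y \<in> sa_carrier A \<Longrightarrow> q (x \<ominus> y) = q (y \<ominus> x)"
  using q_scale[of "x \<ominus> y" "-1"] diff_minus[of x y] by simp

lemma q_triangle:
  "\<lbrakk>x \<in> sa_carrier A; y \<in> sa_carrier A; z \<in> sa_carrier A\<rbrakk> \<Longrightarrow> q (x \<ominus> z) \<le> q (x \<ominus> y) + q (y \<ominus> z)"
  using q_add[of "x \<ominus> y" "y \<ominus> z"] diff_add_diff[of x y z] by simp

lemma q_diff_ge: "\<lbrakk>x \<in> sa_carrier A; y \<in> sa_carrier A\<rbrakk> \<Longrightarrow> \<bar>q x - q y\<bar> \<le> q (x \<ominus> y)"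
  using q_add[of "x \<ominus> y" y] q_add[of "y \<ominus> x" x] diff_add_cancel[of x y] diff_add_cancel[of y x]
    q_diff_commute[of x y] by simp

lemma q_star_le: assumes "x \<in> sa_carrier A" shows "q x \<le> q (x\<^sup>\<star>)"
proof (cases "q x = 0")
  case False
  then have "0 < q x" using q_nonneg[OF assms] by simp
  moreover have "q x * q x \<le> q (x\<^sup>\<star>) * q x"
    using q_mult[of "x\<^sup>\<star>" x] q_star_mult[OF assms] assms by (simp add: power2_eq_square)
  ultimately show ?thesis by simp
qed (simp add: assms q_nonneg)

lemma q_star: "x \<in> sa_carrier A \<Longrightarrow> q (x\<^sup>\<star>) = q x"
  using q_star_le[of x] q_star_le[of "x\<^sup>\<star>"] by (simp add: star_star)

abbreviation "CS \<equiv> cauchy_seqs A q"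
abbreviation "NR \<equiv> null_rel A q"

lemma CS_carrier: "X \<in> CS \<Longrightarrow> X n \<in> sa_carrier A"
  by (simp add: cauchy_seqs_def)

lemma CS_D: "X \<in> CS \<Longrightarrow> 0 < e \<Longrightarrow> \<exists>N. \<forall>m\<ge>N. \<forall>n\<ge>N. q (X m \<ominus> X n) < e"
  by (simp add: cauchy_seqs_def)

lemma CS_I: "(\<And>n. X n \<in> sa_carrier A) \<Longrightarrow> (\<And>e. 0 < e \<Longrightarrow> \<exists>N. \<forall>m\<ge>N. \<forall>n\<ge>N. q (X m \<ominus> X n) < e) \<Longrightarrow> X \<in> CS"
  by (simp add: cauchy_seqs_def)

lemma CS_const: "x \<in> sa_carrier A \<Longrightarrow> (\<lambda>n. x) \<in> CS"
  by (rule CS_I) (auto simp: diff_self q_zero)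

lemma CS_add: assumes "X \<in> CS" "Y \<in> CS" shows "(\<lambda>n. X n \<oplus> Y n) \<in> CS"
proof (rule CS_I)
  fix e :: real assume "0 < e"
  then obtain M N where M: "\<And>m n. m \<ge> M \<Longrightarrow> n \<ge> M \<Longrightarrow> q (X m \<ominus> X n) < e/2"
    and N: "\<And>m n. m \<ge> N \<Longrightarrow> n \<ge> N \<Longrightarrow> q (Y m \<ominus> Y n) < e/2"
    using CS_D[OF assms(1), of "e/2"] CS_D[OF assms(2), of "e/2"] by (metis half_gt_zero)
  have "q ((X m \<oplus> Y m) \<ominus> (X n \<oplus> Y n)) < e" if "m \<ge> max M N" "n \<ge> max M N" for m n
    using q_add[of "X m \<ominus> X n" "Y m \<ominus> Y n"] M[of m n] N[of m n] that CS_carrier assms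
    by (simp add: add_diff_add)
  then show "\<exists>N. \<forall>m\<ge>N. \<forall>n\<ge>N. q ((X m \<oplus> Y m) \<ominus> (X n \<oplus> Y n)) < e" by blast
qed (simp add: CS_carrier assms)

lemma CS_scale: assumes "X \<in> CS" shows "(\<lambda>n. c \<odot> X n) \<in> CS"
proof (rule CS_I)
  fix e :: real assume "0 < e"
  then have "0 < e / (cmod c + 1)" by (simp add: add_nonneg_pos)
  from CS_D[OF assms this] obtain M
    where M: "\<And>m n. m \<ge> M \<Longrightarrow> n \<ge> M \<Longrightarrow> q (X m \<ominus> X n) < e / (cmod c + 1)" by blast
  have "q (c \<odot> X m \<ominus> c \<odot> X n) < e" if "m \<ge> M" "n \<ge> M" for m n
  proof -
    have "cmod c * q (X m \<ominus> X n) \<le> (cmod c + 1) * q (X m \<ominus> X n)"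
      by (intro mult_right_mono q_nonneg) (simp_all add: CS_carrier assms)
    also have "\<dots> < e" using M[OF that] by (subst mult.commute) (simp add: pos_less_divide_eq add_nonneg_pos)
    finally show ?thesis by (simp add: scale_diff CS_carrier assms q_scale)
  qed
  then show "\<exists>N. \<forall>m\<ge>N. \<forall>n\<ge>N. q (c \<odot> X m \<ominus> c \<odot> X n) < e" by blast
qed (simp add: CS_carrier assms)

lemma CS_star: assumes "X \<in> CS" shows "(\<lambda>n. (X n)\<^sup>\<star>) \<in> CS"
  by (rule CS_I) (use CS_D[OF assms] in \<open>simp_all add: star_diff q_star CS_carrier assms\<close>)

lemma q_Cauchy: assumes "X \<in> CS" shows "Cauchy (\<lambda>n. q (X n))"
proof (rule metric_CauchyI)
  fix e :: real assume "0 < e"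
  from CS_D[OF assms this] obtain M where M: "\<And>m n. m \<ge> M \<Longrightarrow> n \<ge> M \<Longrightarrow> q (X m \<ominus> X n) < e" by blast
  have "dist (q (X m)) (q (X n)) < e" if "m \<ge> M" "n \<ge> M" for m n
    using q_diff_ge[of "X m" "X n"] M[OF that] assms CS_carrier by (simp add: dist_real_def)
  then show "\<exists>M. \<forall>m\<ge>M. \<forall>n\<ge>M. dist (q (X m)) (q (X n)) < e" by blast
qed

lemma q_bound: assumes "X \<in> CS" obtains K where "K > 0" "\<And>n. q (X n) \<le> K"
proof -
  have "Bseq (\<lambda>n. q (X n))" using q_Cauchy[OF assms] by (rule Cauchy_Bseq)
  then obtain K where "K > 0" "\<And>n. norm (q (X n)) \<le> K" by (auto elim: BseqE)
  then show ?thesis using that[of K] by (metis abs_le_D1 real_norm_def)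
qed

lemma CS_mult: assumes "X \<in> CS" "Y \<in> CS" shows "(\<lambda>n. X n \<otimes> Y n) \<in> CS"
proof (rule CS_I)
  fix e :: real assume e: "0 < e"
  obtain K where K: "K > 0" "\<And>n. q (X n) \<le> K" using q_bound[OF assms(1)] by blast
  obtain L where L: "L > 0" "\<And>n. q (Y n) \<le> L" using q_bound[OF assms(2)] by blast
  obtain M where M: "\<And>m n. m \<ge> M \<Longrightarrow> n \<ge> M \<Longrightarrow> q (X m \<ominus> X n) < e / (2 * L)"
    using CS_D[OF assms(1), of "e/(2*L)"] e L by auto
  obtain N where N: "\<And>m n. m \<ge> N \<Longrightarrow> n \<ge> N \<Longrightarrow> q (Y m \<ominus> Y n) < e / (2 * K)"
    using CS_D[OF assms(2), of "e/(2*K)"] e K by auto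
  have "q (X m \<otimes> Y m \<ominus> X n \<otimes> Y n) < e" if "m \<ge> max M N" "n \<ge> max M N" for m n
  proof -
    have c: "X k \<in> sa_carrier A" "Y k \<in> sa_carrier A" for k using assms CS_carrier by auto
    have "q (X m \<otimes> Y m \<ominus> X n \<otimes> Y n) \<le> q ((X m \<ominus> X n) \<otimes> Y m) + q (X n \<otimes> (Y m \<ominus> Y n))"
      using q_add c by (simp add: mult_diff_mult)
    also have "\<dots> \<le> q (X m \<ominus> X n) * q (Y m) + q (X n) * q (Y m \<ominus> Y n)"
      using q_mult c by (intro add_mono) simp_all
    also have "\<dots> \<le> q (X m \<ominus> X n) * L + K * q (Y m \<ominus> Y n)"
      using K L q_nonneg c by (intro add_mono mult_left_mono mult_right_mono) simp_all
    also have "\<dots> < e / 2 + e / 2"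
      using M[of m n] N[of m n] that K L by (intro add_strict_mono) (simp_all add: field_simps)
    finally show ?thesis by simp
  qed
  then show "\<exists>N. \<forall>m\<ge>N. \<forall>n\<ge>N. q (X m \<otimes> Y m \<ominus> X n \<otimes> Y n) < e" by blast
qed (simp add: CS_carrier assms)

lemma NR_iff: "(X, Y) \<in> NR \<longleftrightarrow> X \<in> CS \<and> Y \<in> CS \<and> (\<lambda>n. q (X n \<ominus> Y n)) \<longlonglongrightarrow> 0"
  by (simp add: null_rel_def)

lemma tendsto_squeeze0:
  fixes f g :: "nat \<Rightarrow> real"
  assumes "\<And>n. 0 \<le> f n" "\<And>n. f n \<le> g n" "g \<longlonglongrightarrow> 0" shows "f \<longlonglongrightarrow> 0"
  by (rule tendsto_sandwich[OF _ _ tendsto_const assms(3)]) (use assms in auto)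

lemma NR_equiv: "equiv CS NR"
proof (rule equivI)
  show "NR \<subseteq> CS \<times> CS" by (auto simp: NR_iff)
  show "refl_on CS NR" by (auto simp: refl_on_def NR_iff diff_self q_zero CS_carrier)
  show "sym NR" by (auto simp: sym_def NR_iff CS_carrier q_diff_commute)
  show "trans NR"
  proof (rule transI)
    fix X Y Z assume a: "(X, Y) \<in> NR" "(Y, Z) \<in> NR"
    then have "(\<lambda>n. q (X n \<ominus> Y n) + q (Y n \<ominus> Z n)) \<longlonglongrightarrow> 0"
      using tendsto_add[of "\<lambda>n. q (X n \<ominus> Y n)" 0 _ "\<lambda>n. q (Y n \<ominus> Z n)" 0] by (simp add: NR_iff)
    then have "(\<lambda>n. q (X n \<ominus> Z n)) \<longlonglongrightarrow> 0"
      by (rule tendsto_squeeze0[rotated 2]) (use a in \<open>simp_all add: NR_iff CS_carrier q_triangle q_nonneg\<close>)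
    then show "(X, Z) \<in> NR" using a by (simp add: NR_iff)
  qed
qed

lemma NR_add: assumes "(X, X') \<in> NR" "(Y, Y') \<in> NR"
  shows "(\<lambda>n. X n \<oplus> Y n, \<lambda>n. X' n \<oplus> Y' n) \<in> NR"
proof -
  have c: "X \<in> CS" "X' \<in> CS" "Y \<in> CS" "Y' \<in> CS" using assms by (auto simp: NR_iff)
  have "(\<lambda>n. q ((X n \<oplus> Y n) \<ominus> (X' n \<oplus> Y' n))) \<longlonglongrightarrow> 0"
  proof (rule tendsto_squeeze0)
    show "(\<lambda>n. q (X n \<ominus> X' n) + q (Y n \<ominus> Y' n)) \<longlonglongrightarrow> 0"
      using assms tendsto_add[of "\<lambda>n. q (X n \<ominus> X' n)" 0 _ "\<lambda>n. q (Y n \<ominus> Y' n)" 0] by (simp add: NR_iff)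
  qed (use c in \<open>simp_all add: CS_carrier q_nonneg add_diff_add q_add\<close>)
  then show ?thesis using c by (simp add: NR_iff CS_add)
qed

lemma NR_scale: assumes "(X, X') \<in> NR" shows "(\<lambda>n. c \<odot> X n, \<lambda>n. c \<odot> X' n) \<in> NR"
  using assms tendsto_mult_left[of "\<lambda>n. q (X n \<ominus> X' n)" 0 sequentially "cmod c"]
  by (simp add: NR_iff CS_scale CS_carrier scale_diff q_scale)

lemma NR_star: assumes "(X, X') \<in> NR" shows "(\<lambda>n. (X n)\<^sup>\<star>, \<lambda>n. (X' n)\<^sup>\<star>) \<in> NR"
  using assms by (simp add: NR_iff CS_star CS_carrier star_diff q_star)

lemma NR_mult: assumes "(X, X') \<in> NR" "(Y, Y') \<in> NR"
  shows "(\<lambda>n. X n \<otimes> Y n, \<lambda>n. X' n \<otimes> Y' n) \<in> NR"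
proof -
  have c: "X \<in> CS" "X' \<in> CS" "Y \<in> CS" "Y' \<in> CS" using assms by (auto simp: NR_iff)
  then have d: "X k \<in> sa_carrier A" "Y k \<in> sa_carrier A" "X' k \<in> sa_carrier A" "Y' k \<in> sa_carrier A" for k
    using CS_carrier by auto
  obtain K where K: "K > 0" "\<And>n. q (X' n) \<le> K" using q_bound[OF c(2)] by blast
  obtain L where L: "L > 0" "\<And>n. q (Y n) \<le> L" using q_bound[OF c(3)] by blast
  have "(\<lambda>n. q (X n \<otimes> Y n \<ominus> X' n \<otimes> Y' n)) \<longlonglongrightarrow> 0"
  proof (rule tendsto_squeeze0)
    have "(\<lambda>n. q (X n \<ominus> X' n) * L + K * q (Y n \<ominus> Y' n)) \<longlonglongrightarrow> 0 * L + K * 0"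
      using assms by (intro tendsto_intros) (simp_all add: NR_iff)
    then show "(\<lambda>n. q (X n \<ominus> X' n) * L + K * q (Y n \<ominus> Y' n)) \<longlonglongrightarrow> 0" by simp
    fix m
    have "q (X m \<otimes> Y m \<ominus> X' m \<otimes> Y' m) \<le> q ((X m \<ominus> X' m) \<otimes> Y m) + q (X' m \<otimes> (Y m \<ominus> Y' m))"
      using q_add d by (simp add: mult_diff_mult)
    also have "\<dots> \<le> q (X m \<ominus> X' m) * q (Y m) + q (X' m) * q (Y m \<ominus> Y' m)"
      using q_mult d by (intro add_mono) simp_all
    also have "\<dots> \<le> q (X m \<ominus> X' m) * L + K * q (Y m \<ominus> Y' m)"
      using K L q_nonneg d by (intro add_mono mult_left_mono mult_right_mono) simp_all
    finally show "q (X m \<otimes> Y m \<ominus> X' m \<otimes> Y' m) \<le> q (X m \<ominus> X' m) * L + K * q (Y m \<ominus> Y' m)" .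
  qed (simp add: q_nonneg d)
  then show ?thesis using c by (simp add: NR_iff CS_mult)
qed

definition cls :: "(nat \<Rightarrow> 'a) \<Rightarrow> (nat \<Rightarrow> 'a) set" where "cls X = NR `` {X}"

lemma cls_eq_iff: "X \<in> CS \<Longrightarrow> Y \<in> CS \<Longrightarrow> cls X = cls Y \<longleftrightarrow> (X, Y) \<in> NR"
  unfolding cls_def by (rule eq_equiv_class_iff[OF NR_equiv])

lemma cls_in: "X \<in> CS \<Longrightarrow> cls X \<in> sa_carrier (cstar_completion A q)"
  by (simp add: cstar_completion_def cls_def quotientI)

lemma cls_cases: assumes "S \<in> sa_carrier (cstar_completion A q)" obtains X where "X \<in> CS" "S = cls X"
  using assms by (auto simp: cstar_completion_def cls_def elim!: quotientE)

lemma compl_carrier: "sa_carrier (cstar_completion A q) = cls ` CS"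
  by (auto simp: cls_in elim: cls_cases)

lemma in_cls: "X \<in> CS \<Longrightarrow> Y \<in> cls X \<longleftrightarrow> (X, Y) \<in> NR"
  by (simp add: cls_def)

lemma compl_zero: "sa_zero (cstar_completion A q) = cls (\<lambda>n. \<zero>)"
  by (simp add: cstar_completion_def cls_def)

lemma self_in_cls: "X \<in> CS \<Longrightarrow> X \<in> cls X"
  unfolding cls_def by (rule equiv_class_self[OF NR_equiv])

lemma UN_const1: "a \<in> S \<Longrightarrow> (\<And>x. x \<in> S \<Longrightarrow> f x = c) \<Longrightarrow> (\<Union>x\<in>S. f x) = c"
  by auto

lemma UN_const2: "a \<in> S \<Longrightarrow> b \<in> T \<Longrightarrow> (\<And>x y. x \<in> S \<Longrightarrow> y \<in> T \<Longrightarrow> f x y = c) \<Longrightarrow>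
    (\<Union>x\<in>S. \<Union>y\<in>T. f x y) = c"
  by auto

lemma compl_add: assumes "X \<in> CS" "Y \<in> CS"
  shows "sa_add (cstar_completion A q) (cls X) (cls Y) = cls (\<lambda>n. X n \<oplus> Y n)"
proof -
  have "cls (\<lambda>n. X' n \<oplus> Y' n) = cls (\<lambda>n. X n \<oplus> Y n)" if "X' \<in> cls X" "Y' \<in> cls Y" for X' Y'
  proof -
    have "(X, X') \<in> NR" "(Y, Y') \<in> NR" using that assms by (simp_all add: in_cls)
    from NR_add[OF this] show ?thesis
      using cls_eq_iff[of "\<lambda>n. X n \<oplus> Y n" "\<lambda>n. X' n \<oplus> Y' n"] by (simp add: NR_iff)
  qed
  then show ?thesis
    unfolding cstar_completion_def star_algebra.simps cls_def[symmetric]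
    by (intro UN_const2[OF self_in_cls self_in_cls] assms)
qed

lemma compl_mult: assumes "X \<in> CS" "Y \<in> CS"
  shows "sa_mult (cstar_completion A q) (cls X) (cls Y) = cls (\<lambda>n. X n \<otimes> Y n)"
proof -
  have "cls (\<lambda>n. X' n \<otimes> Y' n) = cls (\<lambda>n. X n \<otimes> Y n)" if "X' \<in> cls X" "Y' \<in> cls Y" for X' Y'
  proof -
    have "(X, X') \<in> NR" "(Y, Y') \<in> NR" using that assms by (simp_all add: in_cls)
    from NR_mult[OF this] show ?thesis
      using cls_eq_iff[of "\<lambda>n. X n \<otimes> Y n" "\<lambda>n. X' n \<otimes> Y' n"] by (simp add: NR_iff)
  qed
  then show ?thesis
    unfolding cstar_completion_def star_algebra.simps cls_def[symmetric]
    by (intro UN_const2[OF self_in_cls self_in_cls] assms)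
qed

lemma compl_scale: assumes "X \<in> CS"
  shows "sa_scale (cstar_completion A q) c (cls X) = cls (\<lambda>n. c \<odot> X n)"
proof -
  have "cls (\<lambda>n. c \<odot> X' n) = cls (\<lambda>n. c \<odot> X n)" if "X' \<in> cls X" for X'
  proof -
    have "(X, X') \<in> NR" using that assms by (simp_all add: in_cls)
    from NR_scale[OF this] show ?thesis
      using cls_eq_iff[of "\<lambda>n. c \<odot> X n" "\<lambda>n. c \<odot> X' n"] by (simp add: NR_iff)
  qed
  then show ?thesis
    unfolding cstar_completion_def star_algebra.simps cls_def[symmetric]
    by (intro UN_const1[OF self_in_cls] assms)
qed

lemma compl_star: assumes "X \<in> CS"
  shows "sa_star (cstar_completion A q) (cls X) = cls (\<lambda>n. (X n)\<^sup>\<star>)"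
proof -
  have "cls (\<lambda>n. (X' n)\<^sup>\<star>) = cls (\<lambda>n. (X n)\<^sup>\<star>)" if "X' \<in> cls X" for X'
  proof -
    have "(X, X') \<in> NR" using that assms by (simp_all add: in_cls)
    from NR_star[OF this] show ?thesis
      using cls_eq_iff[of "\<lambda>n. (X n)\<^sup>\<star>" "\<lambda>n. (X' n)\<^sup>\<star>"] by (simp add: NR_iff)
  qed
  then show ?thesis
    unfolding cstar_completion_def star_algebra.simps cls_def[symmetric]
    by (intro UN_const1[OF self_in_cls] assms)
qed

lemma compl_norm: assumes "X \<in> CS"
  shows "(\<lambda>n. q (X n)) \<longlonglongrightarrow> sa_norm (cstar_completion A q) (cls X)"
proof -
  obtain r where r: "(\<lambda>n. q (X n)) \<longlonglongrightarrow> r"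
    using q_Cauchy[OF assms] by (meson convergentD Cauchy_convergent)
  have *: "(\<lambda>n. q (Y n)) \<longlonglongrightarrow> r" if "Y \<in> cls X" for Y
  proof -
    have n: "(X, Y) \<in> NR" using that assms by (simp add: in_cls)
    have "(\<lambda>n. q (X n) - q (Y n)) \<longlonglongrightarrow> 0"
      by (rule tendsto_rabs_zero_cancel, rule tendsto_squeeze0[of _ "\<lambda>n. q (X n \<ominus> Y n)"])
        (use n in \<open>simp_all add: NR_iff CS_carrier q_diff_ge\<close>)
    from tendsto_diff[OF r this] show ?thesis by simp
  qed
  have "sa_norm (cstar_completion A q) (cls X) = r"
    unfolding cstar_completion_def
  proof (simp, rule the_equality)
    show "\<forall>Y\<in>cls X. (\<lambda>n. q (Y n)) \<longlonglongrightarrow> r" using * by blast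
    fix s assume "\<forall>Y\<in>cls X. (\<lambda>n. q (Y n)) \<longlonglongrightarrow> s"
    then show "s = r" using self_in_cls[OF assms] r LIMSEQ_unique by blast
  qed
  then show ?thesis using r by simp
qed

lemma compl_normI: "X \<in> CS \<Longrightarrow> (\<lambda>n. q (X n)) \<longlonglongrightarrow> r \<Longrightarrow> sa_norm (cstar_completion A q) (cls X) = r"
  using compl_norm LIMSEQ_unique by blast

lemma compl_norm_const: "x \<in> sa_carrier A \<Longrightarrow> sa_norm (cstar_completion A q) (cls (\<lambda>n. x)) = q x"
  by (rule compl_normI) (simp_all add: CS_const)

lemma compl_diff: assumes "X \<in> CS" "Y \<in> CS"
  shows "sa_diff (cstar_completion A q) (cls X) (cls Y) = cls (\<lambda>n. X n \<ominus> Y n)"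
  using assms by (simp add: sa_diff_def compl_add compl_scale CS_scale)

lemma CS_diff: "X \<in> CS \<Longrightarrow> Y \<in> CS \<Longrightarrow> (\<lambda>n. X n \<ominus> Y n) \<in> CS"
  by (simp add: sa_diff_def CS_add CS_scale)

lemma star_algebra_completion: "star_algebra (cstar_completion A q)"
proof -
  note c = compl_carrier compl_zero compl_add compl_scale compl_mult compl_star
    CS_const CS_add CS_scale CS_mult CS_star CS_carrier
  show ?thesis
  proof (unfold_locales, goal_cases)
    case (6 x y z) then show ?case by (auto simp: c add_assoc)
  next
    case (7 x y) then show ?case by (auto simp: c add_commute)
  qed (auto simp: c add_zero add_inverse scale_add add_scale scale_scale scale_one mult_assoc
      distrib_left distrib_right scale_mult_left scale_mult_right star_star star_add star_scale star_mult)
qed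

lemma seminorm_completion: "cstar_seminorm (cstar_completion A q) (sa_norm (cstar_completion A q))"
proof -
  have 1: "0 \<le> sa_norm (cstar_completion A q) (cls X)" if "X \<in> CS" for X
    by (rule LIMSEQ_le_const[OF compl_norm[OF that]]) (use that in \<open>auto simp: q_nonneg CS_carrier\<close>)
  have 2: "sa_norm (cstar_completion A q) (cls (\<lambda>n. X n \<oplus> Y n))
      \<le> sa_norm (cstar_completion A q) (cls X) + sa_norm (cstar_completion A q) (cls Y)"
    if "X \<in> CS" "Y \<in> CS" for X Y
    by (rule LIMSEQ_le[OF compl_norm[OF CS_add[OF that]]
          tendsto_add[OF compl_norm[OF that(1)] compl_norm[OF that(2)]]])
       (use that in \<open>auto simp: q_add CS_carrier\<close>)
  have 3: "sa_norm (cstar_completion A q) (cls (\<lambda>n. X n \<otimes> Y n))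
      \<le> sa_norm (cstar_completion A q) (cls X) * sa_norm (cstar_completion A q) (cls Y)"
    if "X \<in> CS" "Y \<in> CS" for X Y
    by (rule LIMSEQ_le[OF compl_norm[OF CS_mult[OF that]]
          tendsto_mult[OF compl_norm[OF that(1)] compl_norm[OF that(2)]]])
       (use that in \<open>auto simp: q_mult CS_carrier\<close>)
  have 4: "sa_norm (cstar_completion A q) (cls (\<lambda>n. c \<odot> X n)) = cmod c * sa_norm (cstar_completion A q) (cls X)"
    if "X \<in> CS" for X c
    by (rule compl_normI[OF CS_scale[OF that]])
      (use tendsto_mult_left[OF compl_norm[OF that], of "cmod c"] that in \<open>simp add: q_scale CS_carrier\<close>)
  have 5: "sa_norm (cstar_completion A q) (cls (\<lambda>n. (X n)\<^sup>\<star> \<otimes> X n)) = (sa_norm (cstar_completion A q) (cls X))\<^sup>2"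
    if "X \<in> CS" for X
    by (rule compl_normI[OF CS_mult[OF CS_star[OF that] that]])
      (use tendsto_power[OF compl_norm[OF that], of 2] that in \<open>simp add: q_star_mult CS_carrier\<close>)
  show ?thesis unfolding cstar_seminorm_def
    by (auto simp: compl_carrier compl_zero compl_add compl_scale compl_mult compl_star
      CS_const CS_add CS_scale CS_mult CS_star CS_carrier 1 2 3 4 5)
qed

lemma cls_approx: assumes "X \<in> CS" "0 < e"
  obtains x where "x \<in> sa_carrier A" "sa_norm (cstar_completion A q) (sa_diff (cstar_completion A q) (cls X) (cls (\<lambda>n. x))) < e"
proof -
  obtain M where M: "\<And>m n. m \<ge> M \<Longrightarrow> n \<ge> M \<Longrightarrow> q (X m \<ominus> X n) < e/2"
    using CS_D[OF assms(1), of "e/2"] assms by auto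
  have c: "(\<lambda>n. X n \<ominus> X M) \<in> CS" by (intro CS_diff CS_const CS_carrier assms)
  have "sa_norm (cstar_completion A q) (cls (\<lambda>n. X n \<ominus> X M)) \<le> e/2"
    by (rule LIMSEQ_le_const2[OF compl_norm[OF c]]) (use M[of _ M] in \<open>auto intro!: exI[of _ M] less_imp_le\<close>)
  then have "sa_norm (cstar_completion A q) (sa_diff (cstar_completion A q) (cls X) (cls (\<lambda>n. X M))) < e"
    using assms by (simp add: compl_diff CS_const CS_carrier)
  then show ?thesis using that[of "X M"] assms CS_carrier by blast
qed

theorem cstar_algebra_completion: "cstar_algebra (cstar_completion A q)"
proof -
  let ?B = "cstar_completion A q"
  interpret B: seminormed_star_algebra ?B "sa_norm ?B"
    by (intro seminormed_star_algebra.intro star_algebra_completion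
        seminormed_star_algebra_axioms.intro seminorm_completion)
  have "x = sa_zero ?B" if "x \<in> sa_carrier ?B" "sa_norm ?B x = 0" for x
    using that(1)
  proof (rule cls_cases)
    fix X assume X: "X \<in> CS" "x = cls X"
    then have "(\<lambda>n. q (X n)) \<longlonglongrightarrow> 0" using compl_norm[of X] that by simp
    then show ?thesis
      using X by (simp add: compl_zero cls_eq_iff CS_const NR_iff diff_zero CS_carrier)
  qed
  moreover have "\<exists>x\<in>sa_carrier ?B. (\<lambda>n. sa_norm ?B (sa_diff ?B (S n) x)) \<longlonglongrightarrow> 0"
    if S: "S \<in> cauchy_seqs ?B (sa_norm ?B)" for S
  proof -
    have Sc: "S n \<in> sa_carrier ?B" for n using B.CS_carrier[OF S] .
    have "\<exists>x. x \<in> sa_carrier A \<and> sa_norm ?B (sa_diff ?B (S n) (cls (\<lambda>_. x))) < 1 / Suc n" for n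
      using Sc[of n]
    proof (rule cls_cases)
      fix X assume "X \<in> CS" "S n = cls X"
      then show ?thesis using cls_approx[of X "1 / Suc n"] by auto
    qed
    then obtain x where x: "\<And>n. x n \<in> sa_carrier A"
      and xs: "\<And>n. sa_norm ?B (sa_diff ?B (S n) (cls (\<lambda>_. x n))) < 1 / Suc n" by metis
    have cx: "cls (\<lambda>_. x n) \<in> sa_carrier ?B" for n by (simp add: cls_in CS_const x)
    have qx: "q (x m \<ominus> x n) = sa_norm ?B (sa_diff ?B (cls (\<lambda>_. x m)) (cls (\<lambda>_. x n)))" for m n
      by (simp add: compl_diff CS_const x compl_norm_const)
    have qle: "q (x m \<ominus> x n) \<le> 1 / Suc m + sa_norm ?B (sa_diff ?B (S m) (S n)) + 1 / Suc n" for m n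
      using B.q_triangle[OF cx[of m] Sc[of m] cx[of n]] B.q_triangle[OF Sc[of m] Sc[of n] cx[of n]] xs[of m] xs[of n]
        B.q_diff_commute[OF cx[of m] Sc[of m]] by (simp add: qx)
    have xCS: "x \<in> CS"
    proof (rule CS_I[OF x])
      fix e :: real assume e: "0 < e"
      obtain N where N: "\<And>m n. m \<ge> N \<Longrightarrow> n \<ge> N \<Longrightarrow> sa_norm ?B (sa_diff ?B (S m) (S n)) < e / 3"
        using B.CS_D[OF S, of "e/3"] e by auto
      obtain M where M: "1 / Suc M < e / 3" using e nat_approx_posE[of "e/3"] by auto
      have M': "1 / Suc m < e / 3" if "m \<ge> M" for m
        using M that by (meson divide_left_mono le_less_trans less_eq_real_def of_nat_0_less_iff of_nat_mono
            Suc_le_mono zero_le_one zero_less_Suc frac_le zero_less_one)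
      have "q (x m \<ominus> x n) < e" if "m \<ge> max M N" "n \<ge> max M N" for m n
        using qle[of m n] N[of m n] M'[of m] M'[of n] that by simp
      then show "\<exists>N. \<forall>m\<ge>N. \<forall>n\<ge>N. q (x m \<ominus> x n) < e" by blast
    qed
    have lim: "(\<lambda>m. sa_norm ?B (sa_diff ?B (cls (\<lambda>_. x m)) (cls x))) \<longlonglongrightarrow> 0"
    proof (rule LIMSEQ_I)
      fix e :: real assume e: "0 < e"
      then obtain N where N: "\<And>m n. m \<ge> N \<Longrightarrow> n \<ge> N \<Longrightarrow> q (x m \<ominus> x n) < e / 2"
        using CS_D[OF xCS, of "e/2"] by auto
      have "norm (sa_norm ?B (sa_diff ?B (cls (\<lambda>_. x m)) (cls x)) - 0) < e" if "m \<ge> N" for m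
      proof -
        have c: "(\<lambda>n. x m \<ominus> x n) \<in> CS" using x xCS by (intro CS_diff CS_const)
        have "sa_norm ?B (cls (\<lambda>n. x m \<ominus> x n)) \<le> e/2"
          by (rule LIMSEQ_le_const2[OF compl_norm[OF c]])
            (use N[of m] that in \<open>auto intro!: exI[of _ N] less_imp_le\<close>)
        moreover have "0 \<le> sa_norm ?B (cls (\<lambda>n. x m \<ominus> x n))" by (rule B.q_nonneg) (rule cls_in[OF c])
        ultimately show ?thesis using e by (simp add: compl_diff CS_const x xCS)
      qed
      then show "\<exists>no. \<forall>n\<ge>no. norm (sa_norm ?B (sa_diff ?B (cls (\<lambda>_. x n)) (cls x)) - 0) < e" by blast
    qed
    have "(\<lambda>n. sa_norm ?B (sa_diff ?B (S n) (cls x))) \<longlonglongrightarrow> 0"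
    proof (rule tendsto_squeeze0)
      show "(\<lambda>n. 1 / Suc n + sa_norm ?B (sa_diff ?B (cls (\<lambda>_. x n)) (cls x))) \<longlonglongrightarrow> 0"
        using tendsto_add[OF LIMSEQ_Suc[OF lim_1_over_n] lim] by simp
      show "0 \<le> sa_norm ?B (sa_diff ?B (S n) (cls x))" for n
        by (intro B.q_nonneg B.diff_closed Sc cls_in xCS)
      show "sa_norm ?B (sa_diff ?B (S n) (cls x)) \<le>
          1 / Suc n + sa_norm ?B (sa_diff ?B (cls (\<lambda>_. x n)) (cls x))" for n
        using B.q_triangle[OF Sc[of n] cx[of n] cls_in[OF xCS]] xs[of n] by simp
    qed
    then show ?thesis using cls_in[OF xCS] by blast
  qed
  ultimately show ?thesis
    by (intro cstar_algebra.intro star_algebra_completion cstar_algebra_axioms.intro seminorm_completion)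
qed


lemma embed_eq: "cstar_completion_embed A q x = cls (\<lambda>n. x)"
  by (simp add: cstar_completion_embed_def cls_def)

lemma star_hom_embed: "star_hom A (cstar_completion A q) (cstar_completion_embed A q)"
  by (simp add: star_hom_def embed_eq cls_in CS_const compl_add compl_scale compl_mult compl_star)

lemma norm_embed: "x \<in> sa_carrier A \<Longrightarrow> sa_norm (cstar_completion A q) (cstar_completion_embed A q x) = q x"
  by (simp add: embed_eq compl_norm_const)

theorem completion_extend:
  assumes B: "cstar_algebra B" and hom: "star_hom A B \<pi>"
    and le: "\<And>x. x \<in> sa_carrier A \<Longrightarrow> sa_norm B (\<pi> x) \<le> q x"
  shows "\<exists>\<phi>. star_hom (cstar_completion A q) B \<phi> \<and>
    (\<forall>x\<in>sa_carrier A. \<phi> (cstar_completion_embed A q x) = \<pi> x)"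
proof -
  interpret B: cstar_algebra B by (rule B)
  interpret B: seminormed_star_algebra B "sa_norm B"
    by (intro seminormed_star_algebra.intro B.star_algebra_axioms
        seminormed_star_algebra_axioms.intro B.cstar_norm)
  have \<pi>: "\<And>x. x \<in> sa_carrier A \<Longrightarrow> \<pi> x \<in> sa_carrier B"
    "\<And>x y. x \<in> sa_carrier A \<Longrightarrow> y \<in> sa_carrier A \<Longrightarrow> \<pi> (x \<oplus> y) = \<pi> x \<oplus>\<^bsub>B\<^esub> \<pi> y"
    "\<And>c x. x \<in> sa_carrier A \<Longrightarrow> \<pi> (c \<odot> x) = c \<odot>\<^bsub>B\<^esub> \<pi> x"
    "\<And>x y. x \<in> sa_carrier A \<Longrightarrow> y \<in> sa_carrier A \<Longrightarrow> \<pi> (x \<otimes> y) = \<pi> x \<otimes>\<^bsub>B\<^esub> \<pi> y"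
    "\<And>x. x \<in> sa_carrier A \<Longrightarrow> \<pi> (x\<^sup>\<star>) = (\<pi> x)\<^sup>\<star>\<^bsub>B\<^esub>"
    using hom by (simp_all add: star_hom_def)
  have \<pi>d: "\<pi> x \<ominus>\<^bsub>B\<^esub> \<pi> y = \<pi> (x \<ominus> y)" if "x \<in> sa_carrier A" "y \<in> sa_carrier A" for x y
    using that by (simp add: sa_diff_def \<pi>)
  have cs: "(\<lambda>n. \<pi> (X n)) \<in> B.CS" if "X \<in> CS" for X
  proof (rule B.CS_I)
    fix e :: real assume "0 < e"
    from CS_D[OF that this] obtain N where "\<And>m n. m \<ge> N \<Longrightarrow> n \<ge> N \<Longrightarrow> q (X m \<ominus> X n) < e" by blast
    then have "\<forall>m\<ge>N. \<forall>n\<ge>N. sa_norm B (\<pi> (X m) \<ominus>\<^bsub>B\<^esub> \<pi> (X n)) < e"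
      unfolding \<pi>d[OF CS_carrier[OF that] CS_carrier[OF that]]
      using le_less_trans[OF le[OF diff_closed[OF CS_carrier[OF that] CS_carrier[OF that]]]] by blast
    then show "\<exists>N. \<forall>m\<ge>N. \<forall>n\<ge>N. sa_norm B (\<pi> (X m) \<ominus>\<^bsub>B\<^esub> \<pi> (X n)) < e" by blast
  qed (simp add: \<pi> CS_carrier that)
  have nr: "(\<lambda>n. \<pi> (X n), \<lambda>n. \<pi> (Y n)) \<in> B.NR" if "(X, Y) \<in> NR" for X Y
  proof -
    have c: "X \<in> CS" "Y \<in> CS" using that by (auto simp: NR_iff)
    have "(\<lambda>n. sa_norm B (\<pi> (X n) \<ominus>\<^bsub>B\<^esub> \<pi> (Y n))) \<longlonglongrightarrow> 0"
      by (rule tendsto_squeeze0[of _ "\<lambda>n. q (X n \<ominus> Y n)"])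
        (use that c in \<open>simp_all add: NR_iff \<pi>d le CS_carrier B.q_nonneg \<pi>\<close>)
    then show ?thesis using c cs by (simp add: B.NR_iff)
  qed
  define L where "L X b \<longleftrightarrow> b \<in> sa_carrier B \<and> (\<lambda>n. \<pi> (X n), \<lambda>n. b) \<in> B.NR" for X b
  have L_ex: "\<exists>b. L X b" if "X \<in> CS" for X
    using B.complete[OF cs[OF that]] cs[OF that] by (auto simp: L_def B.NR_iff B.CS_const)
  have tr: "(X, Z) \<in> B.NR" if "(X, Y) \<in> B.NR" "(Y, Z) \<in> B.NR" for X Y Z
    using B.NR_equiv that unfolding equiv_def trans_def by blast
  have sy: "(Y, X) \<in> B.NR" if "(X, Y) \<in> B.NR" for X Y
    using B.NR_equiv that unfolding equiv_def sym_def by blast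
  have L_un: "b = c" if "L X b" "L Y c" "(X, Y) \<in> NR" for X Y b c
  proof -
    have "(\<lambda>n. \<pi> (X n), \<lambda>n. b) \<in> B.NR" "(\<lambda>n. \<pi> (Y n), \<lambda>n. c) \<in> B.NR"
      using that by (simp_all add: L_def)
    from tr[OF sy[OF this(1)] tr[OF nr[OF that(3)] this(2)]] have "(\<lambda>n. b, \<lambda>n. c) \<in> B.NR" .
    then have "sa_norm B (b \<ominus>\<^bsub>B\<^esub> c) = 0" by (simp add: B.NR_iff LIMSEQ_const_iff)
    then have "b \<ominus>\<^bsub>B\<^esub> c = \<zero>\<^bsub>B\<^esub>" using that by (intro B.norm_definite) (auto simp: L_def)
    then show ?thesis using B.diff_add_cancel[of b c] B.zero_add[of c] that by (simp add: L_def)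
  qed
  define \<phi> where "\<phi> S = (SOME b. \<exists>X\<in>S. L X b)" for S
  have \<phi>: "L X (\<phi> (cls X))" if X: "X \<in> CS" for X
  proof -
    obtain b where b: "L X b" using L_ex[OF X] by blast
    then have "\<exists>b. \<exists>Y\<in>cls X. L Y b" using self_in_cls[OF X] by blast
    then have "\<exists>Y\<in>cls X. L Y (\<phi> (cls X))" unfolding \<phi>_def by (rule someI_ex)
    then obtain Y where "(X, Y) \<in> NR" "L Y (\<phi> (cls X))" using X by (auto simp: in_cls)
    then show ?thesis using L_un[OF b, of Y] b by simp
  qed
  have \<phi>I: "\<phi> (cls X) = b" if "L X b" "X \<in> CS" for X b
  proof (rule L_un[OF \<phi> that(1)])
    show "(X, X) \<in> NR" using that(2) in_cls[of X X] self_in_cls[of X] by simp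
  qed (rule that)
  have "star_hom (cstar_completion A q) B \<phi>"
    unfolding star_hom_def
  proof (intro conjI ballI allI, unfold compl_carrier, safe)
    fix X assume X: "X \<in> CS"
    show "\<phi> (cls X) \<in> sa_carrier B" using \<phi>[OF X] by (simp add: L_def)
    show "\<phi> ((cls X)\<^sup>\<star>\<^bsub>cstar_completion A q\<^esub>) = (\<phi> (cls X))\<^sup>\<star>\<^bsub>B\<^esub>"
      unfolding compl_star[OF X] using B.NR_star[of "\<lambda>n. \<pi> (X n)" "\<lambda>n. \<phi> (cls X)"] \<phi>[OF X] X
      by (intro \<phi>I CS_star) (simp_all add: L_def \<pi> CS_carrier)
    show "\<phi> (c \<odot>\<^bsub>cstar_completion A q\<^esub> cls X) = c \<odot>\<^bsub>B\<^esub> \<phi> (cls X)" for c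
      unfolding compl_scale[OF X] using B.NR_scale[of "\<lambda>n. \<pi> (X n)" "\<lambda>n. \<phi> (cls X)"] \<phi>[OF X] X
      by (intro \<phi>I CS_scale) (simp_all add: L_def \<pi> CS_carrier)
    fix Y assume Y: "Y \<in> CS"
    show "\<phi> (cls X \<oplus>\<^bsub>cstar_completion A q\<^esub> cls Y) = \<phi> (cls X) \<oplus>\<^bsub>B\<^esub> \<phi> (cls Y)"
      unfolding compl_add[OF X Y] using B.NR_add[of "\<lambda>n. \<pi> (X n)" "\<lambda>n. \<phi> (cls X)" "\<lambda>n. \<pi> (Y n)" "\<lambda>n. \<phi> (cls Y)"]
        \<phi>[OF X] \<phi>[OF Y] X Y
      by (intro \<phi>I CS_add) (simp_all add: L_def \<pi> CS_carrier)
    show "\<phi> (cls X \<otimes>\<^bsub>cstar_completion A q\<^esub> cls Y) = \<phi> (cls X) \<otimes>\<^bsub>B\<^esub> \<phi> (cls Y)"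
      unfolding compl_mult[OF X Y] using B.NR_mult[of "\<lambda>n. \<pi> (X n)" "\<lambda>n. \<phi> (cls X)" "\<lambda>n. \<pi> (Y n)" "\<lambda>n. \<phi> (cls Y)"]
        \<phi>[OF X] \<phi>[OF Y] X Y
      by (intro \<phi>I CS_mult) (simp_all add: L_def \<pi> CS_carrier)
  qed
  moreover have "\<phi> (cstar_completion_embed A q x) = \<pi> x" if "x \<in> sa_carrier A" for x
    unfolding embed_eq
    by (rule \<phi>I) (use that in \<open>simp_all add: L_def CS_const \<pi> B.NR_iff B.CS_const B.diff_self B.q_zero\<close>)
  ultimately show ?thesis by blast
qed

end


section \<open>The universal property of graph C*-algebras\<close>

text \<open>
  None of what follows is needed to state results about \<^const>\<open>graph_cstar_algebra\<close>; it confirms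
  that the construction is the intended one. The algebra is a C*-algebra containing a family that
  satisfies the relations, and any *-homomorphism from the free *-algebra to a C*-algebra that
  satisfies the relations factors through it. The image of the free *-algebra is dense by
  \<open>cls_approx\<close>.
\<close>

definition admissible :: "'g set \<Rightarrow> 'g star_poly set \<Rightarrow> ('g star_poly \<Rightarrow> real) set" where
  "admissible X R = {q. cstar_seminorm (free_star_algebra X) q \<and> (\<forall>r\<in>R. q r = 0)}"

lemma universal_seminorm_eq: "universal_seminorm X R x = (SUP q\<in>admissible X R. q x)"
  by (simp add: universal_seminorm_def admissible_def)

definition bounded_relations :: "'g set \<Rightarrow> 'g star_poly set \<Rightarrow> bool" where
  "bounded_relations X R \<longleftrightarrow> (\<forall>x\<in>free_carrier X. \<exists>K. \<forall>q\<in>admissible X R. q x \<le> K)"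

context
  fixes X :: "'g set" and R :: "'g star_poly set"
  assumes bdd: "bounded_relations X R" and R: "R \<subseteq> free_carrier X"
begin

interpretation F: star_algebra "free_star_algebra X" by (rule star_algebra_free)

lemma zero_admissible: "(\<lambda>x. 0) \<in> admissible X R"
  by (simp add: admissible_def cstar_seminorm_def)

lemma bdd_above_admissible: "x \<in> free_carrier X \<Longrightarrow> bdd_above ((\<lambda>q. q x) ` admissible X R)"
  using bdd by (auto simp: bounded_relations_def bdd_above_def)

lemma le_universal: "q \<in> admissible X R \<Longrightarrow> x \<in> free_carrier X \<Longrightarrow> q x \<le> universal_seminorm X R x"
  unfolding universal_seminorm_eq by (rule cSUP_upper[OF _ bdd_above_admissible])

lemma universal_le: "(\<And>q. q \<in> admissible X R \<Longrightarrow> q x \<le> K) \<Longrightarrow> universal_seminorm X R x \<le> K"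
  unfolding universal_seminorm_eq using zero_admissible by (intro cSUP_least) auto

lemma universal_nonneg: "x \<in> free_carrier X \<Longrightarrow> 0 \<le> universal_seminorm X R x"
  using le_universal[OF zero_admissible] .

lemma universal_seminorm_cstar: "cstar_seminorm (free_star_algebra X) (universal_seminorm X R)"
proof -
  let ?U = "universal_seminorm X R"
  have adm: "0 \<le> q x" "q (x + y) \<le> q x + q y" "q (Poly_Mapping.single 0 c * x) = cmod c * q x"
    "q (x * y) \<le> q x * q y" "q (poly_star x * x) = (q x)\<^sup>2"
    if "q \<in> admissible X R" "x \<in> free_carrier X" "y \<in> free_carrier X" for q x y c
    using that unfolding admissible_def cstar_seminorm_def free_simps by blast+
  note cl = free_carrier_add free_carrier_mult free_carrier_scale free_carrier_star
  have 1: "?U (x + y) \<le> ?U x + ?U y" if "x \<in> free_carrier X" "y \<in> free_carrier X" for x y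
  proof (rule universal_le)
    fix q assume "q \<in> admissible X R"
    then show "q (x + y) \<le> ?U x + ?U y"
      using adm(2)[of q x y] le_universal[of q x] le_universal[of q y] that by simp
  qed
  have 2: "?U (x * y) \<le> ?U x * ?U y" if "x \<in> free_carrier X" "y \<in> free_carrier X" for x y
  proof (rule universal_le)
    fix q assume q: "q \<in> admissible X R"
    have "q x * q y \<le> ?U x * ?U y"
      using q that by (intro mult_mono le_universal universal_nonneg adm(1))
    then show "q (x * y) \<le> ?U x * ?U y" using adm(4)[OF q that] by simp
  qed
  have 3: "?U (Poly_Mapping.single 0 c * x) = cmod c * ?U x" if x: "x \<in> free_carrier X" for c x
  proof (cases "c = 0")
    case True
    have "q 0 \<le> 0" if "q \<in> admissible X R" for q
      using adm(3)[OF that free_carrier_zero free_carrier_zero, of 0] by simp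
    then have "?U 0 \<le> 0" by (rule universal_le)
    then show ?thesis using True universal_nonneg[OF free_carrier_zero] by simp
  next
    case False
    have le: "?U (Poly_Mapping.single 0 c * x) \<le> cmod c * ?U x" if x: "x \<in> free_carrier X" for c x
    proof (rule universal_le)
      fix q assume q: "q \<in> admissible X R"
      show "q (Poly_Mapping.single 0 c * x) \<le> cmod c * ?U x"
        unfolding adm(3)[OF q x x] by (intro mult_left_mono le_universal q x) simp
    qed
    have "Poly_Mapping.single 0 (inverse c) * (Poly_Mapping.single 0 c * x) = x"
      unfolding mult.assoc[symmetric] mult_single using False by simp
    then have "?U x \<le> cmod (inverse c) * ?U (Poly_Mapping.single 0 c * x)"
      using le[OF cl(3)[OF x], of "inverse c" c] by simp
    then have "cmod c * ?U x \<le> cmod c * (cmod (inverse c) * ?U (Poly_Mapping.single 0 c * x))"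
      by (rule mult_left_mono) simp
    also have "\<dots> = cmod (c * inverse c) * ?U (Poly_Mapping.single 0 c * x)"
      by (simp only: norm_mult mult.assoc)
    finally have "cmod c * ?U x \<le> ?U (Poly_Mapping.single 0 c * x)"
      using False by simp
    then show ?thesis using le[OF x, of c] by simp
  qed
  have 4: "?U (poly_star x * x) = (?U x)\<^sup>2" if x: "x \<in> free_carrier X" for x
  proof (rule antisym)
    have sx: "poly_star x * x \<in> free_carrier X" by (intro cl x)
    show "?U (poly_star x * x) \<le> (?U x)\<^sup>2"
    proof (rule universal_le)
      fix q assume q: "q \<in> admissible X R"
      show "q (poly_star x * x) \<le> (?U x)\<^sup>2"
        unfolding adm(5)[OF q x x] by (intro power_mono le_universal q x adm(1)[OF q x x])
    qed
    have "?U x \<le> sqrt (?U (poly_star x * x))"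
    proof (rule universal_le)
      fix q assume q: "q \<in> admissible X R"
      have "(q x)\<^sup>2 \<le> ?U (poly_star x * x)" using le_universal[OF q sx] adm(5)[OF q x x] by simp
      then show "q x \<le> sqrt (?U (poly_star x * x))" by (rule real_le_rsqrt)
    qed
    then have "(?U x)\<^sup>2 \<le> (sqrt (?U (poly_star x * x)))\<^sup>2"
      by (rule power_mono) (rule universal_nonneg[OF x])
    then show "(?U x)\<^sup>2 \<le> ?U (poly_star x * x)"
      unfolding real_sqrt_pow2[OF universal_nonneg[OF sx]] .
  qed
  show ?thesis
    unfolding cstar_seminorm_def free_simps
    by (intro conjI ballI allI universal_nonneg 1 2 3 4)
qed

lemma seminormed_universal: "seminormed_star_algebra (free_star_algebra X) (universal_seminorm X R)"
  by (intro seminormed_star_algebra.intro star_algebra_free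
      seminormed_star_algebra_axioms.intro universal_seminorm_cstar)

interpretation U: seminormed_star_algebra "free_star_algebra X" "universal_seminorm X R"
  by (rule seminormed_universal)

lemma universal_seminorm_relations: "r \<in> R \<Longrightarrow> universal_seminorm X R r = 0"
  using universal_le[of r 0] universal_nonneg[of r] R by (fastforce simp: admissible_def)

theorem cstar_algebra_universal: "cstar_algebra (universal_cstar_algebra X R)"
  unfolding universal_cstar_algebra_def by (rule U.cstar_algebra_completion)

abbreviation "emb \<equiv> cstar_completion_embed (free_star_algebra X) (universal_seminorm X R)"

theorem star_hom_universal: "star_hom (free_star_algebra X) (universal_cstar_algebra X R) emb"
  unfolding universal_cstar_algebra_def by (rule U.star_hom_embed)

theorem universal_relations: assumes "r \<in> R" shows "emb r = sa_zero (universal_cstar_algebra X R)"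
proof -
  have r: "r \<in> free_carrier X" using assms R by blast
  have "(\<lambda>n. r, \<lambda>n. 0) \<in> null_rel (free_star_algebra X) (universal_seminorm X R)"
    using U.CS_const[of r] U.CS_const[of 0] r F.diff_zero[of r] universal_seminorm_relations[OF assms]
    by (simp add: U.NR_iff free_carrier_zero)
  then show ?thesis
    using U.CS_const[of r] U.CS_const[of 0] r
    by (simp add: universal_cstar_algebra_def U.embed_eq U.compl_zero U.cls_eq_iff free_carrier_zero)
qed

theorem universal_extend:
  assumes B: "cstar_algebra B" and hom: "star_hom (free_star_algebra X) B \<pi>"
    and rel: "\<And>r. r \<in> R \<Longrightarrow> \<pi> r = sa_zero B"
  shows "\<exists>\<phi>. star_hom (universal_cstar_algebra X R) B \<phi> \<and>
    (\<forall>x\<in>sa_carrier (free_star_algebra X). \<phi> (emb x) = \<pi> x)"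
proof -
  interpret B: cstar_algebra B by (rule B)
  interpret B: seminormed_star_algebra B "sa_norm B"
    by (intro seminormed_star_algebra.intro B.star_algebra_axioms
        seminormed_star_algebra_axioms.intro B.cstar_norm)
  have "(\<lambda>x. sa_norm B (\<pi> x)) \<in> admissible X R"
  proof -
    have h: "\<pi> x \<in> sa_carrier B" "\<pi> (x + y) = \<pi> x \<oplus>\<^bsub>B\<^esub> \<pi> y"
      "\<pi> (Poly_Mapping.single 0 c * x) = c \<odot>\<^bsub>B\<^esub> \<pi> x"
      "\<pi> (x * y) = \<pi> x \<otimes>\<^bsub>B\<^esub> \<pi> y" "\<pi> (poly_star x) = (\<pi> x)\<^sup>\<star>\<^bsub>B\<^esub>"
      if "x \<in> free_carrier X" "y \<in> free_carrier X" for x y c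
      using hom that unfolding star_hom_def free_simps by blast+
    have "sa_norm B (\<pi> (poly_star x * x)) = (sa_norm B (\<pi> x))\<^sup>2" if "x \<in> free_carrier X" for x
      unfolding h(4)[OF free_carrier_star[OF that] that] h(5)[OF that that]
      by (rule B.q_star_mult[OF h(1)[OF that that]])
    then show ?thesis
      unfolding admissible_def cstar_seminorm_def free_simps
      by (simp add: h rel B.q_nonneg B.q_add B.q_scale B.q_mult B.q_zero)
  qed
  then have "sa_norm B (\<pi> x) \<le> universal_seminorm X R x" if "x \<in> sa_carrier (free_star_algebra X)" for x
    using le_universal[of "\<lambda>x. sa_norm B (\<pi> x)" x] that by simp
  then show ?thesis
    unfolding universal_cstar_algebra_def by (rule U.completion_extend[OF B hom])
qed

end

lemma free_carrier_single: "w \<noteq> [] \<Longrightarrow> fst ` set w \<subseteq> X \<Longrightarrow> Poly_Mapping.single w c \<in> free_carrier X"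
  by (simp add: free_carrier_def)

lemma bounded_relationsI:
  assumes "\<And>g. g \<in> X \<Longrightarrow> \<exists>K. \<forall>q\<in>admissible X R. q (gen g) \<le> K"
  shows "bounded_relations X R"
proof -
  have adm: "0 \<le> q x" "q (x + y) \<le> q x + q y" "q (Poly_Mapping.single 0 c * x) = cmod c * q x"
    "q (x * y) \<le> q x * q y" "q (poly_star x) = q x" "q 0 = 0"
    if "q \<in> admissible X R" "x \<in> free_carrier X" "y \<in> free_carrier X" for q x y c
  proof -
    interpret seminormed_star_algebra "free_star_algebra X" q
      using that by (intro seminormed_star_algebra.intro star_algebra_free
          seminormed_star_algebra_axioms.intro) (simp add: admissible_def)
    show "0 \<le> q x" "q (x + y) \<le> q x + q y" "q (Poly_Mapping.single 0 c * x) = cmod c * q x"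
      "q (x * y) \<le> q x * q y" "q (poly_star x) = q x" "q 0 = 0"
      using that q_nonneg q_add q_scale q_mult q_star q_zero by auto
  qed
  have letter: "\<exists>K\<ge>0. \<forall>q\<in>admissible X R. q (Poly_Mapping.single [a] 1) \<le> K" if "fst a \<in> X" for a
  proof -
    obtain K where K: "\<forall>q\<in>admissible X R. q (gen (fst a)) \<le> K" using assms[OF \<open>fst a \<in> X\<close>] by blast
    have "Poly_Mapping.single [a] 1 = gen (fst a) \<or> Poly_Mapping.single [a] 1 = poly_star (gen (fst a))"
      by (cases a; cases "snd a") (auto simp: gen_def poly_star_single word_star_def)
    moreover have g: "gen (fst a) \<in> free_carrier X" using that by (simp add: gen_def free_carrier_single)
    ultimately have "q (Poly_Mapping.single [a] 1) \<le> max 0 K" if "q \<in> admissible X R" for q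
      using K adm(5)[OF that g g] that by (auto simp: le_max_iff_disj)
    then show ?thesis by (intro exI[of _ "max 0 K"]) simp
  qed
  have word: "w \<noteq> [] \<Longrightarrow> fst ` set w \<subseteq> X \<Longrightarrow>
      \<exists>K\<ge>0. \<forall>q\<in>admissible X R. q (Poly_Mapping.single w 1) \<le> K" for w
  proof (induction w rule: list_nonempty_induct)
    case (single a) then show ?case using letter by simp
  next
    case (cons a w)
    obtain K where K: "K \<ge> 0" "\<forall>q\<in>admissible X R. q (Poly_Mapping.single w 1) \<le> K" using cons by auto
    obtain L where L: "L \<ge> 0" "\<forall>q\<in>admissible X R. q (Poly_Mapping.single [a] 1) \<le> L"
      using letter[of a] cons by auto
    have "q (Poly_Mapping.single (a # w) 1) \<le> L * K" if q: "q \<in> admissible X R" for q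
    proof -
      have e: "Poly_Mapping.single (a # w) 1 = Poly_Mapping.single [a] 1 * Poly_Mapping.single w (1::complex)"
        by (simp add: mult_single plus_list_def)
      have c: "Poly_Mapping.single [a] 1 \<in> free_carrier X" "Poly_Mapping.single w 1 \<in> free_carrier X"
        using cons by (auto intro!: free_carrier_single)
      have "q (Poly_Mapping.single [a] 1) * q (Poly_Mapping.single w 1) \<le> L * K"
        using K L q c adm(1) by (intro mult_mono) auto
      then show ?thesis unfolding e using adm(4)[OF q c] by simp
    qed
    then show ?case using K L by (intro exI[of _ "L * K"]) simp
  qed
  have "x \<in> free_carrier X \<longrightarrow> (\<exists>K. \<forall>q\<in>admissible X R. q x \<le> K)" for x
  proof (induction x rule: update_induct)
    case const
    have "q 0 \<le> 0" if "q \<in> admissible X R" for q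
      using adm(6)[OF that free_carrier_zero free_carrier_zero] by simp
    then show ?case by blast
  next
    case (update f w c)
    have e: "Poly_Mapping.update w c f = f + Poly_Mapping.single 0 c * Poly_Mapping.single w 1"
      using update(1) by (intro poly_mapping_eqI)
        (auto simp: lookup_update lookup_add lookup_single mult_single when_def not_in_keys_iff_lookup_eq_zero)
    show ?case
    proof
      assume a: "Poly_Mapping.update w c f \<in> free_carrier X"
      have k: "Poly_Mapping.keys (Poly_Mapping.update w c f) = insert w (Poly_Mapping.keys f)"
        using update(2) by (simp add: keys_update)
      have f: "f \<in> free_carrier X" and w: "w \<noteq> []" "fst ` set w \<subseteq> X"
        using a k by (auto simp: free_carrier_def)
      obtain K where K: "\<And>q. q \<in> admissible X R \<Longrightarrow> q f \<le> K" using update f by blast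
      obtain L where L: "\<And>q. q \<in> admissible X R \<Longrightarrow> q (Poly_Mapping.single w 1) \<le> L" using word[OF w] by blast
      have s: "Poly_Mapping.single w 1 \<in> free_carrier X" by (rule free_carrier_single[OF w])
      have "q (Poly_Mapping.update w c f) \<le> K + cmod c * L" if q: "q \<in> admissible X R" for q
      proof -
        have "q (Poly_Mapping.update w c f) \<le> q f + cmod c * q (Poly_Mapping.single w 1)"
          unfolding e using adm(2)[OF q f free_carrier_scale[OF s, of c]] adm(3)[OF q s s, of c] by linarith
        also have "\<dots> \<le> K + cmod c * L" using K[OF q] L[OF q] by (intro add_mono mult_left_mono) simp_all
        finally show ?thesis .
      qed
      then show "\<exists>K. \<forall>q\<in>admissible X R. q (Poly_Mapping.update w c f) \<le> K" by blast
    qed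
  qed
  then show ?thesis by (simp add: bounded_relations_def)
qed

lemma free_carrier_diff: "x \<in> free_carrier X \<Longrightarrow> y \<in> free_carrier X \<Longrightarrow> x - y \<in> free_carrier X"
  using free_carrier_add[of x X "- y"] by (simp add: free_carrier_def)

lemma free_carrier_sum: "(\<And>i. i \<in> I \<Longrightarrow> f i \<in> free_carrier X) \<Longrightarrow> sum f I \<in> free_carrier X"
  by (induction I rule: infinite_finite_induct) (auto simp: free_carrier_zero free_carrier_add)

lemma gen_in_carrier: "g \<in> X \<Longrightarrow> gen g \<in> free_carrier X"
  by (simp add: gen_def free_carrier_single)

lemma ck_relations_carrier:
  assumes "wf_digraph G" shows "ck_relations G \<subseteq> free_carrier (ck_gens G)"
proof -
  have p: "p_gen v \<in> free_carrier (ck_gens G)" if "v \<in> verts G" for v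
    using that by (intro gen_in_carrier) (simp add: ck_gens_def)
  have s: "s_gen e \<in> free_carrier (ck_gens G)" if "e \<in> arcs G" for e
    using that by (intro gen_in_carrier) (simp add: ck_gens_def)
  have ht: "head G e \<in> verts G" "tail G e \<in> verts G" if "e \<in> arcs G" for e
    using assms that by (auto simp: wf_digraph_def)
  show ?thesis
    by (auto simp: ck_relations_def out_arcs_def
        intro!: free_carrier_diff free_carrier_mult free_carrier_star free_carrier_sum p s ht)
qed

lemma ck_relations_bounded:
  assumes wf: "wf_digraph G" shows "bounded_relations (ck_gens G) (ck_relations G)"
proof (rule bounded_relationsI)
  have p: "p_gen v \<in> free_carrier (ck_gens G)" if "v \<in> verts G" for v
    using that by (intro gen_in_carrier) (simp add: ck_gens_def)
  have s: "s_gen e \<in> free_carrier (ck_gens G)" if "e \<in> arcs G" for e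
    using that by (intro gen_in_carrier) (simp add: ck_gens_def)
  have rel: "q x \<le> q y" if q: "q \<in> admissible (ck_gens G) (ck_relations G)" and r: "x - y \<in> ck_relations G"
    and y: "y \<in> free_carrier (ck_gens G)" for q x y
  proof -
    have "x - y \<in> free_carrier (ck_gens G)" using ck_relations_carrier[OF wf] r by blast
    moreover have "\<forall>a\<in>free_carrier (ck_gens G). \<forall>b\<in>free_carrier (ck_gens G). q (a + b) \<le> q a + q b"
      using q unfolding admissible_def cstar_seminorm_def free_simps by blast
    ultimately have "q ((x - y) + y) \<le> q (x - y) + q y" using y by blast
    moreover have "q (x - y) = 0" using q r unfolding admissible_def by blast
    ultimately show ?thesis by simp
  qed
  have one: "x \<le> 1" if "x\<^sup>2 \<le> x" for x :: real
    
  proof (rule ccontr)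
    assume "\<not> x \<le> 1"
    then have "x * 1 < x * x" by (intro mult_strict_left_mono) simp_all
    then show False using that by (simp add: power2_eq_square)
  qed
  have pv: "q (p_gen v) \<le> 1" if q: "q \<in> admissible (ck_gens G) (ck_relations G)" and v: "v \<in> verts G" for q v
  proof -
    interpret seminormed_star_algebra "free_star_algebra (ck_gens G)" q
      using q by (intro seminormed_star_algebra.intro star_algebra_free
          seminormed_star_algebra_axioms.intro) (simp add: admissible_def)
    have r1: "p_gen v * p_gen v - p_gen v \<in> ck_relations G"
      unfolding ck_relations_def
      by ((rule UnI1)+, rule CollectI, intro exI conjI, rule refl, rule v)
    have r2: "poly_star (p_gen v) - p_gen v \<in> ck_relations G"
      unfolding ck_relations_def
      by (rule UnI1, rule UnI1, rule UnI1, rule UnI1, rule UnI1, rule UnI1, rule UnI2,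
          rule CollectI, intro exI conjI, rule refl, rule v)
    have 1: "q (p_gen v * p_gen v) \<le> q (p_gen v)" by (rule rel[OF q r1 p[OF v]])
    have 2: "q (poly_star (p_gen v) - p_gen v) = 0"
      using q r2 unfolding admissible_def by blast
    have 3: "poly_star (p_gen v) - p_gen v \<in> free_carrier (ck_gens G)"
      by (intro free_carrier_diff free_carrier_star p v)
    have "(q (p_gen v))\<^sup>2 = q ((poly_star (p_gen v) - p_gen v) * p_gen v + p_gen v * p_gen v)"
      using q_star_mult[of "p_gen v"] p[OF v] by (simp add: left_diff_distrib)
    also have "\<dots> \<le> q ((poly_star (p_gen v) - p_gen v) * p_gen v) + q (p_gen v * p_gen v)"
      using q_add[of "(poly_star (p_gen v) - p_gen v) * p_gen v" "p_gen v * p_gen v"] 3 p[OF v]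
      by (simp add: free_carrier_mult)
    also have "\<dots> \<le> 0 + q (p_gen v)"
      using q_mult[of "poly_star (p_gen v) - p_gen v" "p_gen v"] 1 2 3 p[OF v] by (intro add_mono) simp_all
    finally show ?thesis by (intro one) simp
  qed
  fix g assume "g \<in> ck_gens G"
  then consider v where "v \<in> verts G" "g = Proj v" | e where "e \<in> arcs G" "g = PIso e"
    by (auto simp: ck_gens_def)
  then show "\<exists>K. \<forall>q\<in>admissible (ck_gens G) (ck_relations G). q (gen g) \<le> K"
  proof cases
    case 1 then show ?thesis using pv by blast
  next
    case 2
    have h: "head G e \<in> verts G" using wf 2 by (simp add: wf_digraph_def)
    have "q (s_gen e) \<le> 1" if q: "q \<in> admissible (ck_gens G) (ck_relations G)" for q
    proof -
      have "poly_star (s_gen e) * s_gen e - p_gen (head G e) \<in> ck_relations G"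
        unfolding ck_relations_def
        by (rule UnI1, rule UnI1, rule UnI2, rule CollectI, intro exI conjI, rule refl, rule 2(1))
      from rel[OF q this p[OF h]] pv[OF q h] have "q (poly_star (s_gen e) * s_gen e) \<le> 1" by simp
      moreover have "q (poly_star (s_gen e) * s_gen e) = (q (s_gen e))\<^sup>2"
        using q s[OF 2(1)] unfolding admissible_def cstar_seminorm_def free_simps by blast
      ultimately show ?thesis by (intro abs_le_D1[of "q (s_gen e)" 1]) (simp add: abs_square_le_1)
    qed
    then show ?thesis using 2 by blast
  qed
qed

theorem cstar_algebra_graph: "wf_digraph G \<Longrightarrow> cstar_algebra (graph_cstar_algebra G)"
  unfolding graph_cstar_algebra_def
  by (intro cstar_algebra_universal ck_relations_bounded ck_relations_carrier)

definition graph_embed ::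
  "('v, 'e) pre_digraph \<Rightarrow> ('v, 'e) ck_gen star_poly \<Rightarrow> (nat \<Rightarrow> ('v, 'e) ck_gen star_poly) set" where
  "graph_embed G = cstar_completion_embed (free_star_algebra (ck_gens G))
     (universal_seminorm (ck_gens G) (ck_relations G))"

theorem star_hom_graph_embed:
  "wf_digraph G \<Longrightarrow> star_hom (free_star_algebra (ck_gens G)) (graph_cstar_algebra G) (graph_embed G)"
  unfolding graph_cstar_algebra_def graph_embed_def
  by (intro star_hom_universal ck_relations_bounded ck_relations_carrier)

theorem graph_relations:
  "wf_digraph G \<Longrightarrow> r \<in> ck_relations G \<Longrightarrow> graph_embed G r = sa_zero (graph_cstar_algebra G)"
  unfolding graph_cstar_algebra_def graph_embed_def
  by (intro universal_relations ck_relations_bounded ck_relations_carrier)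

theorem graph_cstar_universal:
  assumes "wf_digraph G" "cstar_algebra B" "star_hom (free_star_algebra (ck_gens G)) B \<pi>"
    and "\<And>r. r \<in> ck_relations G \<Longrightarrow> \<pi> r = sa_zero B"
  shows "\<exists>\<phi>. star_hom (graph_cstar_algebra G) B \<phi> \<and>
    (\<forall>x\<in>sa_carrier (free_star_algebra (ck_gens G)). \<phi> (graph_embed G x) = \<pi> x)"
  unfolding graph_cstar_algebra_def graph_embed_def
  by (intro universal_extend ck_relations_bounded ck_relations_carrier assms)

end

theory Submission
  imports Defs
begin

text \<open>
  In a singular graph the summation relations are void, so the algebra can be presented by other
  generators at will. Let there be infinitely many edges \<open>d\<^sub>i\<close> from \<open>u\<close> to \<open>v\<close> and an edge \<open>f\<close> from
  \<open>v\<close> to \<open>w\<close>. Cutting every \<open>d\<^sub>i\<close> into \<open>d\<^sub>i (p\<^sub>v - f f\<^sup>*)\<close> and \<open>d\<^sub>i f\<close>, and gluing the pieces together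
  again after a shift of the index in the manner of Hilbert's hotel, releases infinitely many partial
  isometries that serve as new edges from \<open>u\<close> to \<open>w\<close>. If the graph has finitely many vertices and no
  breaking vertices, repeating this finitely often makes the number of edges infinite for all pairs of
  vertices joined by a path. The result depends only on the path relation, which the graph shares
  with its amplification. All substitutions are polynomial in the generators, so they are contractive
  for the universal seminorms and no spectral theory is needed.
\<close>

section \<open>Substitution homomorphisms\<close>

text \<open>Replacing \<open>c_i\<close> in the second summand by \<open>c_(2i+1)\<close> still
  gives partial isometries from \<open>u\<close> to \<open>v\<close> with orthogonal ranges, and the
  pieces \<open>c_(2j)\<close>, now spare, behave exactly like edges from \<open>u\<close> to
  \<open>w\<close>. The first summand has to be carried along, since \<open>f f*\<close> is in
  general a proper part of \<open>p_v\<close>. A universal property yields homomorphisms but no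
  injectivity, so the inverse must be written down as well; the symmetry of the pieces supplies it.
  An exchange needs infinitely many edges from \<open>u\<close> to some \<open>v\<close> to begin
  with; infinite multiplicity then spreads along the paths out of \<open>v\<close>, one edge at a
  time. A breaking vertex is the obstruction: its finitely many edges into the complement of a
  hereditary set may lead to vertices that this spreading never reaches. Finiteness of the vertex
  set enters twice: it forces infinitely many edges to accumulate at single targets, and it bounds
  the number of exchanges.\<close>

fun word_eval :: "('g \<Rightarrow> 'h star_poly) \<Rightarrow> ('g \<times> bool) list \<Rightarrow> 'h star_poly" where
  "word_eval \<phi> [] = 1"
| "word_eval \<phi> ((g, b) # w) = (if b then poly_star (\<phi> g) else \<phi> g) * word_eval \<phi> w"

text \<open>Total on all polynomials, constants included, so that compatibility with the operations
  holds without carrier conditions; the non-unital free algebras return with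
  \<open>poly_subst_carrier\<close>.\<close>

definition poly_subst :: "('g \<Rightarrow> 'h star_poly) \<Rightarrow> 'g star_poly \<Rightarrow> 'h star_poly" where
  "poly_subst \<phi> x =
     (\<Sum>w\<in>Poly_Mapping.keys x. Poly_Mapping.single 0 (Poly_Mapping.lookup x w) * word_eval \<phi> w)"

lemma poly_star_poly_star [simp]: "poly_star (poly_star x) = x"
  by (rule poly_mapping_eqI) (simp add: poly_star.rep_eq)

lemma word_star_zero [simp]: "word_star 0 = 0"
  by (simp add: word_star_def zero_list_def)

lemma poly_star_scalar: "poly_star (Poly_Mapping.single 0 c) = Poly_Mapping.single 0 (cnj c)"
  by (simp add: poly_star_single)

lemma poly_star_one [simp]: "poly_star 1 = 1"
  using poly_star_scalar[of 1] by simp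

lemma poly_star_uminus: "poly_star (- x) = - poly_star x"
  by (rule poly_mapping_eqI) (simp add: poly_star.rep_eq)

lemma poly_star_diff: "poly_star (x - y) = poly_star x - poly_star y"
  by (simp only: diff_conv_add_uminus poly_star_add poly_star_uminus)

lemma word_eval_append: "word_eval \<phi> (u @ w) = word_eval \<phi> u * word_eval \<phi> w"
  by (induction u) (auto simp: mult.assoc)

lemma word_eval_word_star: "word_eval \<phi> (word_star w) = poly_star (word_eval \<phi> w)"
  by (induction w) (auto simp: word_star_def word_eval_append poly_star_mult)

lemma poly_subst_superset:
  assumes "finite K" "Poly_Mapping.keys x \<subseteq> K"
  shows "poly_subst \<phi> x = (\<Sum>w\<in>K. Poly_Mapping.single 0 (Poly_Mapping.lookup x w) * word_eval \<phi> w)"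
  unfolding poly_subst_def using assms by (intro sum.mono_neutral_left) (auto simp: in_keys_iff)

lemma poly_subst_zero [simp]: "poly_subst \<phi> 0 = 0"
  by (simp add: poly_subst_def)

lemma poly_subst_single: "poly_subst \<phi> (Poly_Mapping.single w c) = Poly_Mapping.single 0 c * word_eval \<phi> w"
  by (subst poly_subst_superset[of "{w}"]) auto

lemma poly_subst_add: "poly_subst \<phi> (x + y) = poly_subst \<phi> x + poly_subst \<phi> y"
proof -
  let ?K = "Poly_Mapping.keys x \<union> Poly_Mapping.keys y"
  have "poly_subst \<phi> z = (\<Sum>w\<in>?K. Poly_Mapping.single 0 (Poly_Mapping.lookup z w) * word_eval \<phi> w)"
    if "Poly_Mapping.keys z \<subseteq> ?K" for z
    using that by (intro poly_subst_superset) auto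
  from this[of x] this[of y] this[of "x + y"] show ?thesis
    using keys_add[of x y] by (simp add: lookup_add single_add distrib_right sum.distrib)
qed

lemma poly_subst_uminus: "poly_subst \<phi> (- x) = - poly_subst \<phi> x"
  using poly_subst_add[of \<phi> x "- x"] by (simp add: add_eq_0_iff)

lemma poly_subst_diff: "poly_subst \<phi> (x - y) = poly_subst \<phi> x - poly_subst \<phi> y"
  by (simp only: diff_conv_add_uminus poly_subst_add poly_subst_uminus)

lemma scalar_left_commute:
  "x * (Poly_Mapping.single 0 c * y) = Poly_Mapping.single 0 c * (x * (y :: 'g star_poly))"
  by (simp only: scale_mult_right' flip: mult.assoc)

lemma poly_subst_mult: "poly_subst \<phi> (x * y) = poly_subst \<phi> x * poly_subst \<phi> y"
proof (induction x rule: poly_mapping_single_induct)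
  case (single w c)
  show ?case
  proof (induction y rule: poly_mapping_single_induct)
    case (single v d)
    have "Poly_Mapping.single 0 c * word_eval \<phi> w * (Poly_Mapping.single 0 d * word_eval \<phi> v) =
        Poly_Mapping.single 0 c * Poly_Mapping.single 0 d * (word_eval \<phi> w * word_eval \<phi> v)"
      by (simp only: mult.assoc scalar_left_commute[of "word_eval \<phi> w"])
    also have "\<dots> = Poly_Mapping.single 0 (c * d) * (word_eval \<phi> w * word_eval \<phi> v)"
      by (simp add: mult_single)
    finally show ?case
      by (simp add: mult_single poly_subst_single plus_list_def word_eval_append)
  qed (simp_all add: poly_subst_add distrib_left)
qed (simp_all add: poly_subst_add distrib_right)

lemma poly_subst_scale:
  "poly_subst \<phi> (Poly_Mapping.single 0 c * x) = Poly_Mapping.single 0 c * poly_subst \<phi> x"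
  by (simp add: poly_subst_mult poly_subst_single zero_list_def)

lemma poly_subst_star: "poly_subst \<phi> (poly_star x) = poly_star (poly_subst \<phi> x)"
proof (induction x rule: poly_mapping_single_induct)
  case (single w c)
  show ?case
    unfolding poly_star_single poly_subst_single word_eval_word_star poly_star_mult word_star_zero
    by (rule scale_mult_right'[symmetric])
qed (simp_all add: poly_subst_add poly_star_add)

lemma poly_subst_gen [simp]: "poly_subst \<phi> (gen g) = \<phi> g"
  by (simp add: gen_def poly_subst_single)

lemmas poly_subst_simps =
  poly_subst_add poly_subst_diff poly_subst_uminus poly_subst_mult poly_subst_star

lemma word_eval_carrier:
  assumes "\<And>g. g \<in> X \<Longrightarrow> \<phi> g \<in> free_carrier Y" "w \<noteq> []" "fst ` set w \<subseteq> X"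
  shows "word_eval \<phi> w \<in> free_carrier Y"
proof -
  have letter: "(if b then poly_star (\<phi> g) else \<phi> g) \<in> free_carrier Y" if "g \<in> X" for g b
    using assms(1)[OF that] by (simp add: free_carrier_star)
  show ?thesis
    using assms(2,3)
  proof (induction w rule: list_nonempty_induct)
    case (single a)
    obtain g b where "a = (g, b)" by (cases a)
    then show ?case using single letter[of g b] by simp
  next
    case (cons a w)
    obtain g b where "a = (g, b)" by (cases a)
    then show ?case using cons letter[of g b] by (simp add: free_carrier_mult del: if_split)
  qed
qed

lemma poly_subst_carrier:
  assumes "\<And>g. g \<in> X \<Longrightarrow> \<phi> g \<in> free_carrier Y" "x \<in> free_carrier X"
  shows "poly_subst \<phi> x \<in> free_carrier Y"
  unfolding poly_subst_def
proof (intro free_carrier_sum free_carrier_scale)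
  fix w assume "w \<in> Poly_Mapping.keys x"
  from free_carrierD[OF assms(2) this] show "word_eval \<phi> w \<in> free_carrier Y"
    by (intro word_eval_carrier[where X = X] assms(1)) simp_all
qed

lemma word_eval_id:
  assumes "\<And>g. g \<in> X \<Longrightarrow> \<phi> g = gen g" "fst ` set w \<subseteq> X"
  shows "word_eval \<phi> w = Poly_Mapping.single w 1"
  using assms(2)
proof (induction w)
  case Nil
  show ?case by (metis single_one word_eval.simps(1) zero_list_def)
next
  case (Cons a w)
  obtain g b where a: "a = (g, b)" by (cases a)
  have "(if b then poly_star (\<phi> g) else \<phi> g) = Poly_Mapping.single [(g, b)] 1"
    using Cons(2) assms(1)[of g] by (simp add: a gen_def poly_star_single word_star_def)
  then have "word_eval \<phi> (a # w) = Poly_Mapping.single [(g, b)] 1 * word_eval \<phi> w"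
    by (simp only: a word_eval.simps)
  also have "\<dots> = Poly_Mapping.single [(g, b)] 1 * Poly_Mapping.single w 1"
    using Cons by simp
  finally show ?case by (simp only: a mult_single plus_list_def append.simps mult_1_right)
qed

lemma poly_subst_id:
  assumes "\<And>g. g \<in> X \<Longrightarrow> \<phi> g = gen g" "x \<in> free_carrier X"
  shows "poly_subst \<phi> x = x"
proof -
  have "Poly_Mapping.single 0 c * word_eval \<phi> w = Poly_Mapping.single w c"
    if "w \<in> Poly_Mapping.keys x" for w c
  proof -
    have "word_eval \<phi> w = Poly_Mapping.single w 1"
      using free_carrierD[OF assms(2) that] by (intro word_eval_id[where X = X] assms(1)) simp_all
    then show ?thesis by (simp only: mult_single add_0 mult_1_right)
  qed
  then have "poly_subst \<phi> x = (\<Sum>w\<in>Poly_Mapping.keys x. Poly_Mapping.single w (Poly_Mapping.lookup x w))"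
    unfolding poly_subst_def by (intro sum.cong refl)
  also have "\<dots> = x"
    by (rule poly_mapping_eqI) (simp add: lookup_sum lookup_single when_def in_keys_iff)
  finally show ?thesis .
qed


section \<open>Congruence modulo a *-ideal\<close>

inductive_set star_ideal :: "'g star_poly set \<Rightarrow> 'g star_poly set" for R where
  base: "r \<in> R \<Longrightarrow> r \<in> star_ideal R"
| zero: "0 \<in> star_ideal R"
| add: "x \<in> star_ideal R \<Longrightarrow> y \<in> star_ideal R \<Longrightarrow> x + y \<in> star_ideal R"
| left: "x \<in> star_ideal R \<Longrightarrow> a * x \<in> star_ideal R"
| right: "x \<in> star_ideal R \<Longrightarrow> x * a \<in> star_ideal R"
| star: "x \<in> star_ideal R \<Longrightarrow> poly_star x \<in> star_ideal R"

definition star_cong :: "'g star_poly \<Rightarrow> 'g star_poly set \<Rightarrow> 'g star_poly \<Rightarrow> bool"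
    ("(_ \<approx>\<^bsub>_\<^esub> _)" [51, 0, 51] 50) where
  "x \<approx>\<^bsub>R\<^esub> y \<longleftrightarrow> x - y \<in> star_ideal R"

lemma star_cong_refl [simp]: "x \<approx>\<^bsub>R\<^esub> x"
  by (simp add: star_cong_def star_ideal.zero)

lemma star_cong_sym: "x \<approx>\<^bsub>R\<^esub> y \<Longrightarrow> y \<approx>\<^bsub>R\<^esub> x"
  using star_ideal.left[of "x - y" R "- 1"] by (simp add: star_cong_def)

lemma star_cong_trans [trans]: "x \<approx>\<^bsub>R\<^esub> y \<Longrightarrow> y \<approx>\<^bsub>R\<^esub> z \<Longrightarrow> x \<approx>\<^bsub>R\<^esub> z"
  using star_ideal.add[of "x - y" R "y - z"] by (simp add: star_cong_def)

lemma star_cong_eq_trans [trans]: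
  "x = y \<Longrightarrow> y \<approx>\<^bsub>R\<^esub> z \<Longrightarrow> x \<approx>\<^bsub>R\<^esub> z"
  "x \<approx>\<^bsub>R\<^esub> y \<Longrightarrow> y = z \<Longrightarrow> x \<approx>\<^bsub>R\<^esub> z"
  by simp_all

lemma star_cong_add: "x \<approx>\<^bsub>R\<^esub> x' \<Longrightarrow> y \<approx>\<^bsub>R\<^esub> y' \<Longrightarrow> x + y \<approx>\<^bsub>R\<^esub> x' + y'"
  using star_ideal.add[of "x - x'" R "y - y'"] by (simp add: star_cong_def algebra_simps)

lemma star_cong_uminus: "x \<approx>\<^bsub>R\<^esub> y \<Longrightarrow> - x \<approx>\<^bsub>R\<^esub> - y"
  using star_cong_sym[of x R y] by (simp add: star_cong_def)

lemma star_cong_diff: "x \<approx>\<^bsub>R\<^esub> x' \<Longrightarrow> y \<approx>\<^bsub>R\<^esub> y' \<Longrightarrow> x - y \<approx>\<^bsub>R\<^esub> x' - y'"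
  using star_cong_add[of x R x' "- y" "- y'"] by (simp add: star_cong_uminus)

lemma star_cong_mult:
  assumes "x \<approx>\<^bsub>R\<^esub> x'" "y \<approx>\<^bsub>R\<^esub> y'" shows "x * y \<approx>\<^bsub>R\<^esub> x' * y'"
proof -
  have "x * y - x' * y' = (x - x') * y + x' * (y - y')" by (simp add: algebra_simps)
  then show ?thesis
    using assms unfolding star_cong_def by (auto intro: star_ideal.intros)
qed

lemma star_cong_star: "x \<approx>\<^bsub>R\<^esub> y \<Longrightarrow> poly_star x \<approx>\<^bsub>R\<^esub> poly_star y"
  using star_ideal.star[of "x - y" R] by (simp add: star_cong_def poly_star_diff)

lemma star_cong_base: "x - y \<in> R \<Longrightarrow> x \<approx>\<^bsub>R\<^esub> y"
  by (simp add: star_cong_def star_ideal.base)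

lemma star_cong_zero_iff: "x \<approx>\<^bsub>R\<^esub> 0 \<longleftrightarrow> x \<in> star_ideal R"
  by (simp add: star_cong_def)

lemma star_cong_0_mult: "x \<approx>\<^bsub>R\<^esub> 0 \<Longrightarrow> a * x \<approx>\<^bsub>R\<^esub> 0" "x \<approx>\<^bsub>R\<^esub> 0 \<Longrightarrow> x * a \<approx>\<^bsub>R\<^esub> 0"
  by (simp_all add: star_cong_zero_iff star_ideal.left star_ideal.right)

lemmas star_cong_intros =
  star_cong_add star_cong_diff star_cong_mult star_cong_star star_cong_refl

text \<open>Congruences of generators multiply up to words and add up to polynomials. This reduces
  each round trip of an isomorphism to a check on generators.\<close>

lemma poly_subst_congruent_id:
  assumes "\<And>g. g \<in> X \<Longrightarrow> \<phi> g \<approx>\<^bsub>R\<^esub> gen g" "x \<in> free_carrier X"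
  shows "poly_subst \<phi> x \<approx>\<^bsub>R\<^esub> x"
proof -
  have w: "word_eval \<phi> w \<approx>\<^bsub>R\<^esub> word_eval gen w" if "fst ` set w \<subseteq> X" for w
    using that by (induction w) (use assms(1) in \<open>auto intro!: star_cong_intros\<close>)
  have s: "sum a K \<approx>\<^bsub>R\<^esub> sum b K" if "\<And>w. w \<in> K \<Longrightarrow> a w \<approx>\<^bsub>R\<^esub> b w"
    for a b :: "('a \<times> bool) list \<Rightarrow> 'a star_poly" and K
    using that by (induction K rule: infinite_finite_induct) (auto intro: star_cong_add)
  have "poly_subst \<phi> x \<approx>\<^bsub>R\<^esub> poly_subst gen x"
    unfolding poly_subst_def using assms(2)
    by (intro s star_cong_mult w star_cong_refl) (auto dest: free_carrierD)
  then show ?thesis using poly_subst_id[OF _ assms(2), of gen] by simp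
qed

text \<open>
  The ideal is taken in the polynomial ring over all generators and with unit, so that it needs no
  carrier conditions; killing the generators outside \<open>X\<close> returns to the free algebra on \<open>X\<close>.
\<close>

lemma admissible_star_ideal:
  assumes q: "q \<in> admissible X R" and R: "R \<subseteq> free_carrier X"
    and x: "x \<in> star_ideal R" "x \<in> free_carrier X"
  shows "q x = 0"
proof -
  interpret seminormed_star_algebra "free_star_algebra X" q
    using q by (intro seminormed_star_algebra.intro star_algebra_free
        seminormed_star_algebra_axioms.intro) (simp add: admissible_def)
  define \<kappa> where "\<kappa> = poly_subst (\<lambda>g. if g \<in> X then gen g else 0)"
  have \<kappa>_id: "\<kappa> y = y" if "y \<in> free_carrier X" for y
    unfolding \<kappa>_def using that by (intro poly_subst_id[of X]) auto
  have le0: "q z = 0" if "q z \<le> 0" "z \<in> free_carrier X" for z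
    using that q_nonneg[of z] by simp
  have mult: "\<kappa> a * y \<in> free_carrier X \<and> q (\<kappa> a * y) = 0 \<and> y * \<kappa> a \<in> free_carrier X \<and> q (y * \<kappa> a) = 0"
    if y: "y \<in> free_carrier X" "q y = 0" for a y
  proof (induction a rule: poly_mapping_single_induct)
    case zero
    then show ?case using q_zero by (simp add: \<kappa>_def free_carrier_zero)
  next
    case (single w c)
    \<comment> \<open>A seminorm bounds products only within the carrier, but \<open>a\<close> may
      have a constant term. Word by word, \<open>\<kappa>\<close> yields either a carrier element or
      the unit, and the unit leaves \<open>y\<close> unchanged.\<close>
    have word: "word_eval (\<lambda>g. if g \<in> X then gen g else 0) w \<in> free_carrier X \<or>
        word_eval (\<lambda>g. if g \<in> X then gen g else 0) w = 1"
      by (cases "w = []")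
        (auto intro!: word_eval_carrier[where X = UNIV] gen_in_carrier free_carrier_zero)
    define z where "z = word_eval (\<lambda>g. if g \<in> X then gen g else 0) w"
    have z: "z * y \<in> free_carrier X \<and> q (z * y) = 0 \<and> y * z \<in> free_carrier X \<and> q (y * z) = 0"
      using word q_mult[of z y] q_mult[of y z] y
      by (auto simp: free_carrier_mult le0 simp flip: z_def)
    have k: "\<kappa> (Poly_Mapping.single w c) = Poly_Mapping.single 0 c * z"
      by (simp add: \<kappa>_def poly_subst_single z_def)
    then show ?case
      using z q_scale[of "z * y" c] q_scale[of "y * z" c]
      by (simp add: k mult.assoc scalar_left_commute[of y] free_carrier_scale)
  next
    case (add a b)
    have "\<kappa> (a + b) = \<kappa> a + \<kappa> b" by (simp add: \<kappa>_def poly_subst_add)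
    then show ?case
      using add q_add[of "\<kappa> a * y" "\<kappa> b * y"] q_add[of "y * \<kappa> a" "y * \<kappa> b"]
      by (auto simp: ring_distribs free_carrier_add le0)
  qed
  from x(1) have "\<kappa> x \<in> free_carrier X \<and> q (\<kappa> x) = 0"
  proof (induction rule: star_ideal.induct)
    case (base r)
    then show ?case using R q by (auto simp: \<kappa>_id admissible_def)
  next
    case zero
    then show ?case using q_zero by (simp add: \<kappa>_def free_carrier_zero)
  next
    case (add x y)
    then show ?case
      using q_add[of "\<kappa> x" "\<kappa> y"] by (auto simp: \<kappa>_def poly_subst_add free_carrier_add le0)
  next
    case (left x a)
    then show ?case using mult[of "\<kappa> x" a] by (simp add: \<kappa>_def poly_subst_mult)
  next
    case (right x a)
    then show ?case using mult[of "\<kappa> x" a] by (simp add: \<kappa>_def poly_subst_mult)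
  next
    case (star x)
    then show ?case using q_star[of "\<kappa> x"] by (simp add: \<kappa>_def poly_subst_star free_carrier_star)
  qed
  then show ?thesis using \<kappa>_id x(2) by simp
qed


section \<open>Isomorphisms from substitutions\<close>

text \<open>Whereas \<open>completion_extend\<close> describes its extension on constant sequences
  only, here the action on every Cauchy sequence is recorded, so that a composite of two extensions
  can be evaluated termwise.\<close>

lemma completion_map:
  assumes "seminormed_star_algebra A p" "seminormed_star_algebra B q" "star_hom A B \<pi>"
    and le: "\<And>x. x \<in> sa_carrier A \<Longrightarrow> q (\<pi> x) \<le> p x"
  shows "\<exists>\<Phi>. star_hom (cstar_completion A p) (cstar_completion B q) \<Phi> \<and>
    (\<forall>X\<in>cauchy_seqs A p. \<pi> \<circ> X \<in> cauchy_seqs B q \<and>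
      \<Phi> (null_rel A p `` {X}) = null_rel B q `` {\<pi> \<circ> X})"
proof -
  interpret A: seminormed_star_algebra A p by (rule assms)
  interpret B: seminormed_star_algebra B q by (rule assms)
  have \<pi>: "\<And>x. x \<in> sa_carrier A \<Longrightarrow> \<pi> x \<in> sa_carrier B"
    "\<And>x y. x \<in> sa_carrier A \<Longrightarrow> y \<in> sa_carrier A \<Longrightarrow> \<pi> (x \<oplus>\<^bsub>A\<^esub> y) = \<pi> x \<oplus>\<^bsub>B\<^esub> \<pi> y"
    "\<And>c x. x \<in> sa_carrier A \<Longrightarrow> \<pi> (c \<odot>\<^bsub>A\<^esub> x) = c \<odot>\<^bsub>B\<^esub> \<pi> x"
    "\<And>x y. x \<in> sa_carrier A \<Longrightarrow> y \<in> sa_carrier A \<Longrightarrow> \<pi> (x \<otimes>\<^bsub>A\<^esub> y) = \<pi> x \<otimes>\<^bsub>B\<^esub> \<pi> y"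
    "\<And>x. x \<in> sa_carrier A \<Longrightarrow> \<pi> (x\<^sup>\<star>\<^bsub>A\<^esub>) = (\<pi> x)\<^sup>\<star>\<^bsub>B\<^esub>"
    using assms(3) by (simp_all add: star_hom_def)
  have le_diff: "q (\<pi> x \<ominus>\<^bsub>B\<^esub> \<pi> y) \<le> p (x \<ominus>\<^bsub>A\<^esub> y)" if "x \<in> sa_carrier A" "y \<in> sa_carrier A" for x y
  proof -
    have "\<pi> (x \<ominus>\<^bsub>A\<^esub> y) = \<pi> x \<ominus>\<^bsub>B\<^esub> \<pi> y"
      using that by (simp add: sa_diff_def \<pi>)
    then show ?thesis using le[of "x \<ominus>\<^bsub>A\<^esub> y"] that by simp
  qed
  have cs: "\<pi> \<circ> X \<in> B.CS" if X: "X \<in> A.CS" for X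
  proof (rule B.CS_I)
    fix e :: real assume "0 < e"
    from A.CS_D[OF X this] obtain N where N: "\<forall>m\<ge>N. \<forall>n\<ge>N. p (X m \<ominus>\<^bsub>A\<^esub> X n) < e" by blast
    then show "\<exists>N. \<forall>m\<ge>N. \<forall>n\<ge>N. q ((\<pi> \<circ> X) m \<ominus>\<^bsub>B\<^esub> (\<pi> \<circ> X) n) < e"
      using le_less_trans[OF le_diff[OF A.CS_carrier[OF X] A.CS_carrier[OF X]]]
      by (intro exI[of _ N]) simp
  qed (simp add: \<pi> A.CS_carrier X)
  have nr: "(\<pi> \<circ> X, \<pi> \<circ> Y) \<in> B.NR" if "(X, Y) \<in> A.NR" for X Y
  proof -
    have c: "X \<in> A.CS" "Y \<in> A.CS" "(\<lambda>n. p (X n \<ominus>\<^bsub>A\<^esub> Y n)) \<longlonglongrightarrow> 0"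
      using that by (auto simp: A.NR_iff)
    have "(\<lambda>n. q (\<pi> (X n) \<ominus>\<^bsub>B\<^esub> \<pi> (Y n))) \<longlonglongrightarrow> 0"
      by (rule A.tendsto_squeeze0[OF _ _ c(3)])
        (use c in \<open>simp_all add: le_diff A.CS_carrier B.q_nonneg \<pi>\<close>)
    then show ?thesis using c cs by (simp add: B.NR_iff)
  qed
  \<comment> \<open>Any representative will do, because \<open>nr\<close> makes the image class
    independent of the choice.\<close>
  define \<Phi> where "\<Phi> S = B.cls (\<pi> \<circ> (SOME X. X \<in> S))" for S
  have \<Phi>: "\<Phi> (A.cls X) = B.cls (\<pi> \<circ> X)" if X: "X \<in> A.CS" for X
  proof -
    define Y where "Y = (SOME Y. Y \<in> A.cls X)"
    have "Y \<in> A.cls X" unfolding Y_def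
      by (rule someI[where P = "\<lambda>Y. Y \<in> A.cls X"], rule A.self_in_cls[OF X])
    then have "(X, Y) \<in> A.NR" using X by (simp add: A.in_cls)
    then have "(\<pi> \<circ> X, \<pi> \<circ> Y) \<in> B.NR" by (rule nr)
    then have "B.cls (\<pi> \<circ> X) = B.cls (\<pi> \<circ> Y)"
      by (subst B.cls_eq_iff) (simp_all add: B.NR_iff)
    then show ?thesis by (simp add: \<Phi>_def Y_def)
  qed
  have "star_hom (cstar_completion A p) (cstar_completion B q) \<Phi>"
    unfolding star_hom_def A.compl_carrier ball_simps(9)
  proof (intro conjI ballI allI)
    fix X assume X: "X \<in> A.CS"
    show "\<Phi> (A.cls X) \<in> sa_carrier (cstar_completion B q)"
      by (simp add: \<Phi> X cs B.cls_in)
    show "\<Phi> ((A.cls X)\<^sup>\<star>\<^bsub>cstar_completion A p\<^esub>) = (\<Phi> (A.cls X))\<^sup>\<star>\<^bsub>cstar_completion B q\<^esub>"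
      by (simp add: A.compl_star \<Phi> X cs B.compl_star A.CS_star comp_def \<pi> A.CS_carrier[OF X]
          cs[OF X, unfolded comp_def])
    show "\<Phi> (c \<odot>\<^bsub>cstar_completion A p\<^esub> A.cls X) = c \<odot>\<^bsub>cstar_completion B q\<^esub> \<Phi> (A.cls X)" for c
      by (simp add: A.compl_scale \<Phi> X B.compl_scale A.CS_scale comp_def \<pi> A.CS_carrier[OF X]
          cs[OF X, unfolded comp_def])
    fix Y assume Y: "Y \<in> A.CS"
    show "\<Phi> (A.cls X \<oplus>\<^bsub>cstar_completion A p\<^esub> A.cls Y) =
        \<Phi> (A.cls X) \<oplus>\<^bsub>cstar_completion B q\<^esub> \<Phi> (A.cls Y)"
      by (simp add: A.compl_add \<Phi> X Y B.compl_add A.CS_add comp_def \<pi> A.CS_carrier[OF X]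
          A.CS_carrier[OF Y] cs[OF X, unfolded comp_def] cs[OF Y, unfolded comp_def])
    show "\<Phi> (A.cls X \<otimes>\<^bsub>cstar_completion A p\<^esub> A.cls Y) =
        \<Phi> (A.cls X) \<otimes>\<^bsub>cstar_completion B q\<^esub> \<Phi> (A.cls Y)"
      by (simp add: A.compl_mult \<Phi> X Y B.compl_mult A.CS_mult comp_def \<pi> A.CS_carrier[OF X]
          A.CS_carrier[OF Y] cs[OF X, unfolded comp_def] cs[OF Y, unfolded comp_def])
  qed
  then show ?thesis using cs \<Phi> by (auto simp: A.cls_def B.cls_def)
qed

lemma completion_isomorphicI:
  assumes A: "seminormed_star_algebra A p" and B: "seminormed_star_algebra B q"
    and hom: "star_hom A B \<pi>" "star_hom B A \<rho>"
    and le: "\<And>x. x \<in> sa_carrier A \<Longrightarrow> q (\<pi> x) \<le> p x" "\<And>y. y \<in> sa_carrier B \<Longrightarrow> p (\<rho> y) \<le> q y"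
    and cancel: "\<And>x. x \<in> sa_carrier A \<Longrightarrow> p (\<rho> (\<pi> x) \<ominus>\<^bsub>A\<^esub> x) = 0"
      "\<And>y. y \<in> sa_carrier B \<Longrightarrow> q (\<pi> (\<rho> y) \<ominus>\<^bsub>B\<^esub> y) = 0"
  shows "cstar_completion A p \<cong>\<^sub>\<star> cstar_completion B q"
proof -
  obtain \<Phi> where \<Phi>: "star_hom (cstar_completion A p) (cstar_completion B q) \<Phi>"
    "\<And>X. X \<in> cauchy_seqs A p \<Longrightarrow> \<pi> \<circ> X \<in> cauchy_seqs B q"
    "\<And>X. X \<in> cauchy_seqs A p \<Longrightarrow> \<Phi> (null_rel A p `` {X}) = null_rel B q `` {\<pi> \<circ> X}"
    using completion_map[OF A B hom(1) le(1)] by blast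
  obtain \<Psi> where \<Psi>: "star_hom (cstar_completion B q) (cstar_completion A p) \<Psi>"
    "\<And>X. X \<in> cauchy_seqs B q \<Longrightarrow> \<rho> \<circ> X \<in> cauchy_seqs A p"
    "\<And>X. X \<in> cauchy_seqs B q \<Longrightarrow> \<Psi> (null_rel B q `` {X}) = null_rel A p `` {\<rho> \<circ> X}"
    using completion_map[OF B A hom(2) le(2)] by blast
  \<comment> \<open>Quantified over the algebras and their types, since it is used for both orders
    of composition.\<close>
  have roundtrip: "\<Psi> (\<Phi> S) = S"
    if "seminormed_star_algebra A p" and S: "S \<in> sa_carrier (cstar_completion A p)"
      and \<Phi>: "\<And>X. X \<in> cauchy_seqs A p \<Longrightarrow> \<pi> \<circ> X \<in> cauchy_seqs B q"
        "\<And>X. X \<in> cauchy_seqs A p \<Longrightarrow> \<Phi> (null_rel A p `` {X}) = null_rel B q `` {\<pi> \<circ> X}"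
      and \<Psi>: "\<And>X. X \<in> cauchy_seqs B q \<Longrightarrow> \<rho> \<circ> X \<in> cauchy_seqs A p"
        "\<And>X. X \<in> cauchy_seqs B q \<Longrightarrow> \<Psi> (null_rel B q `` {X}) = null_rel A p `` {\<rho> \<circ> X}"
      and cancel: "\<And>x. x \<in> sa_carrier A \<Longrightarrow> p (\<rho> (\<pi> x) \<ominus>\<^bsub>A\<^esub> x) = 0"
    for A :: "('e, 'f) star_algebra_scheme" and p and B :: "('g, 'h) star_algebra_scheme"
      and q \<pi> \<rho> \<Phi> \<Psi> S
  proof -
    interpret A: seminormed_star_algebra A p by (rule that(1))
    obtain X where X: "X \<in> A.CS" "S = A.cls X" using A.cls_cases[OF S] by blast
    have "(\<rho> \<circ> (\<pi> \<circ> X), X) \<in> A.NR"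
      using X \<Phi>(1) \<Psi>(1) by (simp add: A.NR_iff cancel A.CS_carrier)
    then have "A.cls (\<rho> \<circ> (\<pi> \<circ> X)) = A.cls X"
      by (subst A.cls_eq_iff) (simp_all add: A.NR_iff)
    then show ?thesis using X \<Phi> \<Psi> by (simp add: A.cls_def)
  qed
  have "bij_betw \<Phi> (sa_carrier (cstar_completion A p)) (sa_carrier (cstar_completion B q))"
  proof (rule bij_betw_byWitness[where f' = \<Psi>])
    show "\<forall>S\<in>sa_carrier (cstar_completion A p). \<Psi> (\<Phi> S) = S"
      using roundtrip[OF A _ \<Phi>(2,3) \<Psi>(2,3) cancel(1)] by blast
    show "\<forall>S\<in>sa_carrier (cstar_completion B q). \<Phi> (\<Psi> S) = S"
      using roundtrip[OF B _ \<Psi>(2,3) \<Phi>(2,3) cancel(2)] by blast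
  qed (use \<Phi>(1) \<Psi>(1) in \<open>auto simp: star_hom_def\<close>)
  then show ?thesis using \<Phi>(1) unfolding star_isomorphic_def by blast
qed

lemma poly_subst_comp: "poly_subst \<psi> (poly_subst \<phi> x) = poly_subst (\<lambda>g. poly_subst \<psi> (\<phi> g)) x"
proof (induction x rule: poly_mapping_single_induct)
  case (single w c)
  have "poly_subst \<psi> 1 = 1"
    by (metis poly_subst_single mult_1 single_one word_eval.simps(1) zero_list_def)
  then have "poly_subst \<psi> (word_eval \<phi> w) = word_eval (\<lambda>g. poly_subst \<psi> (\<phi> g)) w"
    by (induction w) (auto simp: poly_subst_mult poly_subst_star)
  then show ?case by (simp add: poly_subst_single poly_subst_scale)
qed (simp_all add: poly_subst_add)

lemma star_hom_poly_subst:
  assumes "\<And>g. g \<in> X \<Longrightarrow> \<phi> g \<in> free_carrier Y"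
  shows "star_hom (free_star_algebra X) (free_star_algebra Y) (poly_subst \<phi>)"
  using poly_subst_carrier[of X \<phi> Y, OF assms]
  by (simp add: star_hom_def poly_subst_add poly_subst_scale poly_subst_star)
    (simp add: poly_subst_mult)

text \<open>This is why substitutions contract universal seminorms: every seminorm in the supremum
  over the target pulls back to one in the supremum over the source.\<close>

lemma admissible_poly_subst:
  assumes \<phi>: "\<And>g. g \<in> X \<Longrightarrow> \<phi> g \<in> free_carrier Y"
    and R: "R \<subseteq> free_carrier X" "\<And>r. r \<in> R \<Longrightarrow> poly_subst \<phi> r \<in> star_ideal S"
    and S: "S \<subseteq> free_carrier Y" and q: "q \<in> admissible Y S"
  shows "(\<lambda>x. q (poly_subst \<phi> x)) \<in> admissible X R"
proof -
  note c = poly_subst_carrier[of X \<phi> Y, OF \<phi>]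
  have "q (poly_subst \<phi> r) = 0" if "r \<in> R" for r
    using admissible_star_ideal[OF q S R(2)[OF that]] c R(1) that by blast
  then show ?thesis
    using q c
    by (simp add: admissible_def cstar_seminorm_def poly_subst_add poly_subst_scale)
      (simp add: poly_subst_mult poly_subst_star)
qed

theorem universal_isomorphicI:
  assumes X: "bounded_relations X R" "R \<subseteq> free_carrier X"
    and Y: "bounded_relations Y S" "S \<subseteq> free_carrier Y"
    and \<phi>: "\<And>g. g \<in> X \<Longrightarrow> \<phi> g \<in> free_carrier Y" "\<And>r. r \<in> R \<Longrightarrow> poly_subst \<phi> r \<in> star_ideal S"
    and \<psi>: "\<And>g. g \<in> Y \<Longrightarrow> \<psi> g \<in> free_carrier X" "\<And>s. s \<in> S \<Longrightarrow> poly_subst \<psi> s \<in> star_ideal R"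
    and cancel: "\<And>g. g \<in> X \<Longrightarrow> poly_subst \<psi> (\<phi> g) \<approx>\<^bsub>R\<^esub> gen g"
      "\<And>g. g \<in> Y \<Longrightarrow> poly_subst \<phi> (\<psi> g) \<approx>\<^bsub>S\<^esub> gen g"
  shows "universal_cstar_algebra X R \<cong>\<^sub>\<star> universal_cstar_algebra Y S"
proof -
  have le: "universal_seminorm Y S (poly_subst \<phi> x) \<le> universal_seminorm X R x"
    if "x \<in> free_carrier X" "bounded_relations X R" "R \<subseteq> free_carrier X"
      "bounded_relations Y S" "S \<subseteq> free_carrier Y"
      "\<And>g. g \<in> X \<Longrightarrow> \<phi> g \<in> free_carrier Y" "\<And>r. r \<in> R \<Longrightarrow> poly_subst \<phi> r \<in> star_ideal S"
    for X :: "'e set" and Y :: "'f set" and R S \<phi> x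
    using that
    by (intro universal_le[OF that(4,5)] le_universal[OF that(2,3), of "\<lambda>x. _ (poly_subst \<phi> x)"]
        admissible_poly_subst)
  have roundtrip: "universal_seminorm Z T (poly_subst \<beta> (poly_subst \<alpha> x) - x) = 0"
    if "x \<in> free_carrier Z" "bounded_relations Z T" "T \<subseteq> free_carrier Z"
      "\<And>g. g \<in> Z \<Longrightarrow> \<alpha> g \<in> free_carrier W" "\<And>g. g \<in> W \<Longrightarrow> \<beta> g \<in> free_carrier Z"
      "\<And>g. g \<in> Z \<Longrightarrow> poly_subst \<beta> (\<alpha> g) \<approx>\<^bsub>T\<^esub> gen g"
    for Z :: "'e set" and W :: "'f set" and T \<alpha> \<beta> x
  proof -
    have "poly_subst \<beta> (poly_subst \<alpha> x) \<in> free_carrier Z"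
      using that by (intro poly_subst_carrier[of W] poly_subst_carrier[of Z])
    then have c: "poly_subst \<beta> (poly_subst \<alpha> x) - x \<in> free_carrier Z"
      using that(1) by (intro free_carrier_diff)
    have "poly_subst \<beta> (poly_subst \<alpha> x) - x \<in> star_ideal T"
      unfolding poly_subst_comp star_cong_def[symmetric]
      using that by (intro poly_subst_congruent_id[of Z]) simp_all
    then have "universal_seminorm Z T (poly_subst \<beta> (poly_subst \<alpha> x) - x) \<le> 0"
      using c that by (intro universal_le[OF that(2,3)]) (simp add: admissible_star_ideal)
    then show ?thesis using universal_nonneg[OF that(2,3) c] by simp
  qed
  have d: "sa_diff (free_star_algebra Z) x y = x - y" for Z :: "'i set" and x y
    by (simp add: sa_diff_def single_uminus)
  show ?thesis
    unfolding universal_cstar_algebra_def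
  proof (rule completion_isomorphicI[where \<pi> = "poly_subst \<phi>" and \<rho> = "poly_subst \<psi>"])
    fix x :: "'a star_poly" assume "x \<in> sa_carrier (free_star_algebra X)"
    then show "universal_seminorm X R (poly_subst \<psi> (poly_subst \<phi> x) \<ominus>\<^bsub>free_star_algebra X\<^esub> x) = 0"
      unfolding d using assms by (intro roundtrip[of _ X R \<phi> Y \<psi>]) simp_all
  next
    fix y :: "'b star_poly" assume "y \<in> sa_carrier (free_star_algebra Y)"
    then show "universal_seminorm Y S (poly_subst \<phi> (poly_subst \<psi> y) \<ominus>\<^bsub>free_star_algebra Y\<^esub> y) = 0"
      unfolding d using assms by (intro roundtrip[of _ Y S \<psi> X \<phi>]) simp_all
  qed (use assms in \<open>auto simp: le seminormed_universal star_hom_poly_subst\<close>)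
qed


section \<open>Cuntz--Krieger families modulo an ideal\<close>

lemma star_cong_left: "x \<approx>\<^bsub>R\<^esub> y \<Longrightarrow> a * x \<approx>\<^bsub>R\<^esub> a * y"
  by (intro star_cong_mult star_cong_refl)

lemma star_cong_right: "x \<approx>\<^bsub>R\<^esub> y \<Longrightarrow> x * a \<approx>\<^bsub>R\<^esub> y * a"
  by (intro star_cong_mult star_cong_refl)

lemma star_cong_mid: "x \<approx>\<^bsub>R\<^esub> y \<Longrightarrow> a * x * b \<approx>\<^bsub>R\<^esub> a * y * b"
  by (intro star_cong_left star_cong_right)

lemma star_cong_adjoint_zero:
  assumes "poly_star x * y \<approx>\<^bsub>R\<^esub> 0" shows "poly_star y * x \<approx>\<^bsub>R\<^esub> 0"
  using star_cong_star[OF assms] by (simp add: poly_star_mult)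

text \<open>The assumptions \<open>P_S\<close> and \<open>S_P\<close> do the work of the partial
  isometry relation and of the bound on range projections, in a form that applies directly inside
  products. Working modulo \<open>R\<close> admits families made of polynomials.\<close>

locale ck_family =
  fixes R :: "'g star_poly set" and G :: "('v, 'e) pre_digraph"
    and P :: "'v \<Rightarrow> 'g star_poly" and S :: "'e \<Rightarrow> 'g star_poly"
  assumes P_mult: "\<lbrakk>v \<in> verts G; w \<in> verts G\<rbrakk> \<Longrightarrow> P v * P w \<approx>\<^bsub>R\<^esub> (if v = w then P v else 0)"
    and P_star: "v \<in> verts G \<Longrightarrow> poly_star (P v) \<approx>\<^bsub>R\<^esub> P v"
    and S_star_S: "\<lbrakk>e \<in> arcs G; f \<in> arcs G\<rbrakk>
      \<Longrightarrow> poly_star (S e) * S f \<approx>\<^bsub>R\<^esub> (if e = f then P (head G e) else 0)"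
    and P_S: "e \<in> arcs G \<Longrightarrow> P (tail G e) * S e \<approx>\<^bsub>R\<^esub> S e"
    and S_P: "e \<in> arcs G \<Longrightarrow> S e * P (head G e) \<approx>\<^bsub>R\<^esub> S e"
begin

lemma P_self: "v \<in> verts G \<Longrightarrow> P v * P v \<approx>\<^bsub>R\<^esub> P v"
  using P_mult[of v v] by simp

lemma P_orth: "\<lbrakk>v \<in> verts G; w \<in> verts G; v \<noteq> w\<rbrakk> \<Longrightarrow> P v * P w \<approx>\<^bsub>R\<^esub> 0"
  using P_mult[of v w] by simp

lemma S_star_S_self: "e \<in> arcs G \<Longrightarrow> poly_star (S e) * S e \<approx>\<^bsub>R\<^esub> P (head G e)"
  using S_star_S[of e e] by simp

lemma S_star_S_orth: "\<lbrakk>e \<in> arcs G; f \<in> arcs G; e \<noteq> f\<rbrakk> \<Longrightarrow> poly_star (S e) * S f \<approx>\<^bsub>R\<^esub> 0"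
  using S_star_S[of e f] by simp

end

lemma ck_family_gens:
  assumes "wf_digraph G"
  shows "ck_family (ck_relations G) G p_gen s_gen"
proof -
  note rel = ck_relations_def
  have PP: "p_gen v * p_gen v \<approx>\<^bsub>ck_relations G\<^esub> p_gen v" if "v \<in> verts G" for v
    using that by (intro star_cong_base) (auto simp: rel)
  have PQ: "p_gen v * p_gen w \<approx>\<^bsub>ck_relations G\<^esub> 0" if "v \<in> verts G" "w \<in> verts G" "v \<noteq> w" for v w
    unfolding star_cong_zero_iff using that by (intro star_ideal.base) (auto simp: rel)
  have PS: "poly_star (p_gen v) \<approx>\<^bsub>ck_relations G\<^esub> p_gen v" if "v \<in> verts G" for v
    using that by (intro star_cong_base) (auto simp: rel)
  have SSS: "s_gen e * poly_star (s_gen e) * s_gen e \<approx>\<^bsub>ck_relations G\<^esub> s_gen e" if "e \<in> arcs G" for e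
    using that by (intro star_cong_base) (auto simp: rel)
  have SS: "poly_star (s_gen e) * s_gen e \<approx>\<^bsub>ck_relations G\<^esub> p_gen (head G e)" if "e \<in> arcs G" for e
    using that by (intro star_cong_base) (auto simp: rel)
  have ST: "poly_star (s_gen e) * s_gen f \<approx>\<^bsub>ck_relations G\<^esub> 0" if "e \<in> arcs G" "f \<in> arcs G" "e \<noteq> f" for e f
    unfolding star_cong_zero_iff using that by (intro star_ideal.base) (auto simp: rel)
  have TS: "p_gen (tail G e) * (s_gen e * poly_star (s_gen e)) \<approx>\<^bsub>ck_relations G\<^esub> s_gen e * poly_star (s_gen e)"
    if "e \<in> arcs G" for e
    using that by (intro star_cong_base) (auto simp: rel)
  show ?thesis
  proof
    fix e assume e: "e \<in> arcs G"
    have "p_gen (tail G e) * s_gen e \<approx>\<^bsub>ck_relations G\<^esub>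
        p_gen (tail G e) * (s_gen e * poly_star (s_gen e) * s_gen e)"
      by (intro star_cong_left star_cong_sym[OF SSS] e)
    also have "\<dots> = p_gen (tail G e) * (s_gen e * poly_star (s_gen e)) * s_gen e"
      by (simp only: mult.assoc)
    also have "\<dots> \<approx>\<^bsub>ck_relations G\<^esub> s_gen e * poly_star (s_gen e) * s_gen e"
      by (intro star_cong_right TS e)
    also have "\<dots> \<approx>\<^bsub>ck_relations G\<^esub> s_gen e" by (rule SSS[OF e])
    finally show "p_gen (tail G e) * s_gen e \<approx>\<^bsub>ck_relations G\<^esub> s_gen e" .
    have "s_gen e * p_gen (head G e) \<approx>\<^bsub>ck_relations G\<^esub> s_gen e * (poly_star (s_gen e) * s_gen e)"
      by (intro star_cong_left star_cong_sym[OF SS] e)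
    also have "\<dots> \<approx>\<^bsub>ck_relations G\<^esub> s_gen e" using SSS[OF e] by (simp only: mult.assoc)
    finally show "s_gen e * p_gen (head G e) \<approx>\<^bsub>ck_relations G\<^esub> s_gen e" .
  qed (simp_all add: PP PQ PS SS ST)
qed

lemma ck_family_relations:
  assumes wf: "wf_digraph G" and sing: "singular_graph G"
    and fam: "ck_family R G (\<lambda>v. \<phi> (Proj v)) (\<lambda>e. \<phi> (PIso e))" and r: "r \<in> ck_relations G"
  shows "poly_subst \<phi> r \<in> star_ideal R"
proof -
  interpret ck_family R G "\<lambda>v. \<phi> (Proj v)" "\<lambda>e. \<phi> (PIso e)" by (rule fam)
  let ?P = "\<lambda>v. \<phi> (Proj v)" and ?S = "\<lambda>e. \<phi> (PIso e)"
  have 1: "?P v * ?P v - ?P v \<in> star_ideal R" if "v \<in> verts G" for v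
    using P_mult[OF that that] by (simp add: star_cong_def)
  have 2: "poly_star (?P v) - ?P v \<in> star_ideal R" if "v \<in> verts G" for v
    using P_star[OF that] by (simp add: star_cong_def)
  have 3: "?P v * ?P w \<in> star_ideal R" if "v \<in> verts G" "w \<in> verts G" "v \<noteq> w" for v w
    using P_mult[OF that(1,2)] that(3) by (simp add: star_cong_def)
  have 4: "?S e * poly_star (?S e) * ?S e - ?S e \<in> star_ideal R" if "e \<in> arcs G" for e
    using star_cong_trans[OF star_cong_left[OF S_star_S_self[OF that]] S_P[OF that]]
    by (simp add: star_cong_def mult.assoc)
  have 5: "poly_star (?S e) * ?S f \<in> star_ideal R" if "e \<in> arcs G" "f \<in> arcs G" "e \<noteq> f" for e f
    using S_star_S_orth[OF that] by (simp add: star_cong_def)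
  have 6: "poly_star (?S e) * ?S e - ?P (head G e) \<in> star_ideal R" if "e \<in> arcs G" for e
    using S_star_S_self[OF that] by (simp add: star_cong_def)
  have 7: "?P (tail G e) * (?S e * poly_star (?S e)) - ?S e * poly_star (?S e) \<in> star_ideal R"
    if "e \<in> arcs G" for e
    using star_cong_right[OF P_S[OF that], of "poly_star (?S e)"]
    by (simp add: star_cong_def mult.assoc)
  \<comment> \<open>By singularity the side condition of the summation relation never holds, so no
    sum has to be substituted.\<close>
  have 8: "out_arcs G v = {}" if "v \<in> verts G" "finite (out_arcs G v)" for v
    using sing that by (auto simp: singular_graph_def)
  from r show ?thesis
    unfolding ck_relations_def using 1 2 3 4 5 6 7 8
    by (elim UnE CollectE exE conjE) (simp_all add: poly_subst_simps)
qed

lemma graph_isomorphicI: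
  assumes G: "wf_digraph G" "singular_graph G" and H: "wf_digraph H" "singular_graph H"
    and \<phi>: "\<And>g. g \<in> ck_gens G \<Longrightarrow> \<phi> g \<in> free_carrier (ck_gens H)"
      "ck_family (ck_relations H) G (\<lambda>v. \<phi> (Proj v)) (\<lambda>e. \<phi> (PIso e))"
    and \<psi>: "\<And>g. g \<in> ck_gens H \<Longrightarrow> \<psi> g \<in> free_carrier (ck_gens G)"
      "ck_family (ck_relations G) H (\<lambda>v. \<psi> (Proj v)) (\<lambda>e. \<psi> (PIso e))"
    and cancel: "\<And>g. g \<in> ck_gens G \<Longrightarrow> poly_subst \<psi> (\<phi> g) \<approx>\<^bsub>ck_relations G\<^esub> gen g"
      "\<And>g. g \<in> ck_gens H \<Longrightarrow> poly_subst \<phi> (\<psi> g) \<approx>\<^bsub>ck_relations H\<^esub> gen g"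
  shows "graph_cstar_algebra G \<cong>\<^sub>\<star> graph_cstar_algebra H"
  unfolding graph_cstar_algebra_def
  by (rule universal_isomorphicI[OF ck_relations_bounded[OF G(1)] ck_relations_carrier[OF G(1)]
        ck_relations_bounded[OF H(1)] ck_relations_carrier[OF H(1)] \<phi>(1) _ \<psi>(1) _ cancel])
    (use assms in \<open>auto intro: ck_family_relations\<close>)

text \<open>Used at both ends of the argument: to turn the given edges into labelled triples, and to
  renumber infinite label sets by all natural numbers.\<close>

lemma graph_isomorphic_relabel:
  assumes G: "wf_digraph G" "singular_graph G" and H: "wf_digraph H" "singular_graph H"
    and V: "verts H = verts G" and b: "bij_betw b (arcs G) (arcs H)"
    and ends: "\<And>e. e \<in> arcs G \<Longrightarrow> tail H (b e) = tail G e \<and> head H (b e) = head G e"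
  shows "graph_cstar_algebra G \<cong>\<^sub>\<star> graph_cstar_algebra H"
proof -
  define b' where "b' = inv_into (arcs G) b"
  have b': "b' e \<in> arcs G" "b (b' e) = e" if "e \<in> arcs H" for e
    using b that by (auto simp: b'_def bij_betw_def inv_into_into f_inv_into_f)
  have bb: "b e \<in> arcs H" "b' (b e) = e" if "e \<in> arcs G" for e
    using b that by (auto simp: b'_def bij_betw_def)
  interpret GF: ck_family "ck_relations G" G p_gen s_gen by (rule ck_family_gens[OF G(1)])
  interpret HF: ck_family "ck_relations H" H p_gen s_gen by (rule ck_family_gens[OF H(1)])
  let ?\<phi> = "case_ck_gen p_gen (\<lambda>e. s_gen (b e))" and ?\<psi> = "case_ck_gen p_gen (\<lambda>e. s_gen (b' e))"
  show ?thesis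
  proof (rule graph_isomorphicI[OF G H, where \<phi> = ?\<phi> and \<psi> = ?\<psi>])
    show "ck_family (ck_relations H) G (\<lambda>v. ?\<phi> (Proj v)) (\<lambda>e. ?\<phi> (PIso e))"
    proof
      fix e f assume "e \<in> arcs G" "f \<in> arcs G"
      moreover from this have "b e = b f \<longleftrightarrow> e = f" using bb by metis
      ultimately show "poly_star (?\<phi> (PIso e)) * ?\<phi> (PIso f) \<approx>\<^bsub>ck_relations H\<^esub>
          (if e = f then ?\<phi> (Proj (head G e)) else 0)"
        using HF.S_star_S[of "b e" "b f"] bb ends[of e] by (cases "e = f") simp_all
    next
      fix e assume "e \<in> arcs G"
      then show "?\<phi> (Proj (tail G e)) * ?\<phi> (PIso e) \<approx>\<^bsub>ck_relations H\<^esub> ?\<phi> (PIso e)"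
        "?\<phi> (PIso e) * ?\<phi> (Proj (head G e)) \<approx>\<^bsub>ck_relations H\<^esub> ?\<phi> (PIso e)"
        using HF.P_S[of "b e"] HF.S_P[of "b e"] bb ends[of e] by simp_all
    qed (use HF.P_self HF.P_orth HF.P_star V in simp_all)
    show "ck_family (ck_relations G) H (\<lambda>v. ?\<psi> (Proj v)) (\<lambda>e. ?\<psi> (PIso e))"
    proof
      fix e f assume "e \<in> arcs H" "f \<in> arcs H"
      moreover from this have "b' e = b' f \<longleftrightarrow> e = f" using b' by metis
      ultimately show "poly_star (?\<psi> (PIso e)) * ?\<psi> (PIso f) \<approx>\<^bsub>ck_relations G\<^esub>
          (if e = f then ?\<psi> (Proj (head H e)) else 0)"
        using GF.S_star_S[of "b' e" "b' f"] b' ends[of "b' e"] by (cases "e = f") simp_all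
    next
      fix e assume "e \<in> arcs H"
      then show "?\<psi> (Proj (tail H e)) * ?\<psi> (PIso e) \<approx>\<^bsub>ck_relations G\<^esub> ?\<psi> (PIso e)"
        "?\<psi> (PIso e) * ?\<psi> (Proj (head H e)) \<approx>\<^bsub>ck_relations G\<^esub> ?\<psi> (PIso e)"
        using GF.P_S[of "b' e"] GF.S_P[of "b' e"] b' ends[of "b' e"] by simp_all
    qed (use GF.P_self GF.P_orth GF.P_star V in simp_all)
  qed (auto simp: ck_gens_def V bb b' intro!: gen_in_carrier)
qed


section \<open>Exchanging edges\<close>

text \<open>
  Fix an edge \<open>f\<close> from \<open>v\<close> to \<open>w\<close>, edges \<open>d\<^sub>i\<close> from \<open>u\<close> to \<open>v\<close> and edges \<open>g\<^sub>j\<close> from \<open>u\<close> to \<open>w\<close>. For an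
  injection \<open>\<sigma>\<close>, the graph \<open>xgraph \<sigma>\<close> contains all \<open>d\<^sub>i\<close> but only those \<open>g\<^sub>j\<close> with \<open>j \<notin> range \<sigma>\<close>. Its algebra
  is also generated by the pieces \<open>a\<^sub>i = d\<^sub>i (1 - f f\<^sup>*)\<close> together with partial isometries \<open>c\<^sub>j\<close> that are
  \<open>d\<^sub>i f\<close> for \<open>j = \<sigma> i\<close> and \<open>g\<^sub>j\<close> otherwise. The relations between these generators do not involve
  \<open>\<sigma>\<close>, and \<open>d\<^sub>i = a\<^sub>i + c\<^bsub>\<sigma> i\<^esub> f\<^sup>*\<close>.
\<close>

locale edge_exchange =
  fixes V :: "'v set" and B :: "'e set" and t h :: "'e \<Rightarrow> 'v" and f :: 'e and u :: 'v
    and d g :: "nat \<Rightarrow> 'e"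
  assumes base_ends: "e \<in> B \<Longrightarrow> t e \<in> V \<and> h e \<in> V" and f_B: "f \<in> B" and u_V: "u \<in> V"
    and d_ends: "t (d i) = u" "h (d i) = t f" and g_ends: "t (g i) = u" "h (g i) = h f"
    and inj_d: "inj d" and inj_g: "inj g"
    and d_B: "d i \<notin> B" and g_B: "g i \<notin> B" and d_g: "d i \<noteq> g j"
begin

definition xgraph :: "(nat \<Rightarrow> nat) \<Rightarrow> ('v, 'e) pre_digraph" where
  "xgraph \<sigma> = \<lparr>verts = V, arcs = B \<union> range d \<union> g ` (- range \<sigma>), tail = t, head = h\<rparr>"

abbreviation "F \<equiv> s_gen f :: ('v, 'e) ck_gen star_poly"
abbreviation "rel \<sigma> \<equiv> ck_relations (xgraph \<sigma>)"

text \<open>Replaces \<open>1 - f f*\<close>, which lies outside the non-unital algebra. Since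
  \<open>d_i\<close> ends at \<open>t f\<close>, multiplying \<open>d_i\<close> by either gives the
  same result modulo the relations.\<close>

definition Q :: "('v, 'e) ck_gen star_poly" where "Q = p_gen (t f) - F * poly_star F"

definition a :: "nat \<Rightarrow> ('v, 'e) ck_gen star_poly" where "a i = s_gen (d i) * Q"

definition c :: "(nat \<Rightarrow> nat) \<Rightarrow> nat \<Rightarrow> ('v, 'e) ck_gen star_poly" where
  "c \<sigma> j = (if j \<in> range \<sigma> then s_gen (d (inv \<sigma> j)) * F else s_gen (g j))"

text \<open>Writes each generator of \<open>xgraph \<sigma>\<close> through the pieces and realizes
  the pieces in \<open>xgraph \<tau>\<close>. As the pieces treat the two graphs alike, swapping the
  arguments gives the inverse.\<close>

definition exch :: "(nat \<Rightarrow> nat) \<Rightarrow> (nat \<Rightarrow> nat) \<Rightarrow> ('v, 'e) ck_gen \<Rightarrow> ('v, 'e) ck_gen star_poly" where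
  "exch \<sigma> \<tau> = case_ck_gen p_gen (\<lambda>e.
     if e \<in> range d then a (inv d e) + c \<tau> (\<sigma> (inv d e)) * poly_star F
     else if e \<in> range g then c \<tau> (inv g e) else s_gen e)"

lemma xgraph_simps [simp]:
  "verts (xgraph \<sigma>) = V" "tail (xgraph \<sigma>) = t" "head (xgraph \<sigma>) = h"
  "e \<in> arcs (xgraph \<sigma>) \<longleftrightarrow> e \<in> B \<or> e \<in> range d \<or> e \<in> g ` (- range \<sigma>)"
  by (auto simp: xgraph_def)

lemma wf_xgraph: "wf_digraph (xgraph \<sigma>)"
  using base_ends f_B u_V d_ends g_ends by unfold_locales auto

lemma exch_simps [simp]:
  "exch \<sigma> \<tau> (Proj x) = p_gen x"
  "exch \<sigma> \<tau> (PIso (d i)) = a i + c \<tau> (\<sigma> i) * poly_star F"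
  "exch \<sigma> \<tau> (PIso (g j)) = c \<tau> j"
  "e \<in> B \<Longrightarrow> exch \<sigma> \<tau> (PIso e) = s_gen e"
proof -
  have [simp]: "g j \<notin> range d" for j using d_g by (metis rangeE)
  show "exch \<sigma> \<tau> (Proj x) = p_gen x" "exch \<sigma> \<tau> (PIso (d i)) = a i + c \<tau> (\<sigma> i) * poly_star F"
    "exch \<sigma> \<tau> (PIso (g j)) = c \<tau> j"
    by (simp_all add: exch_def inj_d inj_g)
  show "exch \<sigma> \<tau> (PIso e) = s_gen e" if "e \<in> B"
    using that d_B g_B by (auto simp: exch_def)
qed

context
  fixes \<tau> :: "nat \<Rightarrow> nat" assumes inj: "inj \<tau>"
begin

interpretation T: ck_family "rel \<tau>" "xgraph \<tau>" p_gen s_gen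
  by (rule ck_family_gens[OF wf_xgraph])

section \<open>The projection complementary to the range of the fixed edge\<close>

lemma F_star_F: "poly_star F * F \<approx>\<^bsub>rel \<tau>\<^esub> p_gen (h f)"
  using T.S_star_S_self[of f] f_B by simp

lemma Q_F: "Q * F \<approx>\<^bsub>rel \<tau>\<^esub> 0"
proof -
  have "F * (poly_star F * F) \<approx>\<^bsub>rel \<tau>\<^esub> F"
    using star_cong_trans[OF star_cong_left[OF F_star_F]] T.S_P[of f] f_B by simp
  then have "p_gen (t f) * F - F * (poly_star F * F) \<approx>\<^bsub>rel \<tau>\<^esub> F - F"
    using T.P_S[of f] f_B by (intro star_cong_diff) simp_all
  then show ?thesis by (simp add: Q_def left_diff_distrib mult.assoc)
qed

lemma Q_star: "poly_star Q \<approx>\<^bsub>rel \<tau>\<^esub> Q"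
  unfolding Q_def poly_star_diff poly_star_mult poly_star_poly_star
  using T.P_star[of "t f"] base_ends[OF f_B] by (intro star_cong_diff star_cong_refl) simp

lemma F_star_P: "poly_star F * p_gen (t f) \<approx>\<^bsub>rel \<tau>\<^esub> poly_star F"
proof -
  have "poly_star F * p_gen (t f) \<approx>\<^bsub>rel \<tau>\<^esub> poly_star F * poly_star (p_gen (t f))"
    using base_ends[OF f_B] by (intro star_cong_left star_cong_sym[OF T.P_star]) simp
  also have "\<dots> \<approx>\<^bsub>rel \<tau>\<^esub> poly_star F"
    using star_cong_star[OF T.P_S[of f]] f_B by (simp add: poly_star_mult)
  finally show ?thesis .
qed

lemma F_star_Q: "poly_star F * Q \<approx>\<^bsub>rel \<tau>\<^esub> 0"
proof -
  have "poly_star F * Q \<approx>\<^bsub>rel \<tau>\<^esub> poly_star F * poly_star Q"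
    by (intro star_cong_left star_cong_sym[OF Q_star])
  also have "\<dots> \<approx>\<^bsub>rel \<tau>\<^esub> 0"
    using star_cong_star[OF Q_F] by (simp add: poly_star_mult)
  finally show ?thesis .
qed

lemma Q_P: "Q * p_gen (t f) \<approx>\<^bsub>rel \<tau>\<^esub> Q"
proof -
  have "p_gen (t f) * p_gen (t f) - F * (poly_star F * p_gen (t f)) \<approx>\<^bsub>rel \<tau>\<^esub> p_gen (t f) - F * poly_star F"
    using T.P_self[of "t f"] f_B base_ends[OF f_B]
    by (intro star_cong_diff star_cong_left F_star_P) simp_all
  then show ?thesis by (simp add: Q_def left_diff_distrib mult.assoc)
qed

lemma Q_Q: "Q * Q \<approx>\<^bsub>rel \<tau>\<^esub> Q"
proof -
  have "Q * p_gen (t f) - (Q * F) * poly_star F \<approx>\<^bsub>rel \<tau>\<^esub> Q - 0 * poly_star F"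
    by (intro star_cong_diff star_cong_right Q_P Q_F)
  moreover have "Q * Q = Q * p_gen (t f) - (Q * F) * poly_star F"
    by (simp add: Q_def algebra_simps)
  ultimately show ?thesis by simp
qed

section \<open>Orthogonality of the pieces\<close>

lemma D_star_D: "poly_star (s_gen (d i)) * s_gen (d j) \<approx>\<^bsub>rel \<tau>\<^esub> (if i = j then p_gen (t f) else 0)"
  using T.S_star_S[of "d i" "d j"] inj_d by (auto simp: inj_eq d_ends)

lemma a_star: "poly_star (a i) = poly_star Q * poly_star (s_gen (d i))"
  by (simp add: a_def poly_star_mult)

lemma a_star_D: "poly_star (a i) * s_gen (d j) \<approx>\<^bsub>rel \<tau>\<^esub> (if i = j then Q else 0)"
proof -
  have "poly_star (a i) * s_gen (d j) = poly_star Q * (poly_star (s_gen (d i)) * s_gen (d j))"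
    by (simp add: a_star mult.assoc)
  also have "\<dots> \<approx>\<^bsub>rel \<tau>\<^esub> Q * (if i = j then p_gen (t f) else 0)"
    by (intro star_cong_mult Q_star D_star_D)
  also have "\<dots> \<approx>\<^bsub>rel \<tau>\<^esub> (if i = j then Q else 0)" by (simp add: Q_P)
  finally show ?thesis .
qed

lemma a_star_a: "poly_star (a i) * a j \<approx>\<^bsub>rel \<tau>\<^esub> (if i = j then Q else 0)"
proof -
  have "poly_star (a i) * a j = poly_star (a i) * s_gen (d j) * Q"
    by (simp add: a_def mult.assoc)
  also have "\<dots> \<approx>\<^bsub>rel \<tau>\<^esub> (if i = j then Q else 0) * Q"
    by (intro star_cong_right a_star_D)
  also have "\<dots> \<approx>\<^bsub>rel \<tau>\<^esub> (if i = j then Q else 0)" by (simp add: Q_Q)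
  finally show ?thesis .
qed

lemma D_star_S:
  assumes "e \<in> arcs (xgraph \<tau>)" "e \<notin> range d"
  shows "poly_star (s_gen (d i)) * s_gen e \<approx>\<^bsub>rel \<tau>\<^esub> 0"
  using assms by (intro T.S_star_S_orth) auto

lemma a_star_S:
  assumes "e \<in> arcs (xgraph \<tau>)" "e \<notin> range d"
  shows "poly_star (a i) * s_gen e \<approx>\<^bsub>rel \<tau>\<^esub> 0"
  unfolding a_star mult.assoc by (intro star_cong_0_mult D_star_S assms)

lemma c_cases [case_names old new]:
  obtains i where "j = \<tau> i" "c \<tau> j = s_gen (d i) * F"
  | "j \<notin> range \<tau>" "c \<tau> j = s_gen (g j)" "g j \<in> arcs (xgraph \<tau>)" "g j \<notin> range d"
proof (cases "j \<in> range \<tau>")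
  case True
  then obtain i where "j = \<tau> i" by blast
  then show ?thesis using that(1) inj by (simp add: c_def)
next
  case False
  moreover have "g j \<notin> range d" using d_g by (metis rangeE)
  ultimately show ?thesis using that(2) by (simp add: c_def)
qed

lemma a_star_c: "poly_star (a i) * c \<tau> j \<approx>\<^bsub>rel \<tau>\<^esub> 0"
proof (cases j rule: c_cases)
  case (old k)
  have "poly_star (a i) * c \<tau> j = poly_star (a i) * s_gen (d k) * F"
    by (simp only: old(2) mult.assoc)
  also have "\<dots> \<approx>\<^bsub>rel \<tau>\<^esub> (if i = k then Q else 0) * F"
    by (intro star_cong_right a_star_D)
  also have "\<dots> \<approx>\<^bsub>rel \<tau>\<^esub> 0" by (simp add: Q_F)
  finally show ?thesis .
next
  case new
  then show ?thesis by (simp only: new(2)) (intro a_star_S new)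
qed

lemma c_star_a: "poly_star (c \<tau> j) * a i \<approx>\<^bsub>rel \<tau>\<^esub> 0"
  by (rule star_cong_adjoint_zero[OF a_star_c])

text \<open>A cut piece \<open>d_i f\<close> and a genuine edge \<open>g_j\<close> obey the same
  relations, which is what hides \<open>\<tau>\<close> from the pieces. Injectivity of
  \<open>\<tau>\<close> gives distinct cut pieces distinct indices.\<close>

lemma c_star_c: "poly_star (c \<tau> i) * c \<tau> j \<approx>\<^bsub>rel \<tau>\<^esub> (if i = j then p_gen (h f) else 0)"
proof (cases i rule: c_cases)
  case i: (old k)
  show ?thesis
  proof (cases j rule: c_cases)
    case j: (old l)
    have "poly_star (c \<tau> i) * c \<tau> j = poly_star F * (poly_star (s_gen (d k)) * s_gen (d l)) * F"
      by (simp only: i(2) j(2) poly_star_mult mult.assoc)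
    also have "\<dots> \<approx>\<^bsub>rel \<tau>\<^esub> poly_star F * (if k = l then p_gen (t f) else 0) * F"
      by (intro star_cong_mid D_star_D)
    also have "\<dots> \<approx>\<^bsub>rel \<tau>\<^esub> (if k = l then poly_star F * F else 0)"
      by (simp add: star_cong_right F_star_P)
    also have "\<dots> \<approx>\<^bsub>rel \<tau>\<^esub> (if i = j then p_gen (h f) else 0)"
      using inj by (simp add: i(1) j(1) inj_eq F_star_F)
    finally show ?thesis .
  next
    case j: new
    have "poly_star (c \<tau> i) * c \<tau> j = poly_star F * (poly_star (s_gen (d k)) * s_gen (g j))"
      by (simp only: i(2) j(2) poly_star_mult mult.assoc)
    also have "\<dots> \<approx>\<^bsub>rel \<tau>\<^esub> 0" by (intro star_cong_0_mult D_star_S j)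
    finally show ?thesis using i(1) j(1) by auto
  qed
next
  case i: new
  show ?thesis
  proof (cases j rule: c_cases)
    case j: (old l)
    have "poly_star (c \<tau> j) * c \<tau> i = poly_star F * (poly_star (s_gen (d l)) * s_gen (g i))"
      by (simp only: i(2) j(2) poly_star_mult mult.assoc)
    also have "\<dots> \<approx>\<^bsub>rel \<tau>\<^esub> 0" by (intro star_cong_0_mult D_star_S i)
    finally have "poly_star (c \<tau> i) * c \<tau> j \<approx>\<^bsub>rel \<tau>\<^esub> 0" by (rule star_cong_adjoint_zero)
    then show ?thesis using i(1) j(1) by auto
  next
    case j: new
    then show ?thesis
      using T.S_star_S[of "g i" "g j"] i inj_g by (auto simp: inj_eq g_ends)
  qed
qed

lemma base_star_a: "e \<in> B \<Longrightarrow> poly_star (s_gen e) * a i \<approx>\<^bsub>rel \<tau>\<^esub> 0"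
  using d_B by (intro star_cong_adjoint_zero[OF a_star_S]) auto

lemma base_star_c:
  assumes "e \<in> B" shows "poly_star (s_gen e) * c \<tau> j \<approx>\<^bsub>rel \<tau>\<^esub> 0"
proof (cases j rule: c_cases)
  case (old k)
  have "poly_star (s_gen e) * s_gen (d k) * F \<approx>\<^bsub>rel \<tau>\<^esub> 0"
    using assms d_B by (intro star_cong_0_mult T.S_star_S_orth) auto
  then show ?thesis by (simp only: old(2) mult.assoc)
next
  case new
  then show ?thesis using assms g_B by (simp only: new(2)) (intro T.S_star_S_orth, auto)
qed

section \<open>Sources and ranges of the pieces\<close>

lemma P_a: "p_gen u * a i \<approx>\<^bsub>rel \<tau>\<^esub> a i"
  using T.P_S[of "d i"] unfolding a_def mult.assoc[symmetric] by (intro star_cong_right) (simp add: d_ends)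

lemma a_Q: "a i * Q \<approx>\<^bsub>rel \<tau>\<^esub> a i"
  unfolding a_def mult.assoc by (intro star_cong_left Q_Q)

lemma a_P: "a i * p_gen (t f) \<approx>\<^bsub>rel \<tau>\<^esub> a i"
  unfolding a_def mult.assoc by (intro star_cong_left Q_P)

lemma a_F: "a i * F \<approx>\<^bsub>rel \<tau>\<^esub> 0"
  unfolding a_def mult.assoc by (intro star_cong_0_mult Q_F)

lemma P_c: "p_gen u * c \<tau> j \<approx>\<^bsub>rel \<tau>\<^esub> c \<tau> j"
proof (cases j rule: c_cases)
  case (old k)
  then show ?thesis
    using T.P_S[of "d k"] unfolding old(2) mult.assoc[symmetric] by (intro star_cong_right) (simp add: d_ends)
next
  case new
  then show ?thesis using T.P_S[of "g j"] by (simp add: g_ends)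
qed

lemma c_P: "c \<tau> j * p_gen (h f) \<approx>\<^bsub>rel \<tau>\<^esub> c \<tau> j"
proof (cases j rule: c_cases)
  case (old k)
  then show ?thesis
    using T.S_P[of f] f_B unfolding old(2) mult.assoc by (intro star_cong_left) simp
next
  case new
  then show ?thesis using T.S_P[of "g j"] by (simp add: g_ends)
qed

section \<open>Reassembling the pieces\<close>

text \<open>The two summands have orthogonal ranges, and their initial projections \<open>Q\<close>
  and \<open>F * poly_star F\<close> add up to \<open>p_gen (t f)\<close>. For
  \<open>i \<noteq> j\<close> injectivity of \<open>\<sigma>\<close> makes the product of the
  \<open>c\<close> pieces vanish.\<close>

lemma new_d_star_new_d:
  assumes "inj \<sigma>"
  shows "poly_star (a i + c \<tau> (\<sigma> i) * poly_star F) * (a j + c \<tau> (\<sigma> j) * poly_star F) \<approx>\<^bsub>rel \<tau>\<^esub>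
    (if i = j then p_gen (t f) else 0)"
proof -
  have "poly_star (a i + c \<tau> (\<sigma> i) * poly_star F) * (a j + c \<tau> (\<sigma> j) * poly_star F) =
      poly_star (a i) * a j + poly_star (a i) * c \<tau> (\<sigma> j) * poly_star F +
      (F * (poly_star (c \<tau> (\<sigma> i)) * a j) + F * (poly_star (c \<tau> (\<sigma> i)) * c \<tau> (\<sigma> j)) * poly_star F)"
    by (simp add: poly_star_add poly_star_mult algebra_simps)
  also have "\<dots> \<approx>\<^bsub>rel \<tau>\<^esub> (if i = j then Q else 0) + 0 * poly_star F +
      (F * 0 + F * (if \<sigma> i = \<sigma> j then p_gen (h f) else 0) * poly_star F)"
    by (intro star_cong_add star_cong_left star_cong_right a_star_a a_star_c c_star_a c_star_c)
  also have "\<dots> \<approx>\<^bsub>rel \<tau>\<^esub> (if i = j then Q + F * poly_star F else 0)"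
  proof (cases "i = j")
    case True
    have "Q + F * p_gen (h f) * poly_star F \<approx>\<^bsub>rel \<tau>\<^esub> Q + F * poly_star F"
      using T.S_P[of f] f_B by (intro star_cong_add star_cong_right star_cong_refl) simp
    then show ?thesis using True by (simp only: if_True refl mult_zero_left mult_zero_right add_0 add_0_right)
  next
    case False
    then show ?thesis using assms by (simp add: inj_eq)
  qed
  also have "Q + F * poly_star F = p_gen (t f)" by (simp add: Q_def)
  finally show ?thesis .
qed

lemma ck_family_exch:
  assumes "inj \<sigma>"
  shows "ck_family (rel \<tau>) (xgraph \<sigma>) (\<lambda>x. exch \<sigma> \<tau> (Proj x)) (\<lambda>e. exch \<sigma> \<tau> (PIso e))"
proof
  let ?S = "\<lambda>e. exch \<sigma> \<tau> (PIso e)"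
  \<comment> \<open>The index condition selects the edges \<open>g_j\<close> of
    \<open>xgraph \<sigma>\<close>. Their pieces are never glued into a rebuilt \<open>d_i\<close>,
    which uses only indices in the range of \<open>\<sigma>\<close>.\<close>
  have d_g_orth: "poly_star (a i + c \<tau> (\<sigma> i) * poly_star F) * c \<tau> j \<approx>\<^bsub>rel \<tau>\<^esub> 0" if "j \<notin> range \<sigma>" for i j
  proof -
    have "poly_star (a i + c \<tau> (\<sigma> i) * poly_star F) * c \<tau> j =
        poly_star (a i) * c \<tau> j + F * (poly_star (c \<tau> (\<sigma> i)) * c \<tau> j)"
      by (simp add: poly_star_add poly_star_mult algebra_simps)
    also have "\<dots> \<approx>\<^bsub>rel \<tau>\<^esub> 0 + F * (if \<sigma> i = j then p_gen (h f) else 0)"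
      by (intro star_cong_add star_cong_left a_star_c c_star_c)
    also have "\<dots> = 0" using that by auto
    finally show ?thesis .
  qed
  have base_d: "poly_star (s_gen e) * (a i + c \<tau> (\<sigma> i) * poly_star F) \<approx>\<^bsub>rel \<tau>\<^esub> 0" if "e \<in> B" for e i
  proof -
    have "poly_star (s_gen e) * a i + poly_star (s_gen e) * c \<tau> (\<sigma> i) * poly_star F \<approx>\<^bsub>rel \<tau>\<^esub> 0 + 0 * poly_star F"
      by (intro star_cong_add star_cong_right base_star_a base_star_c that)
    then show ?thesis by (simp add: distrib_left mult.assoc)
  qed
  have kinds: "e \<in> B \<or> (\<exists>i. e = d i) \<or> (\<exists>j. j \<notin> range \<sigma> \<and> e = g j)" if "e \<in> arcs (xgraph \<sigma>)" for e
    using that by auto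
  fix e e' assume "e \<in> arcs (xgraph \<sigma>)" "e' \<in> arcs (xgraph \<sigma>)"
  from kinds[OF this(1)] kinds[OF this(2)]
  show "poly_star (?S e) * ?S e' \<approx>\<^bsub>rel \<tau>\<^esub> (if e = e' then exch \<sigma> \<tau> (Proj (head (xgraph \<sigma>) e)) else 0)"
  proof (elim disjE exE conjE)
    assume "e \<in> B" "e' \<in> B"
    then show ?thesis using T.S_star_S[of e e'] by (cases "e = e'") simp_all
  next
    fix i assume "e \<in> B" "e' = d i"
    then show ?thesis using base_d[of e i] d_B by auto
  next
    fix j assume "e \<in> B" "e' = g j"
    then show ?thesis using base_star_c[of e j] g_B by auto
  next
    fix i assume "e = d i" "e' \<in> B"
    then show ?thesis using star_cong_adjoint_zero[OF base_d[of e' i]] d_B by auto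
  next
    fix i j assume "e = d i" "e' = d j"
    then show ?thesis using new_d_star_new_d[OF assms, of i j] inj_d
      by (cases "i = j") (simp_all add: inj_eq d_ends)
  next
    fix i j assume "e = d i" "j \<notin> range \<sigma>" "e' = g j"
    then show ?thesis using d_g_orth[of j i] d_g by simp
  next
    fix j assume "e = g j" "e' \<in> B"
    then show ?thesis using star_cong_adjoint_zero[OF base_star_c[of e' j]] g_B by auto
  next
    fix i j assume "j \<notin> range \<sigma>" "e = g j" "e' = d i"
    then show ?thesis using star_cong_adjoint_zero[OF d_g_orth[of j i]] d_g[of i j] by auto
  next
    fix i j assume "e = g i" "e' = g j"
    then show ?thesis using c_star_c[of i j] inj_g by (cases "i = j") (simp_all add: inj_eq g_ends)
  qed
next
  fix e assume "e \<in> arcs (xgraph \<sigma>)"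
  then consider "e \<in> B" | i where "e = d i" | j where "e = g j" by auto
  then show "exch \<sigma> \<tau> (Proj (tail (xgraph \<sigma>) e)) * exch \<sigma> \<tau> (PIso e) \<approx>\<^bsub>rel \<tau>\<^esub> exch \<sigma> \<tau> (PIso e)"
  proof cases
    case 1
    then show ?thesis using T.P_S[of e] by simp
  next
    case (2 i)
    have "p_gen u * a i + p_gen u * c \<tau> (\<sigma> i) * poly_star F \<approx>\<^bsub>rel \<tau>\<^esub> a i + c \<tau> (\<sigma> i) * poly_star F"
      by (intro star_cong_add star_cong_right P_a P_c)
    then show ?thesis by (simp add: 2 d_ends distrib_left mult.assoc)
  next
    case (3 j)
    then show ?thesis using P_c[of j] by (simp add: g_ends)
  qed
next
  fix e assume "e \<in> arcs (xgraph \<sigma>)"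
  then consider "e \<in> B" | i where "e = d i" | j where "e = g j" by auto
  then show "exch \<sigma> \<tau> (PIso e) * exch \<sigma> \<tau> (Proj (head (xgraph \<sigma>) e)) \<approx>\<^bsub>rel \<tau>\<^esub> exch \<sigma> \<tau> (PIso e)"
  proof cases
    case 1
    then show ?thesis using T.S_P[of e] by simp
  next
    case (2 i)
    have "a i * p_gen (t f) + c \<tau> (\<sigma> i) * (poly_star F * p_gen (t f)) \<approx>\<^bsub>rel \<tau>\<^esub> a i + c \<tau> (\<sigma> i) * poly_star F"
      by (intro star_cong_add star_cong_left a_P F_star_P)
    then show ?thesis by (simp add: 2 d_ends distrib_right mult.assoc)
  next
    case (3 j)
    then show ?thesis using c_P[of j] by (simp add: g_ends)
  qed
qed (use T.P_self T.P_orth T.P_star in simp_all)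

section \<open>Mutually inverse substitutions\<close>

text \<open>\<open>F\<close> and \<open>Q\<close> are fixed by the substitution, and right
  multiplication separates the two summands of the rebuilt edge: \<open>Q\<close> keeps the first
  and annihilates the second, while in \<open>subst_c\<close> the factor \<open>F\<close>
  annihilates the first and recovers the \<open>c\<close> piece from the second.\<close>

lemma subst_a: "poly_subst (exch \<sigma> \<tau>) (a i) \<approx>\<^bsub>rel \<tau>\<^esub> a i"
proof -
  have "poly_subst (exch \<sigma> \<tau>) (a i) = (a i + c \<tau> (\<sigma> i) * poly_star F) * Q"
    using f_B by (simp add: a_def[of i] Q_def poly_subst_simps)
  also have "\<dots> = a i * Q + c \<tau> (\<sigma> i) * (poly_star F * Q)"
    by (simp add: distrib_right mult.assoc)
  also have "\<dots> \<approx>\<^bsub>rel \<tau>\<^esub> a i + c \<tau> (\<sigma> i) * 0"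
    by (intro star_cong_add star_cong_left a_Q F_star_Q)
  finally show ?thesis by simp
qed

lemma subst_c:
  assumes "inj \<sigma>"
  shows "poly_subst (exch \<sigma> \<tau>) (c \<sigma> j) \<approx>\<^bsub>rel \<tau>\<^esub> c \<tau> j"
proof (cases "j \<in> range \<sigma>")
  case True
  then obtain i where i: "j = \<sigma> i" by blast
  have "poly_subst (exch \<sigma> \<tau>) (c \<sigma> j) = (a i + c \<tau> (\<sigma> i) * poly_star F) * F"
    using f_B assms by (simp add: i c_def[of \<sigma>] poly_subst_simps)
  also have "\<dots> = a i * F + c \<tau> (\<sigma> i) * (poly_star F * F)"
    by (simp add: distrib_right mult.assoc)
  also have "\<dots> \<approx>\<^bsub>rel \<tau>\<^esub> 0 + c \<tau> (\<sigma> i) * p_gen (h f)"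
    by (intro star_cong_add star_cong_left a_F F_star_F)
  also have "\<dots> \<approx>\<^bsub>rel \<tau>\<^esub> c \<tau> j" using c_P by (simp add: i)
  finally show ?thesis .
next
  case False
  then show ?thesis by (simp add: c_def[of \<sigma>])
qed

lemma subst_exch:
  assumes "inj \<sigma>" "x \<in> ck_gens (xgraph \<tau>)"
  shows "poly_subst (exch \<sigma> \<tau>) (exch \<tau> \<sigma> x) \<approx>\<^bsub>rel \<tau>\<^esub> gen x"
proof -
  from assms(2) consider y where "x = Proj y" | e where "x = PIso e" "e \<in> B"
    | i where "x = PIso (d i)" | j where "x = PIso (g j)" "j \<notin> range \<tau>"
    by (auto simp: ck_gens_def)
  then show ?thesis
  proof cases
    case (3 i)
    have "poly_subst (exch \<sigma> \<tau>) (exch \<tau> \<sigma> x) =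
        poly_subst (exch \<sigma> \<tau>) (a i) + poly_subst (exch \<sigma> \<tau>) (c \<sigma> (\<tau> i)) * poly_star F"
      using f_B by (simp add: 3 poly_subst_simps)
    also have "\<dots> \<approx>\<^bsub>rel \<tau>\<^esub> a i + c \<tau> (\<tau> i) * poly_star F"
      by (intro star_cong_add star_cong_right subst_a subst_c assms)
    \<comment> \<open>In \<open>xgraph \<tau>\<close> itself the two pieces of \<open>d i\<close>
      recombine, because \<open>Q + F * poly_star F\<close> is \<open>p_gen (t f)\<close>.\<close>
    also have "\<dots> = s_gen (d i) * p_gen (t f)"
      using inj by (simp add: a_def c_def Q_def right_diff_distrib mult.assoc)
    also have "\<dots> \<approx>\<^bsub>rel \<tau>\<^esub> gen x" using T.S_P[of "d i"] by (simp add: 3 d_ends)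
    finally show ?thesis .
  next
    case (4 j)
    then show ?thesis using subst_c[OF assms(1), of j] by (simp add: c_def[of \<tau>])
  qed simp_all
qed

lemma exch_carrier:
  assumes "x \<in> ck_gens (xgraph \<sigma>)"
  shows "exch \<sigma> \<tau> x \<in> free_carrier (ck_gens (xgraph \<tau>))"
proof -
  have p: "p_gen y \<in> free_carrier (ck_gens (xgraph \<tau>))" if "y \<in> V" for y
    using that by (intro gen_in_carrier) (simp add: ck_gens_def)
  have s: "s_gen e \<in> free_carrier (ck_gens (xgraph \<tau>))" if "e \<in> arcs (xgraph \<tau>)" for e
    using that by (intro gen_in_carrier) (auto simp: ck_gens_def)
  have F: "F \<in> free_carrier (ck_gens (xgraph \<tau>))" using f_B by (intro s) simp
  have a: "a i \<in> free_carrier (ck_gens (xgraph \<tau>))" for i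
    unfolding a_def Q_def using base_ends[OF f_B]
    by (intro free_carrier_mult free_carrier_diff free_carrier_star p s F) auto
  have c: "c \<tau> j \<in> free_carrier (ck_gens (xgraph \<tau>))" for j
  proof (cases j rule: c_cases)
    case (old i)
    then show ?thesis by (simp only: old(2)) (intro free_carrier_mult s F, simp)
  next
    case new
    then show ?thesis by (simp only: new(2)) (intro s new)
  qed
  from assms consider y where "x = Proj y" "y \<in> V" | e where "x = PIso e" "e \<in> B"
    | i where "x = PIso (d i)" | j where "x = PIso (g j)"
    by (auto simp: ck_gens_def)
  then show ?thesis
  proof cases
    case (3 i)
    then show ?thesis
      by (simp only: exch_simps) (intro free_carrier_add free_carrier_mult free_carrier_star a c F)
  qed (auto simp: p c intro: s)
qed

end

theorem xgraph_isomorphic: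
  assumes "inj \<sigma>" "inj \<tau>" "singular_graph (xgraph \<sigma>)" "singular_graph (xgraph \<tau>)"
  shows "graph_cstar_algebra (xgraph \<sigma>) \<cong>\<^sub>\<star> graph_cstar_algebra (xgraph \<tau>)"
proof (rule graph_isomorphicI[OF wf_xgraph assms(3) wf_xgraph assms(4),
      where \<phi> = "exch \<sigma> \<tau>" and \<psi> = "exch \<tau> \<sigma>"])
qed (rule exch_carrier ck_family_exch subst_exch assms | assumption)+

end


section \<open>Saturating the multiplicities\<close>

lemma star_isomorphic_trans:
  assumes "A \<cong>\<^sub>\<star> B" "B \<cong>\<^sub>\<star> C" shows "A \<cong>\<^sub>\<star> C"
proof -
  obtain \<phi> \<psi> where "star_hom A B \<phi>" "bij_betw \<phi> (sa_carrier A) (sa_carrier B)"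
    "star_hom B C \<psi>" "bij_betw \<psi> (sa_carrier B) (sa_carrier C)"
    using assms unfolding star_isomorphic_def by blast
  then have "star_hom A C (\<psi> \<circ> \<phi>) \<and> bij_betw (\<psi> \<circ> \<phi>) (sa_carrier A) (sa_carrier C)"
    by (auto simp: star_hom_def intro: bij_betw_trans)
  then show ?thesis unfolding star_isomorphic_def by blast
qed

lemma star_isomorphic_sym:
  assumes "star_algebra A" "A \<cong>\<^sub>\<star> B" shows "B \<cong>\<^sub>\<star> A"
proof -
  interpret star_algebra A by (rule assms(1))
  obtain \<phi> where \<phi>: "star_hom A B \<phi>" "bij_betw \<phi> (sa_carrier A) (sa_carrier B)"
    using assms(2) unfolding star_isomorphic_def by blast
  define \<psi> where "\<psi> = inv_into (sa_carrier A) \<phi>"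
  have \<psi>: "bij_betw \<psi> (sa_carrier B) (sa_carrier A)"
    unfolding \<psi>_def by (rule bij_betw_inv_into[OF \<phi>(2)])
  have cl: "\<psi> y \<in> sa_carrier A" and \<phi>\<psi>: "\<phi> (\<psi> y) = y" if "y \<in> sa_carrier B" for y
    using \<psi> \<phi>(2) that by (auto simp: bij_betw_def \<psi>_def f_inv_into_f)
  have eq: "\<psi> y = x" if "x \<in> sa_carrier A" "\<phi> x = y" for x y
    using \<phi>(2) that by (auto simp: \<psi>_def bij_betw_def)
  have "star_hom B A \<psi>"
    using \<phi>(1) unfolding star_hom_def by (auto simp: cl \<phi>\<psi> intro!: eq)
  then show ?thesis using \<psi> unfolding star_isomorphic_def by blast
qed

section \<open>Graphs as sets of labelled edges\<close>

definition mgraph :: "'v set \<Rightarrow> ('v \<times> 'v \<times> nat) set \<Rightarrow> ('v, 'v \<times> 'v \<times> nat) pre_digraph" where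
  "mgraph V A = \<lparr>verts = V, arcs = A, tail = (\<lambda>(u, w, n). u), head = (\<lambda>(u, w, n). w)\<rparr>"

definition links :: "('v \<times> 'v \<times> nat) set \<Rightarrow> ('v \<times> 'v) set" where
  "links A = {(u, w). \<exists>n. (u, w, n) \<in> A}"

definition labels :: "('v \<times> 'v \<times> nat) set \<Rightarrow> 'v \<Rightarrow> 'v \<Rightarrow> nat set" where
  "labels A u w = {n. (u, w, n) \<in> A}"

text \<open>The invariant of the saturation. It follows from singularity and absence of breaking
  vertices over finitely many vertices, holds for amplifications, implies singularity, and survives
  the addition of edges that leaves the path relation unchanged.\<close>

definition covered :: "('v \<times> 'v \<times> nat) set \<Rightarrow> bool" where
  "covered A \<longleftrightarrow> (\<forall>(u, w)\<in>(links A)\<^sup>+. \<exists>v. infinite (labels A u v) \<and> (v, w) \<in> (links A)\<^sup>*)"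

abbreviation saturation :: "('v \<times> 'v \<times> nat) set \<Rightarrow> ('v \<times> 'v \<times> nat) set" where
  "saturation A \<equiv> {(u, w, n). (u, w) \<in> (links A)\<^sup>+}"

lemma mgraph_simps [simp]:
  "verts (mgraph V A) = V" "arcs (mgraph V A) = A"
  "tail (mgraph V A) (u, w, n) = u" "head (mgraph V A) (u, w, n) = w"
  by (simp_all add: mgraph_def)

lemma wf_mgraph: "A \<subseteq> V \<times> V \<times> UNIV \<Longrightarrow> wf_digraph (mgraph V A)"
  by unfold_locales auto

lemma covered_linkD:
  assumes "covered A" "(u, w, n) \<in> A" shows "\<exists>v. infinite (labels A u v)"
  using assms unfolding covered_def links_def by (blast intro: r_into_trancl)

lemma singular_mgraph:
  assumes "covered A" shows "singular_graph (mgraph V A)"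
  unfolding singular_graph_def
proof (intro ballI disjCI)
  fix u assume "out_arcs (mgraph V A) u \<noteq> {}"
  then obtain w n where "(u, w, n) \<in> A" by auto
  with assms obtain v where v: "infinite (labels A u v)" using covered_linkD by metis
  have "(\<lambda>n. (u, v, n)) ` labels A u v \<subseteq> out_arcs (mgraph V A) u" by (auto simp: labels_def)
  then show "infinite (out_arcs (mgraph V A) u)"
    using v by (meson finite_subset finite_imageD inj_onI prod.inject)
qed

lemma links_mono: "A \<subseteq> A' \<Longrightarrow> links A \<subseteq> links A'"
  by (auto simp: links_def)

lemma labels_mono: "A \<subseteq> A' \<Longrightarrow> labels A u w \<subseteq> labels A' u w"
  by (auto simp: labels_def)

lemma covered_mono:
  assumes "covered A" "A \<subseteq> A'" "(links A')\<^sup>+ = (links A)\<^sup>+" shows "covered A'"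
proof -
  have "infinite (labels A' u v)" if "infinite (labels A u v)" for u v
    using that labels_mono[OF assms(2)] infinite_super by blast
  moreover have "(links A)\<^sup>* \<subseteq> (links A')\<^sup>*" by (rule rtrancl_mono[OF links_mono[OF assms(2)]])
  ultimately show ?thesis using assms(1) unfolding covered_def assms(3) by blast
qed

lemma saturated_isomorphic:
  assumes A: "A \<subseteq> V \<times> V \<times> UNIV" and cov: "covered A"
    and inf: "\<And>u w. (u, w) \<in> (links A)\<^sup>+ \<Longrightarrow> infinite (labels A u w)"
  shows "graph_cstar_algebra (mgraph V (saturation A)) \<cong>\<^sub>\<star> graph_cstar_algebra (mgraph V A)"
proof -
  have tr: "links (saturation A) = (links A)\<^sup>+" by (auto simp: links_def)
  have "links A \<subseteq> V \<times> V" using A by (auto simp: links_def)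
  then have "(links A)\<^sup>+ \<subseteq> V \<times> V" by (rule trancl_subset_Sigma)
  then have V: "saturation A \<subseteq> V \<times> V \<times> UNIV" by auto
  have "A \<subseteq> saturation A" by (auto simp: links_def)
  then have cov': "covered (saturation A)"
    by (rule covered_mono[OF cov]) (unfold tr, rule trancl_id[OF trans_trancl])
  define b where "b = (\<lambda>(u, w, n). (u, w, enumerate (labels A u w) n))"
  have bij: "bij_betw (enumerate (labels A u w)) UNIV (labels A u w)" if "(u, w) \<in> (links A)\<^sup>+" for u w
    by (rule bij_enumerate[OF inf[OF that]])
  have "bij_betw b (saturation A) A"
    unfolding bij_betw_def
  proof
    show "inj_on b (saturation A)"
    proof (rule inj_onI)
      fix p p' assume p: "p \<in> saturation A" "b p = b p'"
      obtain u w n u' w' n' where "p = (u, w, n)" "p' = (u', w', n')" by (metis prod_cases3)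
      then show "p = p'"
        using p bij[of u w] by (auto simp: b_def bij_betw_def inj_eq)
    qed
    show "b ` saturation A = A"
    proof
      show "b ` saturation A \<subseteq> A"
      proof clarify
        fix u w u' w' n n' assume "(u, w, n) = b (u', w', n')" "(u', w') \<in> (links A)\<^sup>+"
        then show "(u, w, n) \<in> A"
          using bij[of u' w'] by (auto simp: b_def bij_betw_def labels_def)
      qed
      show "A \<subseteq> b ` saturation A"
      proof clarify
        fix u w n assume a: "(u, w, n) \<in> A"
        then have l: "(u, w) \<in> (links A)\<^sup>+" by (auto simp: links_def)
        have "n \<in> labels A u w" using a by (simp add: labels_def)
        then have "n \<in> range (enumerate (labels A u w))" using bij[OF l] by (simp add: bij_betw_def)
        then obtain m where "n = enumerate (labels A u w) m" by blast
        then have "(u, w, n) = b (u, w, m)" by (simp add: b_def)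
        then show "(u, w, n) \<in> b ` saturation A" using l by blast
      qed
    qed
  qed
  then show ?thesis
    by (intro graph_isomorphic_relabel[where b = b] wf_mgraph singular_mgraph A V cov cov')
      (auto simp: b_def)
qed

section \<open>Enlarging multiplicities\<close>

text \<open>Edge exchange with the edges from \<open>u\<close> to \<open>v\<close> as
  \<open>d\<close> and one edge from \<open>v\<close> to \<open>x\<close> as \<open>f\<close>. The
  given graph is the case \<open>id\<close>, where no \<open>g_j\<close> is present; the enlarged
  one comes from an injection that omits infinitely many indices.\<close>

lemma add_arcs_isomorphic:
  assumes A: "A \<subseteq> V \<times> V \<times> UNIV" and cov: "covered A"
    and v: "infinite (labels A u v)" and x: "(v, x) \<in> links A" "finite (labels A u x)"
  obtains A' where "A \<subseteq> A'" "A' \<subseteq> V \<times> V \<times> UNIV" "(links A')\<^sup>+ = (links A)\<^sup>+" "infinite (labels A' u x)"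
    "graph_cstar_algebra (mgraph V A) \<cong>\<^sub>\<star> graph_cstar_algebra (mgraph V A')"
proof -
  obtain k where k: "(v, x, k) \<in> A" using x by (auto simp: links_def)
  \<comment> \<open>One multiplicity from \<open>u\<close> is infinite, the other finite. Hence
    \<open>f\<close> is not among the \<open>d_i\<close> and stays in the base set, even if
    \<open>u = v\<close>.\<close>
  have vx: "v \<noteq> x" using v x(2) by auto
  have "labels A u v \<noteq> {}" using v by auto
  then obtain l where l: "(u, v, l) \<in> A" by (auto simp: labels_def)
  then have V: "u \<in> V" "x \<in> V" using A k by auto
  have comp: "infinite (- labels A u x)" using x(2) by simp
  define d where "d i = (u, v, enumerate (labels A u v) i)" for i
  \<comment> \<open>These carry the labels not yet in use from \<open>u\<close> to \<open>x\<close>;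
    only finitely many are taken.\<close>
  define g where "g j = (u, x, enumerate (- labels A u x) j)" for j
  have d: "inj (enumerate (labels A u v))" "range (enumerate (labels A u v)) = labels A u v"
    using bij_enumerate[OF v] by (auto simp: bij_betw_def)
  have g: "inj (enumerate (- labels A u x))" "range (enumerate (- labels A u x)) = - labels A u x"
    using bij_enumerate[OF comp] by (auto simp: bij_betw_def)
  have d_A: "range d \<subseteq> A" using d(2) by (auto simp: d_def labels_def)
  have g_A: "g j \<notin> A" for j
  proof -
    have "enumerate (- labels A u x) j \<in> - labels A u x" using g(2) by blast
    then show ?thesis by (simp add: g_def labels_def)
  qed
  interpret edge_exchange V "A - range d" "\<lambda>(u, w, n). u" "\<lambda>(u, w, n). w" "(v, x, k)" u d g
  proof
    show "(case e of (u, w, n) \<Rightarrow> u) \<in> V \<and> (case e of (u, w, n) \<Rightarrow> w) \<in> V" if "e \<in> A - range d" for e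
      using A that by auto
    show "(v, x, k) \<in> A - range d" using k vx by (auto simp: d_def)
    show "inj d" using d(1) by (auto simp: inj_def d_def)
    show "inj g" using g(1) by (auto simp: inj_def g_def)
    show "d i \<noteq> g j" for i j using vx by (simp add: d_def g_def)
  qed (auto simp: V d_def g_def g_A[unfolded g_def])
  \<comment> \<open>Odd values leave all even indices free, so the edges \<open>g_j\<close> with
    \<open>j\<close> even are the new ones.\<close>
  define \<tau> :: "nat \<Rightarrow> nat" where "\<tau> i = 2 * i + 1" for i
  have \<tau>: "inj \<tau>" by (auto simp: inj_def \<tau>_def)
  define A' where "A' = A \<union> g ` (- range \<tau>)"
  have x0: "xgraph id = mgraph V A"
    using d_A by (auto simp: xgraph_def mgraph_def)
  have x1: "xgraph \<tau> = mgraph V A'"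
    using d_A by (auto simp: xgraph_def mgraph_def A'_def)
  \<comment> \<open>The only link that can be new joins a pair already joined through
    \<open>v\<close>, so the path relation does not change.\<close>
  have ux: "(u, x) \<in> (links A)\<^sup>+"
    using l x(1) by (intro trancl_into_trancl[OF r_into_trancl]) (auto simp: links_def)
  have "links A \<subseteq> links A'" by (rule links_mono) (simp add: A'_def)
  moreover have "links A' \<subseteq> insert (u, x) (links A)" by (auto simp: links_def A'_def g_def)
  moreover have "links A \<subseteq> (links A)\<^sup>+" by auto
  ultimately have "links A' \<subseteq> (links A)\<^sup>+" and sub_links: "links A \<subseteq> links A'" using ux by blast+
  then have "(links A')\<^sup>+ \<subseteq> ((links A)\<^sup>+)\<^sup>+" by (meson subsetI trancl_mono)
  moreover have "((links A)\<^sup>+)\<^sup>+ = (links A)\<^sup>+" by (rule trancl_id[OF trans_trancl])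
  moreover have "(links A)\<^sup>+ \<subseteq> (links A')\<^sup>+" using sub_links by (meson subsetI trancl_mono)
  ultimately have tr: "(links A')\<^sup>+ = (links A)\<^sup>+" by simp
  have "(\<lambda>i. enumerate (- labels A u x) (2 * i)) ` UNIV \<subseteq> labels A' u x"
  proof clarify
    fix i
    have "2 * i \<notin> range \<tau>" by (auto simp: \<tau>_def) presburger
    then show "enumerate (- labels A u x) (2 * i) \<in> labels A' u x"
      by (auto simp: A'_def labels_def g_def)
  qed
  moreover have "inj (\<lambda>i. enumerate (- labels A u x) (2 * i))"
    by (rule injI) (use g(1) in \<open>simp add: inj_eq\<close>)
  ultimately have inf: "infinite (labels A' u x)"
    by (meson finite_subset finite_imageD infinite_UNIV_nat)
  have sub: "A \<subseteq> A'" by (simp add: A'_def)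
  have "graph_cstar_algebra (mgraph V A) \<cong>\<^sub>\<star> graph_cstar_algebra (mgraph V A')"
    using xgraph_isomorphic[OF inj_on_id \<tau>] singular_mgraph[OF cov, of V]
      singular_mgraph[OF covered_mono[OF cov sub tr], of V]
    by (simp add: x0 x1)
  moreover have "A' \<subseteq> V \<times> V \<times> UNIV" using A V by (auto simp: A'_def g_def)
  ultimately show ?thesis using that sub tr inf by blast
qed

text \<open>The multiplicity from \<open>u\<close> is infinite at the start of the path and finite
  at its end, so it drops across some link.\<close>

lemma first_finite_link:
  assumes "infinite (labels A u v)" "(v, w) \<in> (links A)\<^sup>*" "finite (labels A u w)"
  obtains y x where "infinite (labels A u y)" "(y, x) \<in> links A" "finite (labels A u x)"
proof -
  from assms(2) have "infinite (labels A u w) \<or>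
      (\<exists>y x. infinite (labels A u y) \<and> (y, x) \<in> links A \<and> finite (labels A u x))"
    by (induction rule: rtrancl_induct) (use assms(1) in blast)+
  then show ?thesis using assms(3) that by blast
qed

theorem covered_isomorphic_saturation:
  assumes "finite V" "A \<subseteq> V \<times> V \<times> UNIV" "covered A"
  shows "graph_cstar_algebra (mgraph V A) \<cong>\<^sub>\<star> graph_cstar_algebra (mgraph V (saturation A))"
  using assms(2,3)
\<comment> \<open>The measure counts the joined pairs of finite multiplicity. An exchange removes
  \<open>(u, x)\<close> and adds none, since the path relation is fixed and label sets only grow;
  the fixed path relation also keeps the target \<open>saturation A\<close> the same.\<close>
proof (induction "card {(u, w) \<in> (links A)\<^sup>+. finite (labels A u w)}" arbitrary: A rule: less_induct)
  case less
  let ?D = "\<lambda>A. {(u, w) \<in> (links A)\<^sup>+. finite (labels A u w)}"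
  show ?case
  proof (cases "?D A = {}")
    case True
    have "links A \<subseteq> V \<times> V" using less.prems by (auto simp: links_def)
    then have "(links A)\<^sup>+ \<subseteq> V \<times> V" by (rule trancl_subset_Sigma)
    then have "wf_digraph (mgraph V (saturation A))" by (intro wf_mgraph) auto
    then have "star_algebra (graph_cstar_algebra (mgraph V (saturation A)))"
      using cstar_algebra_graph cstar_algebra_def by blast
    moreover have "graph_cstar_algebra (mgraph V (saturation A)) \<cong>\<^sub>\<star> graph_cstar_algebra (mgraph V A)"
      using True by (intro saturated_isomorphic less.prems) blast
    ultimately show ?thesis by (rule star_isomorphic_sym)
  next
    case False
    then obtain u w where uw: "(u, w) \<in> (links A)\<^sup>+" "finite (labels A u w)" by auto
    then obtain v where v: "infinite (labels A u v)" "(v, w) \<in> (links A)\<^sup>*"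
      using less.prems(2) unfolding covered_def by blast
    obtain y x where yx: "infinite (labels A u y)" "(y, x) \<in> links A" "finite (labels A u x)"
      by (rule first_finite_link[OF v uw(2)])
    obtain A' where A': "A \<subseteq> A'" "A' \<subseteq> V \<times> V \<times> UNIV" "(links A')\<^sup>+ = (links A)\<^sup>+" "infinite (labels A' u x)"
      "graph_cstar_algebra (mgraph V A) \<cong>\<^sub>\<star> graph_cstar_algebra (mgraph V A')"
      by (rule add_arcs_isomorphic[OF less.prems yx])
    have "links A \<subseteq> V \<times> V" using less.prems by (auto simp: links_def)
    then have "(links A)\<^sup>+ \<subseteq> V \<times> V" by (rule trancl_subset_Sigma)
    then have fin: "finite (?D A)"
      using assms(1) by (rule_tac finite_subset[of _ "V \<times> V"]) auto
    have "labels A u y \<noteq> {}" using yx by auto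
    then have "(u, y) \<in> links A" by (auto simp: labels_def links_def)
    then have "(u, x) \<in> (links A)\<^sup>+" using yx(2) by (blast intro: trancl_into_trancl r_into_trancl)
    then have "(u, x) \<in> ?D A" "(u, x) \<notin> ?D A'" using yx(3) A'(4) by auto
    moreover have "?D A' \<subseteq> ?D A"
      using A'(3) finite_subset[OF labels_mono[OF A'(1)]] by auto
    ultimately have "card (?D A') < card (?D A)" by (intro psubset_card_mono fin) blast
    then have "graph_cstar_algebra (mgraph V A') \<cong>\<^sub>\<star> graph_cstar_algebra (mgraph V (saturation A'))"
      using A' covered_mono[OF less.prems(2) A'(1,3)] by (intro less.hyps) auto
    then show ?thesis using star_isomorphic_trans[OF A'(5)] by (simp add: A'(3))
  qed
qed

text \<open>
  The hereditary set to which absence of breaking vertices applies is the set of vertices that can be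
  reached from some \<open>v\<close> receiving infinitely many edges from \<open>u\<close>.
\<close>

lemma no_breaking_vertex_infinite_link:
  assumes wf: "wf_digraph G" and sing: "singular_graph G" and fin: "finite (verts G)"
    and nb: "\<not> (\<exists>v\<in>verts G. breaking_vertex G v)" and uw: "(u, w) \<in> (arcs_ends G)\<^sup>+"
  shows "\<exists>v. infinite {e \<in> arcs G. tail G e = u \<and> head G e = v} \<and> (v, w) \<in> (arcs_ends G)\<^sup>*"
proof -
  interpret wf_digraph G by (rule wf)
  define I where "I = {v. infinite {e \<in> arcs G. tail G e = u \<and> head G e = v}}"
  define H where "H = (arcs_ends G)\<^sup>* `` I"
  obtain x where ux: "(u, x) \<in> arcs_ends G" and xw: "(x, w) \<in> (arcs_ends G)\<^sup>*"
    using uw by (meson tranclD)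
  then obtain e where e: "e \<in> arcs G" "tail G e = u" "head G e = x"
    by (auto simp: arcs_ends_def arc_to_ends_def)
  have I_V: "I \<subseteq> verts G"
  proof
    fix v assume "v \<in> I"
    then have "{e \<in> arcs G. tail G e = u \<and> head G e = v} \<noteq> {}" unfolding I_def by fastforce
    then show "v \<in> verts G" by auto
  qed
  have "y \<in> verts G" if "(v, y) \<in> (arcs_ends G)\<^sup>*" "v \<in> verts G" for v y
    using that by (induction rule: rtrancl_induct) (auto simp: arcs_ends_def arc_to_ends_def)
  then have "H \<subseteq> verts G" using I_V by (auto simp: H_def)
  moreover have "z \<in> H" if "y \<in> H" "y \<rightarrow>\<^sup>*\<^bsub>G\<^esub> z" for y z
  proof -
    have "(y, z) \<in> (arcs_ends G)\<^sup>*" using that(2) unfolding reachable_def by (rule rtrancl_on_rtranclI)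
    then show ?thesis using that(1) by (auto simp: H_def intro: rtrancl_trans)
  qed
  ultimately have H: "hereditary G H" by (simp add: hereditary_def)
  have "x \<in> H"
  proof (cases "u \<in> H")
    \<comment> \<open>If \<open>u\<close> is reachable from one of its own infinite targets, then so
      is its successor \<open>x\<close>.\<close>
    case True
    then show ?thesis using ux by (auto simp: H_def intro: rtrancl_into_rtrancl)
  next
    case False
    have u: "u \<in> verts G" using e by auto
    \<comment> \<open>Each vertex outside \<open>H\<close> receives only finitely many edges from
      \<open>u\<close>, and there are finitely many such vertices. So \<open>?E\<close> is finite,
      hence empty because \<open>u\<close> is not breaking.\<close>
    let ?E = "{e \<in> out_arcs G u. head G e \<in> verts G - H}"
    have "?E \<subseteq> (\<Union>y\<in>verts G - H. {e \<in> arcs G. tail G e = u \<and> head G e = y})" by auto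
    moreover have "finite {e \<in> arcs G. tail G e = u \<and> head G e = y}" if "y \<notin> H" for y
      using that by (auto simp: H_def I_def)
    ultimately have "finite ?E" using fin by (blast intro: finite_subset)
    moreover have "infinite (out_arcs G u)"
      using sing u e by (fastforce simp: singular_graph_def)
    ultimately have "?E = {}"
      using nb u False H unfolding breaking_vertex_def by blast
    then show ?thesis using e by auto
  qed
  then obtain v where "v \<in> I" "(v, x) \<in> (arcs_ends G)\<^sup>*" by (auto simp: H_def)
  then show ?thesis using xw unfolding I_def by (blast intro: rtrancl_trans)
qed

theorem corollary6p19:
  fixes G :: "('v, 'e) pre_digraph"
  assumes "wf_digraph G"
    and "countable (arcs G)"
    and "singular_graph G"
    and "finite (verts G)"
    and "\<not> (\<exists>v\<in>verts G. breaking_vertex G v)"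
  shows "graph_cstar_algebra G \<cong>\<^sub>\<star> graph_cstar_algebra (amplification G)"
proof -
  interpret wf_digraph G by (rule assms(1))
  \<comment> \<open>Countability supplies the numbering. It runs over all edges at once, so the
    labels of a single pair may form any subset of the natural numbers.\<close>
  define b where "b e = (tail G e, head G e, to_nat_on (arcs G) e)" for e
  define A where "A = b ` arcs G"
  define A' where "A' = {(u, w, n :: nat). (u, w) \<in> arcs_ends G}"
  have inj: "inj_on b (arcs G)"
    using inj_on_to_nat_on[OF assms(2)] by (auto simp: b_def inj_on_def)
  have links: "links A = arcs_ends G" "links A' = arcs_ends G"
    by (auto simp: links_def A_def A'_def b_def arcs_ends_def arc_to_ends_def)
  have V: "A \<subseteq> verts G \<times> verts G \<times> UNIV" "A' \<subseteq> verts G \<times> verts G \<times> UNIV"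
    by (auto simp: A_def A'_def b_def arcs_ends_def arc_to_ends_def)
  have "infinite (labels A u v)" if "infinite {e \<in> arcs G. tail G e = u \<and> head G e = v}" for u v
  proof
    assume "finite (labels A u v)"
    moreover have "to_nat_on (arcs G) ` {e \<in> arcs G. tail G e = u \<and> head G e = v} \<subseteq> labels A u v"
      by (auto simp: labels_def A_def b_def)
    ultimately have "finite (to_nat_on (arcs G) ` {e \<in> arcs G. tail G e = u \<and> head G e = v})"
      by (rule finite_subset[rotated])
    moreover have "inj_on (to_nat_on (arcs G)) {e \<in> arcs G. tail G e = u \<and> head G e = v}"
      by (rule inj_on_subset[OF inj_on_to_nat_on[OF assms(2)]]) blast
    ultimately show False using that by (simp add: finite_image_iff)
  qed
  then have cov: "covered A"
    using no_breaking_vertex_infinite_link[OF assms(1,3-5)] unfolding covered_def links by blast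
  have cov': "covered A'"
    unfolding covered_def links
  proof clarify
    fix u w assume "(u, w) \<in> (arcs_ends G)\<^sup>+"
    then obtain v where "(u, v) \<in> arcs_ends G" "(v, w) \<in> (arcs_ends G)\<^sup>*" by (meson tranclD)
    then show "\<exists>v. infinite (labels A' u v) \<and> (v, w) \<in> (arcs_ends G)\<^sup>*"
      by (intro exI[of _ v]) (simp add: labels_def A'_def)
  qed
  have amp: "amplification G = mgraph (verts G) A'"
    by (auto simp: amplification_def mgraph_def A'_def arcs_ends_def arc_to_ends_def)
  have 1: "graph_cstar_algebra G \<cong>\<^sub>\<star> graph_cstar_algebra (mgraph (verts G) A)"
    using inj by (intro graph_isomorphic_relabel[where b = b] assms wf_mgraph V singular_mgraph cov)
      (auto simp: bij_betw_def A_def b_def)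
  \<comment> \<open>\<open>A\<close> and \<open>A'\<close> have the same links, hence the same
    saturation, where the two chains of isomorphisms meet.\<close>
  let ?S = "{(u, w, n :: nat). (u, w) \<in> (arcs_ends G)\<^sup>+}"
  have 2: "graph_cstar_algebra (mgraph (verts G) A) \<cong>\<^sub>\<star> graph_cstar_algebra (mgraph (verts G) ?S)"
    using covered_isomorphic_saturation[OF assms(4) V(1) cov] by (simp add: links)
  have "graph_cstar_algebra (mgraph (verts G) A') \<cong>\<^sub>\<star> graph_cstar_algebra (mgraph (verts G) ?S)"
    using covered_isomorphic_saturation[OF assms(4) V(2) cov'] by (simp add: links)
  then have 3: "graph_cstar_algebra (mgraph (verts G) ?S) \<cong>\<^sub>\<star> graph_cstar_algebra (mgraph (verts G) A')"
    by (rule star_isomorphic_sym[OF cstar_algebra.axioms(1)[OF cstar_algebra_graph[OF wf_mgraph[OF V(2)]]]])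
  show ?thesis
    unfolding amp by (rule star_isomorphic_trans[OF star_isomorphic_trans[OF 1 2] 3])
qed

end
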